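(* Let $\mathcal{M}$ be the family of $3$-graphs defined in the context. Then $\mathrm{proj}\,\Omega(\mathcal{M})=[0,1]$, and $g(\mathcal{M},x)\le 4/9$ for all $x\in[0,1]$. Moreover, $g(\mathcal{M},x)=4/9$ if and only if $x\in\{5/6,\,8/9\}$.
   Context: An $r$-graph is an $r$-uniform hypergraph; $\mathcal{F}$-free means containing no member of $\mathcal{F}$ as a subgraph. "Contained in" means isomorphic to a subgraph of. Transversal number: $\tau(\mathcal{H})$ is the minimum size of a vertex set meeting every edge ($0$ if no edges). For $\ell\ge3$, $\mathcal{K}^3_{\ell+1}$ is the collection of $3$-graphs $F$ on at most $(\ell+1)+\binom{\ell+1}{2}$ vertices with an $(\ell+1)$-set $S$ (a core) every pair of which lies in an edge of $F$. Blowup of a $3$-graph $\mathcal{T}$ on $[s]$: replace vertex $i$ by a set of size $t_i\ge1$ (pairwise disjoint), each edge by the complete $3$-partite $3$-graph on the corresponding sets. $\mathcal{G}^1_n$: disjoint $A,B$, $|A|=\lfloor n/3\rfloor$, $|B|=\lceil 2n/3\rceil$, edges $\{a,b,b'\}$, $a\in A$, $\{b,b'\}\subseteq B$. $\mathcal{G}^2_6$: all triples of $[6]$ except $\{1,2,3\},\{1,2,6\},\{3,4,5\},\{4,5,6\}$; for $n>6$, $\mathcal{G}^2_n$ is a blowup of $\mathcal{G}^2_6$ on $n$ vertices with maximum number of edges. $\mathcal{M}=M_1\cup M_2\cup M_3$ with $M_1=\{K_5^{3-}\}$ (complete $3$-graph on $5$ vertices minus an edge), $M_2$ = all $F\in\mathcal{K}^3_7$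 with a core $S$ such that $\tau(F[S])\ge2$, $M_3$ = all $F\in\mathcal{K}^3_6$ not contained in $\mathcal{G}^1_n$ for any $n\ge1$ and not contained in $\mathcal{G}^2_n$ for any $n\ge 6$. For a $3$-graph $\mathcal{H}$ on $n$ vertices, the shadow is $\partial\mathcal{H}=\{A\in\binom{V(\mathcal{H})}{2}: A\subseteq B \text{ for some } B\in\mathcal{H}\}$, the edge density is $d(\mathcal{H})=|\mathcal{H}|/\binom{n}{3}$ and the shadow density is $d(\partial\mathcal{H})=|\partial\mathcal{H}|/\binom{n}{2}$. The feasible region $\Omega(\mathcal{F})$ is the set of $(x,y)\in[0,1]^2$ for which there is a sequence of $\mathcal{F}$-free $3$-graphs $\mathcal{H}_k$ with $v(\mathcal{H}_k)\to\infty$, $d(\partial\mathcal{H}_k)\to x$ and $d(\mathcal{H}_k)\to y$. $\mathrm{proj}\,\Omega(\mathcal{F})=\{x: \exists y, (x,y)\in\Omega(\mathcal{F})\}$, and for $x\in\mathrm{proj}\,\Omega(\mathcal{F})$, $g(\mathcal{F},x)=\max\{y:(x,y)\in\Omega(\mathcal{F})\}$ (this maximum exists). *)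

theory Defs
  imports Complex_Main
begin

text \<open>A (finite) 3-graph with vertices in nat: a pair (vertex set, edge set).\<close>
type_synonym hg = "nat set \<times> nat set set"

definition hg3 :: "hg \<Rightarrow> bool" where
  "hg3 H \<longleftrightarrow> finite (fst H) \<and> (\<forall>e\<in>snd H. e \<subseteq> fst H \<and> card e = 3)"

definition contained :: "hg \<Rightarrow> hg \<Rightarrow> bool" where
  "contained F H \<longleftrightarrow>
     (\<exists>f. inj_on f (fst F) \<and> f ` fst F \<subseteq> fst H \<and> (\<forall>e\<in>snd F. f ` e \<in> snd H))"

definition hfree :: "hg set \<Rightarrow> hg \<Rightarrow> bool" where
  "hfree Fam H \<longleftrightarrow> \<not> (\<exists>F\<in>Fam. contained F H)"

definition shadow :: "hg \<Rightarrow> nat set set" where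
  "shadow H = {A. A \<subseteq> fst H \<and> card A = 2 \<and> (\<exists>B\<in>snd H. A \<subseteq> B)}"

definition edge_density :: "hg \<Rightarrow> real" where
  "edge_density H = real (card (snd H)) / real (card (fst H) choose 3)"

definition shadow_density :: "hg \<Rightarrow> real" where
  "shadow_density H = real (card (shadow H)) / real (card (fst H) choose 2)"

definition feasible_region :: "hg set \<Rightarrow> (real \<times> real) set" where
  "feasible_region Fam = {(x, y). x \<in> {0..1} \<and> y \<in> {0..1} \<and>
     (\<exists>Hs :: nat \<Rightarrow> hg. (\<forall>k. hg3 (Hs k) \<and> hfree Fam (Hs k)) \<and>
        filterlim (\<lambda>k. card (fst (Hs k))) at_top sequentially \<and>
        (\<lambda>k. shadow_density (Hs k)) \<longlonglongrightarrow> x \<and>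
        (\<lambda>k. edge_density (Hs k)) \<longlonglongrightarrow> y)}"

definition proj_region :: "hg set \<Rightarrow> real set" where
  "proj_region Fam = {x. \<exists>y. (x, y) \<in> feasible_region Fam}"

definition feasible_g :: "hg set \<Rightarrow> real \<Rightarrow> real" where
  "feasible_g Fam x = (GREATEST y. (x, y) \<in> feasible_region Fam)"

definition tau :: "nat set \<Rightarrow> nat set set \<Rightarrow> nat" where
  "tau V E = (LEAST k. \<exists>T\<subseteq>V. card T = k \<and> (\<forall>e\<in>E. T \<inter> e \<noteq> {}))"

definition is_core :: "hg \<Rightarrow> nat set \<Rightarrow> nat \<Rightarrow> bool" where
  "is_core F S m \<longleftrightarrow> S \<subseteq> fst F \<and> card S = m \<and>
     (\<forall>u\<in>S. \<forall>v\<in>S. u \<noteq> v \<longrightarrow> (\<exists>e\<in>snd F. {u, v} \<subseteq> e))"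

definition Kfam :: "nat \<Rightarrow> hg set" where
  "Kfam l = {F. hg3 F \<and> card (fst F) \<le> (l + 1) + ((l + 1) choose 2) \<and>
                (\<exists>S. is_core F S (l + 1))}"

definition K5minus :: hg where
  "K5minus = ({0..<5}, {e. e \<subseteq> {0..<5} \<and> card e = 3} - {{0, 1, 2}})"

definition G1 :: "nat \<Rightarrow> hg" where
  "G1 n = ({0..<n}, {e. \<exists>a b b'. a < n div 3 \<and> n div 3 \<le> b \<and> b < n \<and>
                         n div 3 \<le> b' \<and> b' < n \<and> b \<noteq> b' \<and> e = {a, b, b'}})"

definition G26_edges :: "nat set set" where
  "G26_edges = {e. e \<subseteq> {1..6} \<and> card e = 3} - {{1,2,3}, {1,2,6}, {3,4,5}, {4,5,6}}"

definition blowup_G26 :: "nat \<Rightarrow> hg \<Rightarrow> bool" where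
  "blowup_G26 n H \<longleftrightarrow> (\<exists>\<phi> :: nat \<Rightarrow> nat. \<phi> ` {0..<n} = {1..6} \<and>
     H = ({0..<n}, {e. e \<subseteq> {0..<n} \<and> card e = 3 \<and> \<phi> ` e \<in> G26_edges}))"

definition G2 :: "nat \<Rightarrow> hg \<Rightarrow> bool" where
  "G2 n H \<longleftrightarrow> blowup_G26 n H \<and>
     (\<forall>H'. blowup_G26 n H' \<longrightarrow> card (snd H') \<le> card (snd H))"

definition M2 :: "hg set" where
  "M2 = {F \<in> Kfam 6. \<exists>S. is_core F S 7 \<and> tau S {e \<in> snd F. e \<subseteq> S} \<ge> 2}"

definition M3 :: "hg set" where
  "M3 = {F \<in> Kfam 5. (\<forall>n\<ge>1. \<not> contained F (G1 n)) \<and>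
                      (\<forall>n\<ge>6. \<forall>H. G2 n H \<longrightarrow> \<not> contained F H)}"

definition Mfam :: "hg set" where
  "Mfam = {K5minus} \<union> M2 \<union> M3"

end

theory Submission
  imports Defs
begin

text \<open>
  For a 3-graph \<open>H\<close> let \<open>P\<close> be the symmetric trilinear form of \<open>H\<close> and \<open>Q\<close> the bilinear form of its
  shadow; on uniform weights their diagonals are asymptotically the edge and the shadow density.
  Along \<open>e\<^sub>u - e\<^sub>v\<close> with \<open>uv\<close> not in the shadow, \<open>P(y,y,y)\<close>, \<open>P(x,y,y)\<close> and \<open>Q(y,y)\<close> are affine in \<open>y\<close>,
  so by Zykov symmetrisation any linear combination of them is at most its value at some \<open>y\<close>
  supported on a clique of the shadow. If \<open>H\<close> is M-free, then the edges inside such a clique form a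
  star or a subgraph of \<open>G26\<close>, hence \<open>P(y,y,y) \<le> 4/9\<close>, and near equality \<open>Q(y,y)\<close> is close to \<open>8/9\<close>
  (star) or \<open>5/6\<close> (a full copy of \<open>G26\<close> with nearly uniform weights).

  Thus for near-extremal \<open>x\<close> only a value of \<open>Q(x,x)\<close> strictly between \<open>5/6\<close> and \<open>8/9\<close> has to be excluded.
  Symmetrising \<open>\<alpha> P(y,y,y) + P(x,y,y) - g Q(y,y)\<close> with \<open>\<alpha>\<close> large and \<open>g\<close> small then yields a copy \<open>S\<close> of
  \<open>G26\<close> to which almost all vertices are attached by almost the maximal number of edges. Since \<open>M3\<close>
  forces every few vertices together with \<open>S\<close> to be \<open>G26\<close>-colourable, almost all vertices get a
  unique colour, and the shadow is essentially 6-partite: \<open>Q(x,x)\<close> is at most about \<open>5/6\<close>.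
\<close>


section \<open>Multilinear forms of a 3-graph\<close>

text \<open>Both extremal structures reach the same value: \<open>3 * a * (1 - a)^2\<close> is at
  most \<open>4/9\<close>, with equality at \<open>a = 1/3\<close>, and \<open>G26_poly\<close> is
  at most \<open>2/27\<close>, with equality at equal weights, where \<open>6 * 2/27 = 4/9\<close>.
  Their shadow values are \<open>1 - 1/9 = 8/9\<close> (a centre of weight \<open>1/3\<close>, the
  rest spread thinly) and \<open>1 - 6/36 = 5/6\<close>. The obstacle is that symmetrisation
  replaces \<open>x\<close> by some \<open>y\<close> and forgets \<open>x\<close>, so it can only
  bracket the shadow value of \<open>x\<close>; a mixture of the two structures is not excluded. The
  form with \<open>x\<close> in one slot keeps the memory: it averages, over \<open>x\<close>, the
  links of vertices measured by \<open>y\<close>. The penalty on the shadow makes both outcomes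
  informative: if a star still comes out, the shadow of \<open>x\<close> is about as large as that
  of the star; if a copy of \<open>G26\<close> comes out, at most order \<open>g\<close> is lost in
  the links. The scales are forced. Errors of order \<theta> get divided by the penalty factor
  \<open>g\<close>, hence \<theta> is \<open>g^2\<close>. A deficit of \<open>\<theta>^2\<close> for
  \<open>y\<close> needs a factor \<alpha> of order \<open>1 / \<theta>^2\<close>, and an error of
  order \<theta> in the other form then needs a deficit of \<open>\<theta>^3\<close>, that is
  \<open>g^6\<close>, for \<open>x\<close>.\<close>

definition tri :: "nat set set \<Rightarrow> nat set \<Rightarrow> (nat \<Rightarrow> real) \<Rightarrow> (nat \<Rightarrow> real) \<Rightarrow> (nat \<Rightarrow> real) \<Rightarrow> real" where
  "tri E V x y z = (\<Sum>a\<in>V. \<Sum>b\<in>V. \<Sum>c\<in>V. of_bool ({a, b, c} \<in> E) * (x a * y b * z c))"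

definition bil :: "nat set set \<Rightarrow> nat set \<Rightarrow> (nat \<Rightarrow> real) \<Rightarrow> (nat \<Rightarrow> real) \<Rightarrow> real" where
  "bil D V x y = (\<Sum>a\<in>V. \<Sum>b\<in>V. of_bool ({a, b} \<in> D) * (x a * y b))"

definition weights :: "nat set \<Rightarrow> (nat \<Rightarrow> real) set" where
  "weights V = {x. (\<forall>v. 0 \<le> x v) \<and> (\<forall>v. v \<notin> V \<longrightarrow> x v = 0) \<and> sum x V = 1}"

definition shift :: "nat \<Rightarrow> nat \<Rightarrow> real \<Rightarrow> (nat \<Rightarrow> real) \<Rightarrow> nat \<Rightarrow> real" where
  "shift u v t y = (\<lambda>w. y w + t * (of_bool (w = u) - of_bool (w = v)))"

text \<open>Affinity on whole lines, for arbitrary real \<open>y\<close>, is closed under sums and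
  under multiples of either sign. Convexity would not survive the negative multiple of the shadow
  form that is used later.\<close>

definition affine_along :: "(nat \<Rightarrow> nat \<Rightarrow> bool) \<Rightarrow> nat set \<Rightarrow> ((nat \<Rightarrow> real) \<Rightarrow> real) \<Rightarrow> bool" where
  "affine_along R V \<Phi> \<longleftrightarrow>
     (\<forall>y. \<forall>u\<in>V. \<forall>v\<in>V. u \<noteq> v \<longrightarrow> \<not> R u v \<longrightarrow> (\<exists>c. \<forall>t. \<Phi> (shift u v t y) = \<Phi> y + c * t))"

definition covered :: "hg \<Rightarrow> nat \<Rightarrow> nat \<Rightarrow> bool" where
  "covered H u v \<longleftrightarrow> (\<exists>e\<in>snd H. {u, v} \<subseteq> e)"

definition clique :: "hg \<Rightarrow> nat set \<Rightarrow> bool" where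
  "clique H S \<longleftrightarrow> S \<subseteq> fst H \<and> (\<forall>u\<in>S. \<forall>v\<in>S. u \<noteq> v \<longrightarrow> covered H u v)"

lemma card3_distinct: "card {a, b, c} = 3 \<longleftrightarrow> a \<noteq> b \<and> a \<noteq> c \<and> b \<noteq> c"
  by (auto simp: card_insert_if)

lemma hg3_edge_distinct:
  assumes "hg3 H" "{a, b, c} \<in> snd H"
  shows "a \<noteq> b" "a \<noteq> c" "b \<noteq> c"
  using assms card3_distinct[of a b c] unfolding hg3_def by auto

lemma weights_nonneg: "x \<in> weights V \<Longrightarrow> 0 \<le> x v"
  by (simp add: weights_def)

lemma weights_sum: "x \<in> weights V \<Longrightarrow> sum x V = 1"
  by (simp add: weights_def)

lemma weights_le_1:
  assumes "finite V" "x \<in> weights V" shows "x v \<le> 1"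
proof (cases "v \<in> V")
  case True
  then have "x v \<le> sum x V"
    using assms by (intro member_le_sum) (auto simp: weights_def)
  then show ?thesis using assms by (simp add: weights_def)
qed (use assms in \<open>auto simp: weights_def\<close>)

lemma affine_along_add:
  assumes "affine_along R V f" "affine_along R V g"
  shows "affine_along R V (\<lambda>y. f y + g y)"
  unfolding affine_along_def
proof (intro allI ballI impI)
  fix y u v assume h: "u \<in> V" "v \<in> V" "u \<noteq> v" "\<not> R u v"
  obtain c where c: "\<And>t. f (shift u v t y) = f y + c * t"
    using assms(1) h unfolding affine_along_def by blast
  obtain d where d: "\<And>t. g (shift u v t y) = g y + d * t"
    using assms(2) h unfolding affine_along_def by blast
  have "\<forall>t. f (shift u v t y) + g (shift u v t y) = f y + g y + (c + d) * t"
    by (simp add: c d algebra_simps)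
  then show "\<exists>c. \<forall>t. f (shift u v t y) + g (shift u v t y) = f y + g y + c * t" by blast
qed

lemma affine_along_cmult:
  assumes "affine_along R V f"
  shows "affine_along R V (\<lambda>y. k * f y)"
  unfolding affine_along_def
proof (intro allI ballI impI)
  fix y u v assume h: "u \<in> V" "v \<in> V" "u \<noteq> v" "\<not> R u v"
  obtain c where c: "\<And>t. f (shift u v t y) = f y + c * t"
    using assms(1) h unfolding affine_along_def by blast
  have "\<forall>t. k * f (shift u v t y) = k * f y + (k * c) * t"
    by (simp add: c algebra_simps)
  then show "\<exists>c. \<forall>t. k * f (shift u v t y) = k * f y + c * t" by blast
qed

text \<open>Every coefficient of \<open>t^2\<close> or \<open>t^3\<close> contains a product
  \<open>d a * d b\<close> for two distinct vertices of one edge. Such a product is nonzero only if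
  these vertices are \<open>u\<close> and \<open>v\<close>, but this pair lies in no edge.\<close>

lemma affine_along_tri:
  assumes H: "hg3 H"
  shows "affine_along (covered H) (fst H) (\<lambda>y. tri (snd H) (fst H) y y y)"
  unfolding affine_along_def
proof (intro allI ballI impI)
  fix y :: "nat \<Rightarrow> real" and u v assume uv: "u \<noteq> v" "\<not> covered H u v"
  define d where "d = (\<lambda>w. of_bool (w = u) - of_bool (w = v) :: real)"
  have d0: "d a * d b = 0" if "{a, b} \<subseteq> e" "e \<in> snd H" "a \<noteq> b" for a b e
    using that uv unfolding d_def covered_def by (auto simp: of_bool_def)
  define c where "c = (\<Sum>p\<in>fst H. \<Sum>q\<in>fst H. \<Sum>r\<in>fst H. of_bool ({p, q, r} \<in> snd H) *
       (d p * y q * y r + y p * d q * y r + y p * y q * d r))"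
  have term_eq: "of_bool ({p, q, r} \<in> snd H) * ((y p + t * d p) * (y q + t * d q) * (y r + t * d r)) =
      of_bool ({p, q, r} \<in> snd H) * (y p * y q * y r) + (of_bool ({p, q, r} \<in> snd H) *
       (d p * y q * y r + y p * d q * y r + y p * y q * d r)) * t" for p q r t
  proof (cases "{p, q, r} \<in> snd H")
    case True
    note ne = hg3_edge_distinct[OF H True]
    have z: "d p * d q = 0" "d p * d r = 0" "d q * d r = 0"
      using d0[OF _ True] ne by auto
    have "(y p + t * d p) * (y q + t * d q) * (y r + t * d r) =
       y p * y q * y r + (d p * y q * y r + y p * d q * y r + y p * y q * d r) * t
       + t^2 * ((d p * d q) * y r + (d p * d r) * y q + (d q * d r) * y p) + t^3 * (d p * d q) * d r"
      by (simp add: algebra_simps power2_eq_square power3_eq_cube)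
    then show ?thesis using True z by simp
  qed simp
  have "\<forall>t. tri (snd H) (fst H) (shift u v t y) (shift u v t y) (shift u v t y) =
            tri (snd H) (fst H) y y y + c * t"
    unfolding tri_def shift_def d_def[symmetric] c_def
    by (simp add: term_eq sum.distrib sum_distrib_right d_def[THEN fun_cong, symmetric])
  then show "\<exists>c. \<forall>t. tri (snd H) (fst H) (shift u v t y) (shift u v t y) (shift u v t y) =
            tri (snd H) (fst H) y y y + c * t" by blast
qed

lemma affine_along_tri2:
  assumes H: "hg3 H"
  shows "affine_along (covered H) (fst H) (\<lambda>y. tri (snd H) (fst H) x y y)"
  unfolding affine_along_def
proof (intro allI ballI impI)
  fix y :: "nat \<Rightarrow> real" and u v assume uv: "u \<noteq> v" "\<not> covered H u v"
  define d where "d = (\<lambda>w. of_bool (w = u) - of_bool (w = v) :: real)"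
  have d0: "d a * d b = 0" if "{a, b} \<subseteq> e" "e \<in> snd H" "a \<noteq> b" for a b e
    using that uv unfolding d_def covered_def by (auto simp: of_bool_def)
  define c where "c = (\<Sum>p\<in>fst H. \<Sum>q\<in>fst H. \<Sum>r\<in>fst H. of_bool ({p, q, r} \<in> snd H) *
       (x p * d q * y r + x p * y q * d r))"
  have term_eq: "of_bool ({p, q, r} \<in> snd H) * (x p * (y q + t * d q) * (y r + t * d r)) =
      of_bool ({p, q, r} \<in> snd H) * (x p * y q * y r) + (of_bool ({p, q, r} \<in> snd H) *
       (x p * d q * y r + x p * y q * d r)) * t" for p q r t
  proof (cases "{p, q, r} \<in> snd H")
    case True
    note ne = hg3_edge_distinct[OF H True]
    have z: "d q * d r = 0"
      using d0[OF _ True] ne by auto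
    have "x p * (y q + t * d q) * (y r + t * d r) =
       x p * y q * y r + (x p * d q * y r + x p * y q * d r) * t + t^2 * (d q * d r) * x p"
      by (simp add: algebra_simps power2_eq_square)
    then show ?thesis using True z by simp
  qed simp
  have "\<forall>t. tri (snd H) (fst H) x (shift u v t y) (shift u v t y) =
            tri (snd H) (fst H) x y y + c * t"
    unfolding tri_def shift_def d_def[symmetric] c_def
    by (simp add: term_eq sum.distrib sum_distrib_right d_def[THEN fun_cong, symmetric])
  then show "\<exists>c. \<forall>t. tri (snd H) (fst H) x (shift u v t y) (shift u v t y) =
            tri (snd H) (fst H) x y y + c * t" by blast
qed

lemma in_shadow_iff:
  assumes "hg3 H"
  shows "{a, b} \<in> shadow H \<longleftrightarrow> a \<noteq> b \<and> covered H a b"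
proof -
  have "card {a, b} = 2 \<longleftrightarrow> a \<noteq> b" by (auto simp: card_insert_if)
  then show ?thesis
    using assms unfolding shadow_def covered_def hg3_def by blast
qed

lemma affine_along_bil:
  assumes H: "hg3 H"
  shows "affine_along (covered H) (fst H) (\<lambda>y. bil (shadow H) (fst H) y y)"
  unfolding affine_along_def
proof (intro allI ballI impI)
  fix y :: "nat \<Rightarrow> real" and u v assume uv: "u \<noteq> v" "\<not> covered H u v"
  define d where "d = (\<lambda>w. of_bool (w = u) - of_bool (w = v) :: real)"
  define c where "c = (\<Sum>p\<in>fst H. \<Sum>q\<in>fst H. of_bool ({p, q} \<in> shadow H) * (d p * y q + y p * d q))"
  have term_eq: "of_bool ({p, q} \<in> shadow H) * ((y p + t * d p) * (y q + t * d q)) =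
      of_bool ({p, q} \<in> shadow H) * (y p * y q) +
      (of_bool ({p, q} \<in> shadow H) * (d p * y q + y p * d q)) * t" for p q t
  proof (cases "{p, q} \<in> shadow H")
    case True
    then have z: "d p * d q = 0"
      using uv unfolding d_def in_shadow_iff[OF H] covered_def by (auto simp: of_bool_def)
    have "(y p + t * d p) * (y q + t * d q) =
       y p * y q + (d p * y q + y p * d q) * t + t^2 * (d p * d q)"
      by (simp add: algebra_simps power2_eq_square)
    then show ?thesis using True z by simp
  qed simp
  have "\<forall>t. bil (shadow H) (fst H) (shift u v t y) (shift u v t y) =
            bil (shadow H) (fst H) y y + c * t"
    unfolding bil_def shift_def d_def[symmetric] c_def
    by (simp add: term_eq sum.distrib sum_distrib_right d_def[THEN fun_cong, symmetric])
  then show "\<exists>c. \<forall>t. bil (shadow H) (fst H) (shift u v t y) (shift u v t y) =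
            bil (shadow H) (fst H) y y + c * t" by blast
qed

lemma shift_weights:
  assumes "finite V" "y \<in> weights V" "u \<in> V" "v \<in> V" "u \<noteq> v" "- y u \<le> t" "t \<le> y v"
  shows "shift u v t y \<in> weights V"
proof -
  have "(\<Sum>w\<in>V. t * (of_bool (w = u) - of_bool (w = v))) = 0"
    using assms by (simp add: sum_distrib_left[symmetric] sum_subtractf of_bool_def)
  then show ?thesis
    using assms by (auto simp: weights_def shift_def sum.distrib)
qed

text \<open>Zykov symmetrisation: moving all weight of one of two unrelated vertices onto the other
  does not decrease \<open>\<Phi>\<close> in one of the two directions, and shrinks the support.\<close>

lemma symmetrization:
  assumes "finite V" "affine_along R V \<Phi>" "x \<in> weights V"
  shows "\<exists>y\<in>weights V. \<Phi> x \<le> \<Phi> y \<and> (\<forall>u v. 0 < y u \<longrightarrow> 0 < y v \<longrightarrow> u \<noteq> v \<longrightarrow> R u v)"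
  using assms(3)
proof (induction "card {w. 0 < x w}" arbitrary: x rule: less_induct)
  case less
  show ?case
  proof (cases "\<forall>u v. 0 < x u \<longrightarrow> 0 < x v \<longrightarrow> u \<noteq> v \<longrightarrow> R u v")
    case True
    then show ?thesis using less.prems by blast
  next
    case False
    then obtain u v where uv: "0 < x u" "0 < x v" "u \<noteq> v" "\<not> R u v" by blast
    have supp: "{w. 0 < x w} \<subseteq> V" using less.prems by (auto simp: weights_def)
    have uV: "u \<in> V" "v \<in> V" using uv supp by auto
    obtain c where c: "\<And>t. \<Phi> (shift u v t x) = \<Phi> x + c * t"
      using assms(2) uv uV unfolding affine_along_def by blast
    define t where "t = (if c \<ge> 0 then x v else - x u)"
    have ct: "0 \<le> c * t" using uv by (auto simp: t_def mult_le_0_iff)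
    have tb: "- x u \<le> t" "t \<le> x v" using uv by (auto simp: t_def)
    have w: "shift u v t x \<in> weights V"
      by (rule shift_weights) (use assms less.prems uv uV tb in auto)
    have "{w. 0 < shift u v t x w} \<subset> {w. 0 < x w}"
      using uv by (auto simp: shift_def t_def of_bool_def split: if_splits)
    then have "card {w. 0 < shift u v t x w} < card {w. 0 < x w}"
      using supp assms(1) by (meson finite_subset psubset_card_mono)
    from less.hyps[OF this w] obtain y where "y \<in> weights V" "\<Phi> (shift u v t x) \<le> \<Phi> y"
      "\<forall>u v. 0 < y u \<longrightarrow> 0 < y v \<longrightarrow> u \<noteq> v \<longrightarrow> R u v" by blast
    then show ?thesis using c[of t] ct by (intro bexI[of _ y]) auto
  qed
qed


section \<open>Cliques of the shadow of an M-free 3-graph\<close>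

definition induced :: "hg \<Rightarrow> nat set \<Rightarrow> hg" where
  "induced H U = (U, {e \<in> snd H. e \<subseteq> U})"

text \<open>This is the semibipartite structure of \<open>G1\<close>, expressed through a marking so
  that it pulls back along containments.\<close>

definition one_marked :: "(nat \<Rightarrow> bool) \<Rightarrow> hg \<Rightarrow> bool" where
  "one_marked \<alpha> H \<longleftrightarrow> (\<forall>e\<in>snd H. \<exists>v\<in>e. \<alpha> v \<and> (\<forall>w\<in>e. \<alpha> w \<longrightarrow> w = v))"

text \<open>A homomorphism to \<open>G26\<close>. Unlike in a blowup, colours may be missing, so the
  property passes to every contained 3-graph.\<close>

definition G26_col :: "(nat \<Rightarrow> nat) \<Rightarrow> hg \<Rightarrow> bool" where
  "G26_col \<phi> H \<longleftrightarrow> (\<forall>v\<in>fst H. \<phi> v \<in> {1..6}) \<and> (\<forall>e\<in>snd H. \<phi> ` e \<in> G26_edges)"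

text \<open>\<open>G1\<close> with a free size \<open>t\<close> of the side that each edge meets
  once. Varying \<open>t\<close> realises all positive shadow densities.\<close>

definition semibip :: "nat \<Rightarrow> nat \<Rightarrow> hg" where
  "semibip t n = ({0..<n}, {e. \<exists>a b b'. a < t \<and> t \<le> b \<and> b < n \<and> t \<le> b' \<and> b' < n \<and> b \<noteq> b' \<and> e = {a, b, b'}})"

lemma hg3_finite: "hg3 H \<Longrightarrow> finite (fst H)"
  and hg3_card: "hg3 H \<Longrightarrow> e \<in> snd H \<Longrightarrow> card e = 3"
  and hg3_sub: "hg3 H \<Longrightarrow> e \<in> snd H \<Longrightarrow> e \<subseteq> fst H"
  by (auto simp: hg3_def)

lemma clique_finite: "hg3 H \<Longrightarrow> clique H S \<Longrightarrow> finite S"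
  by (meson clique_def finite_subset hg3_finite)

lemma clique_subset: "clique H S \<Longrightarrow> T \<subseteq> S \<Longrightarrow> clique H T"
  unfolding clique_def by blast

lemma hg3_induced: "hg3 H \<Longrightarrow> U \<subseteq> fst H \<Longrightarrow> hg3 (induced H U)"
  unfolding hg3_def induced_def using finite_subset by auto

lemma contained_induced: "U \<subseteq> fst H \<Longrightarrow> contained (induced H U) H"
  unfolding contained_def induced_def by (intro exI[of _ id]) auto

lemma contained_trans:
  assumes "contained F G" "contained G H" "hg3 F"
  shows "contained F H"
proof -
  obtain f where f: "inj_on f (fst F)" "f ` fst F \<subseteq> fst G" "\<forall>e\<in>snd F. f ` e \<in> snd G"
    using assms(1) unfolding contained_def by blast
  obtain g where g: "inj_on g (fst G)" "g ` fst G \<subseteq> fst H" "\<forall>e\<in>snd G. g ` e \<in> snd H"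
    using assms(2) unfolding contained_def by blast
  have "inj_on (g \<circ> f) (fst F)" using f g by (meson comp_inj_on inj_on_subset)
  moreover have "(g \<circ> f) ` fst F \<subseteq> fst H" using f g by force
  moreover have "\<forall>e\<in>snd F. (g \<circ> f) ` e \<in> snd H" using f g by (metis image_comp)
  ultimately show ?thesis unfolding contained_def by blast
qed

text \<open>One covering edge is chosen for each pair of \<open>S\<close>; it brings at most one
  vertex outside \<open>S\<close>. This is exactly the vertex bound in \<open>Kfam\<close>.\<close>

lemma clique_cover:
  assumes H: "hg3 H" and S: "clique H S"
  shows "\<exists>U. S \<subseteq> U \<and> U \<subseteq> fst H \<and> card U \<le> card S + (card S choose 2) \<and>
             is_core (induced H U) S (card S)"
proof -
  have finS: "finite S" using assms clique_finite by blast
  define Ps where "Ps = {P. P \<subseteq> S \<and> card P = 2}"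
  have finP: "finite Ps" unfolding Ps_def using finS by simp
  have cardP: "card Ps = card S choose 2" unfolding Ps_def using finS by (rule n_subsets)
  have "\<forall>P\<in>Ps. \<exists>e\<in>snd H. P \<subseteq> e"
  proof
    fix P assume "P \<in> Ps"
    then obtain u v where "P = {u, v}" "u \<noteq> v" "u \<in> S" "v \<in> S"
      unfolding Ps_def by (auto simp: card_2_iff)
    then show "\<exists>e\<in>snd H. P \<subseteq> e" using S unfolding clique_def covered_def by blast
  qed
  then obtain g where g: "\<And>P. P \<in> Ps \<Longrightarrow> g P \<in> snd H \<and> P \<subseteq> g P" by metis
  define U where "U = S \<union> (\<Union>P\<in>Ps. g P - P)"
  have c1: "card (g P - P) = 1" if "P \<in> Ps" for P
  proof -
    have "card (g P) = 3" "card P = 2" "finite P"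
      using g[OF that] hg3_card[OF H] that finS by (auto simp: Ps_def intro: finite_subset)
    then show ?thesis using g[OF that] by (simp add: card_Diff_subset)
  qed
  have "card U \<le> card S + card (\<Union>P\<in>Ps. g P - P)" unfolding U_def by (rule card_Un_le)
  also have "card (\<Union>P\<in>Ps. g P - P) \<le> (\<Sum>P\<in>Ps. card (g P - P))" by (rule card_UN_le[OF finP])
  also have "\<dots> = card Ps" using c1 by simp
  finally have cU: "card U \<le> card S + (card S choose 2)" using cardP by simp
  have sub: "U \<subseteq> fst H" unfolding U_def using S g hg3_sub[OF H] unfolding clique_def by blast
  have "is_core (induced H U) S (card S)"
    unfolding is_core_def
  proof (intro conjI ballI impI)
    fix u v assume uv: "u \<in> S" "v \<in> S" "u \<noteq> v"
    then have P: "{u, v} \<in> Ps" unfolding Ps_def by simp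
    then have "g {u, v} \<subseteq> U" unfolding U_def using uv by auto
    then show "\<exists>e\<in>snd (induced H U). {u, v} \<subseteq> e"
      using g[OF P] unfolding induced_def by auto
  qed (auto simp: induced_def U_def)
  then show ?thesis using cU sub U_def by blast
qed

text \<open>Two marked vertices never share an edge, whereas any two core vertices do. So the core
  has at most one marked vertex, and each edge inside the core must contain it.\<close>

lemma one_marked_core:
  assumes "one_marked \<alpha> F" "is_core F S m"
  shows "(\<exists>c\<in>S. \<forall>e\<in>snd F. e \<subseteq> S \<longrightarrow> c \<in> e) \<or> (\<forall>e\<in>snd F. \<not> e \<subseteq> S)"
proof (cases "\<exists>c\<in>S. \<alpha> c")
  case True
  then obtain c where c: "c \<in> S" "\<alpha> c" by blast
  have "c \<in> e" if e: "e \<in> snd F" "e \<subseteq> S" for e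
  proof -
    obtain v where v: "v \<in> e" "\<alpha> v" using assms(1) e unfolding one_marked_def by blast
    show ?thesis
    proof (rule ccontr)
      assume "c \<notin> e"
      then have "v \<noteq> c" using v by blast
      then obtain e' where e': "e' \<in> snd F" "{v, c} \<subseteq> e'"
        using assms(2) v e c unfolding is_core_def by blast
      then obtain w where "\<forall>w'\<in>e'. \<alpha> w' \<longrightarrow> w' = w" using assms(1) unfolding one_marked_def by blast
      then show False using e' v c \<open>v \<noteq> c\<close> by auto
    qed
  qed
  then show ?thesis using c by blast
next
  case False
  have "\<not> e \<subseteq> S" if "e \<in> snd F" for e
  proof -
    obtain v where "v \<in> e" "\<alpha> v" using assms(1) \<open>e \<in> snd F\<close> unfolding one_marked_def by blast
    then show ?thesis using False by blast
  qed
  then show ?thesis by blast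
qed

lemma one_marked_contained:
  assumes "contained F H" "one_marked \<alpha> H" "hg3 F"
  shows "\<exists>\<beta>. one_marked \<beta> F"
proof -
  obtain f where f: "inj_on f (fst F)" "\<forall>e\<in>snd F. f ` e \<in> snd H"
    using assms(1) unfolding contained_def by blast
  have "\<exists>v\<in>e. \<alpha> (f v) \<and> (\<forall>w\<in>e. \<alpha> (f w) \<longrightarrow> w = v)" if e: "e \<in> snd F" for e
  proof -
    have "inj_on f e" using f hg3_sub[OF assms(3) e] by (meson inj_on_subset)
    moreover obtain w where "w \<in> f ` e" "\<alpha> w" "\<forall>w'\<in>f ` e. \<alpha> w' \<longrightarrow> w' = w"
      using assms(2) f e unfolding one_marked_def by blast
    ultimately show ?thesis unfolding inj_on_def by auto
  qed
  then show ?thesis unfolding one_marked_def by (intro exI[of _ "\<alpha> \<circ> f"]) auto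
qed

lemma one_marked_semibip: "one_marked (\<lambda>v. v < t) (semibip t n)"
  unfolding one_marked_def semibip_def by auto

lemma G1_semibip: "G1 n = semibip (n div 3) n"
  unfolding G1_def semibip_def by simp

lemma G26_col_contained:
  assumes "contained F H" "G26_col \<phi> H"
  shows "\<exists>\<psi>. G26_col \<psi> F"
proof -
  obtain f where f: "f ` fst F \<subseteq> fst H" "\<forall>e\<in>snd F. f ` e \<in> snd H"
    using assms(1) unfolding contained_def by blast
  have "\<forall>v\<in>fst F. (\<phi> \<circ> f) v \<in> {1..6}"
    using f assms(2) unfolding G26_col_def by (simp add: image_subset_iff)
  moreover have "\<forall>e\<in>snd F. (\<phi> \<circ> f) ` e \<in> G26_edges"
    using f assms(2) unfolding G26_col_def by (metis image_comp)
  ultimately have "G26_col (\<phi> \<circ> f) F" unfolding G26_col_def by blast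
  then show ?thesis by blast
qed

lemma blowup_G26_col: "blowup_G26 n H \<Longrightarrow> \<exists>\<phi>. G26_col \<phi> H"
proof -
  assume "blowup_G26 n H"
  then obtain \<phi> where \<phi>: "\<phi> ` {0..<n} = {1..6}"
    "H = ({0..<n}, {e. e \<subseteq> {0..<n} \<and> card e = 3 \<and> \<phi> ` e \<in> G26_edges})"
    unfolding blowup_G26_def by blast
  have "\<phi> v \<in> {1..6}" if "v \<in> {0..<n}" for v using \<phi>(1) that by (metis imageI)
  then have "G26_col \<phi> H" unfolding G26_col_def \<phi>(2) by simp
  then show ?thesis by blast
qed

lemma G26_edge_card: "e \<in> G26_edges \<Longrightarrow> card e = 3"
  by (auto simp: G26_edges_def)

lemma G26_edge_sub: "e \<in> G26_edges \<Longrightarrow> e \<subseteq> {1..6}"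
  by (auto simp: G26_edges_def)

lemma G26_col_inj_edge:
  assumes "hg3 F" "G26_col \<phi> F" "e \<in> snd F"
  shows "inj_on \<phi> e"
proof -
  have "card e = 3" using assms hg3_card by blast
  moreover have "card (\<phi> ` e) = 3" using assms G26_edge_card unfolding G26_col_def by blast
  ultimately show ?thesis by (intro eq_card_imp_inj_on card_ge_0_finite) auto
qed

text \<open>An edge receives three different colours, and each pair of the core shares an edge. In
  particular a colourable 3-graph has no core on seven vertices.\<close>

lemma G26_col_core_inj:
  assumes "hg3 F" "G26_col \<phi> F" "is_core F S m"
  shows "inj_on \<phi> S"
proof (rule inj_onI, rule ccontr)
  fix u v assume uv: "u \<in> S" "v \<in> S" "\<phi> u = \<phi> v" "u \<noteq> v"
  then obtain e where e: "e \<in> snd F" "{u, v} \<subseteq> e" using assms(3) unfolding is_core_def by blast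
  then show False using G26_col_inj_edge[OF assms(1,2) e(1)] uv unfolding inj_on_def by blast
qed

lemma tau_ge_2:
  assumes "finite V" "\<forall>e\<in>E. e \<noteq> {} \<and> e \<subseteq> V" "E \<noteq> {}" "\<not> (\<exists>c\<in>V. \<forall>e\<in>E. c \<in> e)"
  shows "2 \<le> tau V E"
proof -
  have "\<exists>T\<subseteq>V. card T = card V \<and> (\<forall>e\<in>E. T \<inter> e \<noteq> {})"
    using assms(2) by (intro exI[of _ V]) (auto simp: Int_absorb1)
  then have "\<exists>k. \<exists>T\<subseteq>V. card T = k \<and> (\<forall>e\<in>E. T \<inter> e \<noteq> {})" by blast
  from LeastI_ex[OF this] obtain T where T: "T \<subseteq> V" "card T = tau V E" "\<forall>e\<in>E. T \<inter> e \<noteq> {}"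
    unfolding tau_def by blast
  have finT: "finite T" using T assms finite_subset by blast
  have "card T \<noteq> 0" using T(3) assms(3) finT by auto
  moreover have "card T \<noteq> 1"
  proof
    assume "card T = 1"
    then obtain c where "T = {c}" by (auto simp: card_1_singleton_iff)
    then show False using T assms(4) by auto
  qed
  ultimately show ?thesis using T by linarith
qed

lemma tau_le_1:
  assumes "(\<exists>c\<in>V. \<forall>e\<in>E. c \<in> e) \<or> E = {}"
  shows "tau V E \<le> 1"
  using assms
proof
  assume "\<exists>c\<in>V. \<forall>e\<in>E. c \<in> e"
  then obtain c where "{c} \<subseteq> V" "card {c} = 1" "\<forall>e\<in>E. {c} \<inter> e \<noteq> {}" by auto
  then show ?thesis unfolding tau_def by (intro Least_le) blast
next
  assume "E = {}"
  then have "tau V E \<le> 0" unfolding tau_def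
    by (intro Least_le exI[of _ "{}"]) auto
  then show ?thesis by simp
qed

lemma hfree_induced:
  assumes "hfree Mfam H" "U \<subseteq> fst H"
  shows "induced H U \<notin> Mfam"
  using assms contained_induced unfolding hfree_def by blast

text \<open>The clique together with its covering edges belongs to \<open>Kfam 6\<close>. If the
  edges inside the clique had no common vertex, their transversal number would be at least 2 and
  this subgraph would lie in \<open>M2\<close>.\<close>

lemma Mfree_clique7:
  assumes H: "hg3 H" "hfree Mfam H" and S: "clique H S" "card S = 7"
  shows "(\<exists>c. \<forall>e\<in>snd H. e \<subseteq> S \<longrightarrow> c \<in> e)"
proof (rule ccontr)
  assume no: "\<nexists>c. \<forall>e\<in>snd H. e \<subseteq> S \<longrightarrow> c \<in> e"
  obtain U where U: "S \<subseteq> U" "U \<subseteq> fst H" "card U \<le> 7 + (7 choose 2)" "is_core (induced H U) S 7"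
    using clique_cover[OF H(1) S(1)] S(2) by auto
  let ?E = "{e \<in> snd (induced H U). e \<subseteq> S}"
  have E: "?E = {e \<in> snd H. e \<subseteq> S}" using U unfolding induced_def by auto
  have "2 \<le> tau S ?E"
  proof (rule tau_ge_2)
    show "finite S" using clique_finite[OF H(1) S(1)] .
    show "\<forall>e\<in>?E. e \<noteq> {} \<and> e \<subseteq> S" unfolding E using hg3_card[OF H(1)] by fastforce
    show "?E \<noteq> {}" unfolding E using no by blast
    show "\<not> (\<exists>c\<in>S. \<forall>e\<in>?E. c \<in> e)" unfolding E using no by blast
  qed
  moreover have "induced H U \<in> Kfam 6"
    using U hg3_induced[OF H(1) U(2)] unfolding Kfam_def by (auto simp: induced_def)
  ultimately have "induced H U \<in> Mfam" using U unfolding Mfam_def M2_def by blast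
  then show False using hfree_induced[OF H(2) U(2)] by blast
qed

text \<open>A Helly-type argument: an intersecting family of triples without a common point has a
  subfamily spanning at most 7 vertices without a common point.\<close>

lemma Mfree_clique_ge7:
  assumes H: "hg3 H" "hfree Mfam H" and S: "clique H S" "card S \<ge> 7"
  shows "\<exists>c. \<forall>e\<in>snd H. e \<subseteq> S \<longrightarrow> c \<in> e"
proof (rule ccontr)
  assume no: "\<nexists>c. \<forall>e\<in>snd H. e \<subseteq> S \<longrightarrow> c \<in> e"
  define E where "E = {e \<in> snd H. e \<subseteq> S}"
  have no': "\<exists>e\<in>E. c \<notin> e" for c using no unfolding E_def by blast
  have c3: "card e = 3" "finite e" if "e \<in> E" for e
    using that hg3_card[OF H(1), of e] unfolding E_def by (auto intro: card_ge_0_finite)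
  have fS: "finite S" using clique_finite[OF H(1) S(1)] .
  \<comment> \<open>Any set of at most seven vertices extends to a subclique with exactly
    seven.\<close>
  have key: "\<exists>c. \<forall>e\<in>E. e \<subseteq> X \<longrightarrow> c \<in> e" if X: "X \<subseteq> S" "card X \<le> 7" for X
  proof -
    obtain T where T: "X \<subseteq> T" "T \<subseteq> S" "card T = 7"
      using exists_subset_between[of X 7 S] X S(2) fS by auto
    obtain c where "\<forall>e\<in>snd H. e \<subseteq> T \<longrightarrow> c \<in> e"
      using Mfree_clique7[OF H clique_subset[OF S(1) T(2)] T(3)] by blast
    then have "\<forall>e\<in>E. e \<subseteq> X \<longrightarrow> c \<in> e" using T(1) unfolding E_def by auto
    then show ?thesis by blast
  qed
  have two: "e \<inter> f \<noteq> {}" if "e \<in> E" "f \<in> E" for e f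
  proof -
    have "card (e \<union> f) \<le> 7" using card_Un_le[of e f] c3[OF that(1)] c3[OF that(2)] by simp
    moreover have "e \<union> f \<subseteq> S" using that unfolding E_def by blast
    ultimately obtain c where "\<forall>h\<in>E. h \<subseteq> e \<union> f \<longrightarrow> c \<in> h" using key[of "e \<union> f"] by blast
    then have "c \<in> e" "c \<in> f" using that by auto
    then show ?thesis by blast
  qed
  \<comment> \<open>Two intersecting triples span at most 5 vertices, and a third one that meets
    them adds at most 2.\<close>
  have three: "\<exists>c. c \<in> e \<and> c \<in> f \<and> c \<in> g" if "e \<in> E" "f \<in> E" "g \<in> E" for e f g
  proof -
    note c = c3[OF that(1)] c3[OF that(2)] c3[OF that(3)]
    have "card (e \<inter> f) \<ge> 1" using two[OF that(1,2)] c by (simp add: Suc_le_eq card_gt_0_iff)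
    then have "card (e \<union> f) \<le> 5" using card_Un_Int[of e f] c by simp
    moreover have "card ((e \<union> f) \<inter> g) \<ge> 1"
      using two[OF that(1,3)] c by (simp add: Suc_le_eq card_gt_0_iff) blast
    ultimately have "card (e \<union> f \<union> g) \<le> 7" using card_Un_Int[of "e \<union> f" g] c by simp
    moreover have "e \<union> f \<union> g \<subseteq> S" using that unfolding E_def by blast
    ultimately obtain c where "\<forall>h\<in>E. h \<subseteq> e \<union> f \<union> g \<longrightarrow> c \<in> h"
      using key[of "e \<union> f \<union> g"] by blast
    then have "c \<in> e" "c \<in> f" "c \<in> g" using that by auto
    then show ?thesis by blast
  qed
  obtain e where e: "e \<in> E" using no' by blast
  obtain a b c where abc: "e = {a, b, c}" "a \<noteq> b" "a \<noteq> c" "b \<noteq> c"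
    using c3(1)[OF e] by (auto simp: card_3_iff)
  obtain p q r where pqr: "p \<in> E" "a \<notin> p" "q \<in> E" "b \<notin> q" "r \<in> E" "c \<notin> r" using no' by metis
  \<comment> \<open>A common vertex of \<open>e\<close>, \<open>p\<close>, \<open>q\<close> is
    neither \<open>a\<close> nor \<open>b\<close>, so it is \<open>c\<close>; likewise for the other
    two choices. Each of \<open>p\<close>, \<open>q\<close>, \<open>r\<close> therefore shares two
    vertices with \<open>e\<close> and adds at most one, so all four edges span at most 6
    vertices.\<close>
  have m: "c \<in> p" "c \<in> q" "b \<in> p" "b \<in> r" "a \<in> q" "a \<in> r"
    using three[OF e pqr(1,3)] three[OF e pqr(1,5)] three[OF e pqr(3,5)] abc pqr by auto
  have one: "card (h - e) \<le> 1" if "h \<in> E" "{u, v} \<subseteq> h" "{u, v} \<subseteq> e" "u \<noteq> v" for h u v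
  proof -
    have "card (h - {u, v}) = 1" using that c3[OF that(1)] by (simp add: card_Diff_subset)
    moreover have "h - e \<subseteq> h - {u, v}" using that by blast
    ultimately show ?thesis using c3[OF that(1)] by (metis card_mono finite_Diff)
  qed
  have o: "card (p - e) \<le> 1" "card (q - e) \<le> 1" "card (r - e) \<le> 1"
    using one[OF pqr(1), of b c] one[OF pqr(3), of a c] one[OF pqr(5), of a b] m abc by auto
  have "card (e \<union> (p - e) \<union> (q - e) \<union> (r - e)) \<le> 6"
    using card_Un_le[of e "p - e"] card_Un_le[of "e \<union> (p - e)" "q - e"]
      card_Un_le[of "e \<union> (p - e) \<union> (q - e)" "r - e"] o c3[OF e] by linarith
  moreover have "e \<union> (p - e) \<union> (q - e) \<union> (r - e) \<subseteq> S" using e pqr unfolding E_def by blast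
  ultimately obtain z where "\<forall>h\<in>E. h \<subseteq> e \<union> (p - e) \<union> (q - e) \<union> (r - e) \<longrightarrow> z \<in> h"
    using key[of "e \<union> (p - e) \<union> (q - e) \<union> (r - e)"] by auto
  then have "z \<in> e" "z \<in> p" "z \<in> q" "z \<in> r" using e pqr by auto
  then show False using abc pqr by auto
qed

text \<open>The number 21 is \<open>6 + (6 choose 2)\<close>, the vertex bound of
  \<open>Kfam 5\<close>. Since the induced 3-graph is not in \<open>M3\<close>, it is contained in
  some \<open>G1\<close>, which gives a common vertex inside the core, or in some \<open>G2\<close>,
  which gives a colouring.\<close>

lemma Mfree_core6:
  assumes H: "hg3 H" "hfree Mfam H" and U: "U \<subseteq> fst H" "card U \<le> 21" "is_core (induced H U) S 6"
  shows "(\<exists>c. \<forall>e\<in>snd H. e \<subseteq> S \<longrightarrow> c \<in> e) \<or> (\<exists>\<phi>. G26_col \<phi> (induced H U))"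
proof -
  let ?F = "induced H U"
  have F: "hg3 ?F" using hg3_induced[OF H(1) U(1)] .
  have "(6::nat) choose 2 = 15" by (simp add: choose_two)
  then have "?F \<in> Kfam 5" using U F unfolding Kfam_def by (auto simp: induced_def)
  moreover have "?F \<notin> M3" using hfree_induced[OF H(2) U(1)] unfolding Mfam_def by blast
  ultimately consider n where "contained ?F (G1 n)" | n G where "G2 n G" "contained ?F G"
    unfolding M3_def by blast
  then show ?thesis
  proof cases
    case 1
    then obtain \<beta> where "one_marked \<beta> ?F"
      using one_marked_contained[OF _ one_marked_semibip F] unfolding G1_semibip by blast
    from one_marked_core[OF this U(3)] obtain c where "\<forall>e\<in>snd ?F. e \<subseteq> S \<longrightarrow> c \<in> e" by blast
    moreover have "S \<subseteq> U" using U(3) unfolding is_core_def induced_def by simp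
    ultimately have "\<forall>e\<in>snd H. e \<subseteq> S \<longrightarrow> c \<in> e" unfolding induced_def by auto
    then show ?thesis by blast
  next
    case 2
    then show ?thesis using G26_col_contained blowup_G26_col unfolding G2_def by blast
  qed
qed

lemma Mfree_clique6:
  assumes H: "hg3 H" "hfree Mfam H" and S: "clique H S" "card S = 6"
  shows "(\<exists>c. \<forall>e\<in>snd H. e \<subseteq> S \<longrightarrow> c \<in> e) \<or>
    (\<exists>\<psi>. inj_on \<psi> S \<and> \<psi> ` S \<subseteq> {1..6} \<and> (\<forall>e\<in>snd H. e \<subseteq> S \<longrightarrow> \<psi> ` e \<in> G26_edges))"
proof -
  obtain U where U: "S \<subseteq> U" "U \<subseteq> fst H" "card U \<le> 6 + (6 choose 2)" "is_core (induced H U) S 6"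
    using clique_cover[OF H(1) S(1)] S(2) by auto
  have "(6::nat) choose 2 = 15" by (simp add: choose_two)
  then have "card U \<le> 21" using U by simp
  from Mfree_core6[OF H U(2) this U(4)] show ?thesis
  proof
    assume "\<exists>\<phi>. G26_col \<phi> (induced H U)"
    then obtain \<phi> where \<phi>: "G26_col \<phi> (induced H U)" by blast
    have "inj_on \<phi> S" using G26_col_core_inj[OF hg3_induced[OF H(1) U(2)] \<phi> U(4)] .
    moreover have "\<phi> ` S \<subseteq> {1..6}" "\<forall>e\<in>snd H. e \<subseteq> S \<longrightarrow> \<phi> ` e \<in> G26_edges"
      using \<phi> U(1) unfolding G26_col_def induced_def by auto
    ultimately show ?thesis by blast
  qed blast
qed

section \<open>Embedding cliques with at most five vertices into \<open>G26\<close>\<close>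

lemma G26_edgeI:
  assumes "inj_on \<psi> S" "\<psi> ` S \<subseteq> {1..6}" "e \<subseteq> S" "card e = 3"
    "\<psi> ` e \<noteq> {1,2,3}" "\<psi> ` e \<noteq> {1,2,6}" "\<psi> ` e \<noteq> {3,4,5}" "\<psi> ` e \<noteq> {4,5,6}"
  shows "\<psi> ` e \<in> G26_edges"
proof -
  have "card (\<psi> ` e) = 3" using assms by (metis card_image inj_on_subset)
  then show ?thesis using assms unfolding G26_edges_def by auto
qed

text \<open>If at most one triple were missing, mapping \<open>{0, 1, 2}\<close> to it (or to any
  triple, if none is missing) would embed \<open>K5minus\<close>.\<close>

lemma K5minus_free_missing:
  assumes H: "hg3 H" "hfree Mfam H" and S: "S \<subseteq> fst H" "card S = 5"
  shows "\<exists>e f. e \<subseteq> S \<and> f \<subseteq> S \<and> card e = 3 \<and> card f = 3 \<and> e \<noteq> f \<and> e \<notin> snd H \<and> f \<notin> snd H"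
proof (rule ccontr)
  assume no: "\<not> ?thesis"
  have uniq: "e = f" if "e \<subseteq> S" "f \<subseteq> S" "card e = 3" "card f = 3" "e \<notin> snd H" "f \<notin> snd H" for e f
    using no that by metis
  have finS: "finite S" using S(2) by (intro card_ge_0_finite) simp
  obtain e where e: "e \<subseteq> S" "card e = 3" and oth: "\<And>f. f \<subseteq> S \<Longrightarrow> card f = 3 \<Longrightarrow> f \<noteq> e \<Longrightarrow> f \<in> snd H"
  proof (cases "\<exists>e\<subseteq>S. card e = 3 \<and> e \<notin> snd H")
    case True
    then obtain e where "e \<subseteq> S" "card e = 3" "e \<notin> snd H" by blast
    then show ?thesis using that uniq by metis
  next
    case False
    moreover obtain e where "e \<subseteq> S" "card e = 3"
      using obtain_subset_with_card_n[of 3 S] S(2) by auto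
    ultimately show ?thesis using that by metis
  qed
  obtain a b c where abc: "e = {a, b, c}" "a \<noteq> b" "a \<noteq> c" "b \<noteq> c"
    using e(2) by (auto simp: card_3_iff)
  have "card (S - e) = 2" using e S(2) finS by (simp add: card_Diff_subset finite_subset)
  then obtain p q where pq: "S - e = {p, q}" "p \<noteq> q" by (auto simp: card_2_iff)
  have S_eq: "S = {a, b, c, p, q}" using pq abc e by auto
  have dis: "p \<notin> {a, b, c}" "q \<notin> {a, b, c}" using pq abc by auto
  define f :: "nat \<Rightarrow> nat" where
    "f = (\<lambda>i. if i = 0 then a else if i = 1 then b else if i = 2 then c else if i = 3 then p else q)"
  have five: "{0..<5::nat} = {0, 1, 2, 3, 4}" by auto
  have inj: "inj_on f {0..<5}" unfolding five inj_on_def f_def using abc pq dis by auto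
  have img: "f ` {0..<5} = S" unfolding five S_eq f_def by auto
  have "f ` g \<in> snd H" if g: "g \<subseteq> {0..<5}" "card g = 3" "g \<noteq> {0, 1, 2}" for g
  proof (rule oth)
    show "f ` g \<subseteq> S" using g img by blast
    show "card (f ` g) = 3" using g inj by (metis card_image inj_on_subset)
    have "f ` {0, 1, 2} = e" unfolding f_def abc by auto
    moreover have "{0, 1, 2} \<subseteq> {0..<5::nat}" by auto
    ultimately show "f ` g \<noteq> e" using g inj inj_on_image_eq_iff[OF inj, of g "{0,1,2}"] by metis
  qed
  then have "contained K5minus H" unfolding contained_def K5minus_def
    using inj img S(1) by (intro exI[of _ f]) auto
  then show False using H(2) unfolding hfree_def Mfam_def by blast
qed

lemma Mfree_clique5:
  assumes H: "hg3 H" "hfree Mfam H" and S: "S \<subseteq> fst H" "card S = 5"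
  shows "\<exists>\<psi>. inj_on \<psi> S \<and> \<psi> ` S \<subseteq> {1..6} \<and> (\<forall>e\<in>snd H. e \<subseteq> S \<longrightarrow> \<psi> ` e \<in> G26_edges)"
proof -
  obtain e f where ef: "e \<subseteq> S" "f \<subseteq> S" "card e = 3" "card f = 3" "e \<noteq> f" "e \<notin> snd H" "f \<notin> snd H"
    using K5minus_free_missing[OF H S] by blast
  have finS: "finite S" using S(2) by (intro card_ge_0_finite) simp
  have fin: "finite e" "finite f" using ef finS finite_subset by auto
  have "card (e \<union> f) \<le> 5" using ef S finS by (metis card_mono Un_least)
  then have i1: "card (e \<inter> f) \<ge> 1" using card_Un_Int[of e f] fin ef by simp
  have "card (e \<inter> f) \<noteq> 3"
    using ef fin by (metis card_subset_eq inf_le1 inf_le2)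
  moreover have "card (e \<inter> f) \<le> 3" using ef fin by (metis card_mono inf_le1)
  ultimately consider "card (e \<inter> f) = 2" | "card (e \<inter> f) = 1" using i1 by linarith
  then show ?thesis
  proof cases
    case 1
    then obtain a b where ab: "e \<inter> f = {a, b}" "a \<noteq> b" by (auto simp: card_2_iff)
    have "{a, b} \<subseteq> e" "{a, b} \<subseteq> f" using ab(1) by blast+
    then have "card (e - {a, b}) = 1" "card (f - {a, b}) = 1"
      using ef(3,4) ab(2) by (simp_all add: card_Diff_subset)
    then obtain c d where cd: "e - {a, b} = {c}" "f - {a, b} = {d}"
      by (auto simp: card_1_singleton_iff)
    have e_eq: "e = {a, b, c}" and f_eq: "f = {a, b, d}" using cd ab(1) by blast+
    have "c \<in> e - {a, b}" "d \<in> f - {a, b}" "c \<noteq> d" using cd ef(5) e_eq f_eq by blast+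
    then have dis: "c \<noteq> a" "c \<noteq> b" "d \<noteq> a" "d \<noteq> b" "c \<noteq> d" by blast+
    have sub: "{a, b, c, d} \<subseteq> S" using ef(1,2) e_eq f_eq by blast
    have "card {a, b, c, d} = 4" using dis ab(2) by auto
    then have "card (S - {a, b, c, d}) = 1"
      using S(2) sub by (subst card_Diff_subset) auto
    then obtain h where h: "S - {a, b, c, d} = {h}" by (auto simp: card_1_singleton_iff)
    have S_eq: "S = {a, b, c, d, h}" using h sub by blast
    have hd: "h \<notin> {a, b, c, d}" using h by blast
    define \<psi> :: "nat \<Rightarrow> nat" where
      "\<psi> = (\<lambda>i. if i = a then 1 else if i = b then 2 else if i = c then 3 else if i = d then 6 else 4)"
    have inj: "inj_on \<psi> S" unfolding S_eq inj_on_def \<psi>_def using ab(2) dis hd by auto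
    have img: "\<psi> ` S = {1, 2, 3, 6, 4}" unfolding S_eq \<psi>_def using ab(2) dis hd by auto
    have ime: "\<psi> ` e = {1, 2, 3}" "\<psi> ` f = {1, 2, 6}"
      unfolding e_eq f_eq \<psi>_def using ab(2) dis hd by auto
    have "\<psi> ` g \<in> G26_edges" if g: "g \<in> snd H" "g \<subseteq> S" for g
    proof (rule G26_edgeI[OF inj])
      show "\<psi> ` g \<noteq> {1, 2, 3}" "\<psi> ` g \<noteq> {1, 2, 6}"
        using g ef(1,2,6,7) inj_on_image_eq_iff[OF inj g(2)] ime by metis+
      have "5 \<notin> \<psi> ` S" unfolding img by simp
      then have "5 \<notin> \<psi> ` g" using g(2) by blast
      then show "\<psi> ` g \<noteq> {3, 4, 5}" "\<psi> ` g \<noteq> {4, 5, 6}" by auto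
    qed (use img g hg3_card[OF H(1)] in auto)
    then show ?thesis using inj img by (intro exI[of _ \<psi>]) auto
  next
    case 2
    then obtain c where c: "e \<inter> f = {c}" by (auto simp: card_1_singleton_iff)
    have "{c} \<subseteq> e" "{c} \<subseteq> f" using c by blast+
    then have "card (e - {c}) = 2" "card (f - {c}) = 2"
      using ef(3,4) by (simp_all add: card_Diff_subset)
    then obtain a b d h where abdh: "e - {c} = {a, b}" "a \<noteq> b" "f - {c} = {d, h}" "d \<noteq> h"
      by (auto simp: card_2_iff)
    have e_eq: "e = {a, b, c}" and f_eq: "f = {c, d, h}" using abdh c by blast+
    have dis: "c \<noteq> a" "c \<noteq> b" "d \<noteq> c" "h \<noteq> c" using abdh(1,3) by blast+
    have dis2: "d \<noteq> a" "d \<noteq> b" "h \<noteq> a" "h \<noteq> b" using c e_eq f_eq dis by blast+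
    have "card {a, b, c, d, h} = 5" using abdh(2,4) dis dis2 by auto
    moreover have "{a, b, c, d, h} \<subseteq> S" using e_eq f_eq ef(1,2) by blast
    ultimately have S_eq: "S = {a, b, c, d, h}" using S(2) finS by (metis card_subset_eq)
    define \<psi> :: "nat \<Rightarrow> nat" where
      "\<psi> = (\<lambda>i. if i = a then 1 else if i = b then 2 else if i = c then 3 else if i = d then 4 else 5)"
    have inj: "inj_on \<psi> S" unfolding S_eq inj_on_def \<psi>_def using abdh(2,4) dis dis2 by auto
    have img: "\<psi> ` S = {1, 2, 3, 4, 5}" unfolding S_eq \<psi>_def using abdh(2,4) dis dis2 by auto
    have ime: "\<psi> ` e = {1, 2, 3}" "\<psi> ` f = {3, 4, 5}"
      unfolding e_eq f_eq \<psi>_def using abdh(2,4) dis dis2 by auto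
    have "\<psi> ` g \<in> G26_edges" if g: "g \<in> snd H" "g \<subseteq> S" for g
    proof (rule G26_edgeI[OF inj])
      show "\<psi> ` g \<noteq> {1, 2, 3}" "\<psi> ` g \<noteq> {3, 4, 5}"
        using g ef(1,2,6,7) inj_on_image_eq_iff[OF inj g(2)] ime by metis+
      have "6 \<notin> \<psi> ` S" unfolding img by simp
      then have "6 \<notin> \<psi> ` g" using g(2) by blast
      then show "\<psi> ` g \<noteq> {1, 2, 6}" "\<psi> ` g \<noteq> {4, 5, 6}" by auto
    qed (use img g hg3_card[OF H(1)] in auto)
    then show ?thesis using inj img by (intro exI[of _ \<psi>]) auto
  qed
qed

text \<open>Every non-edge of \<open>G26\<close> contains 2 or 5, so the labels 1, 3, 4, 6 span a
  complete 3-graph and impose no condition.\<close>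

lemma clique_le4:
  assumes H: "hg3 H" and S: "finite S" "card S \<le> 4"
  shows "\<exists>\<psi>. inj_on \<psi> S \<and> \<psi> ` S \<subseteq> {1..6} \<and> (\<forall>e\<in>snd H. e \<subseteq> S \<longrightarrow> \<psi> ` e \<in> G26_edges)"
proof -
  have "card S \<le> card {1, 3, 4, 6::nat}" using S by simp
  then obtain \<psi> where \<psi>: "inj_on \<psi> S" "\<psi> ` S \<subseteq> {1, 3, 4, 6::nat}"
    using card_le_inj[OF S(1), of "{1, 3, 4, 6::nat}"] by auto
  have "\<psi> ` g \<in> G26_edges" if g: "g \<in> snd H" "g \<subseteq> S" for g
  proof (rule G26_edgeI[OF \<psi>(1)])
    have "2 \<notin> \<psi> ` S" "5 \<notin> \<psi> ` S" using \<psi>(2) by auto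
    then have "2 \<notin> \<psi> ` g" "5 \<notin> \<psi> ` g" using g(2) by blast+
    then show "\<psi> ` g \<noteq> {1, 2, 3}" "\<psi> ` g \<noteq> {1, 2, 6}" "\<psi> ` g \<noteq> {3, 4, 5}" "\<psi> ` g \<noteq> {4, 5, 6}"
      by auto
  qed (use \<psi> g hg3_card[OF H] in auto)
  then show ?thesis using \<psi> by (intro exI[of _ \<psi>]) auto
qed

lemma Mfree_clique_structure:
  assumes H: "hg3 H" "hfree Mfam H" and S: "clique H S"
  shows "(\<exists>c. \<forall>e\<in>snd H. e \<subseteq> S \<longrightarrow> c \<in> e) \<or>
    (\<exists>\<psi>. inj_on \<psi> S \<and> \<psi> ` S \<subseteq> {1..6} \<and> (\<forall>e\<in>snd H. e \<subseteq> S \<longrightarrow> \<psi> ` e \<in> G26_edges))"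
proof -
  consider "card S \<ge> 7" | "card S = 6" | "card S = 5" | "card S \<le> 4" by linarith
  then show ?thesis
  proof cases
    case 1 show ?thesis by (rule disjI1[OF Mfree_clique_ge7[OF H S 1]])
  next
    case 2 show ?thesis by (rule Mfree_clique6[OF H S 2])
  next
    case 3
    have "S \<subseteq> fst H" using S unfolding clique_def by blast
    then show ?thesis by (rule disjI2[OF Mfree_clique5[OF H _ 3]])
  next
    case 4 show ?thesis by (rule disjI2[OF clique_le4[OF H(1) clique_finite[OF H(1) S] 4]])
  qed
qed


section \<open>Lagrangians of stars and of \<open>G26\<close>\<close>

definition supp_clique :: "hg \<Rightarrow> (nat \<Rightarrow> real) \<Rightarrow> bool" where
  "supp_clique H y \<longleftrightarrow> (\<forall>u v. 0 < y u \<longrightarrow> 0 < y v \<longrightarrow> u \<noteq> v \<longrightarrow> covered H u v)"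

lemma sum_push:
  fixes x :: "nat \<Rightarrow> real" and \<phi> :: "nat \<Rightarrow> nat"
  assumes "finite V" "finite I" "\<phi> ` V \<subseteq> I"
  shows "(\<Sum>a\<in>V. g (\<phi> a) * x a) = (\<Sum>i\<in>I. g i * (\<Sum>a\<in>{a \<in> V. \<phi> a = i}. x a))"
proof -
  have "(\<Sum>a\<in>V. g (\<phi> a) * x a) = (\<Sum>i\<in>I. \<Sum>a\<in>{a \<in> V. \<phi> a = i}. g (\<phi> a) * x a)"
    using sum.group[OF assms, of "\<lambda>a. g (\<phi> a) * x a"] by simp
  then show ?thesis by (simp add: sum_distrib_left)
qed

text \<open>Weights are pushed forward to the colours one slot at a time. This serves both for
  weights on a clique and, with all weights 1, for counting edges of blowups.\<close>

lemma sum_push3: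
  fixes x :: "nat \<Rightarrow> real" and \<phi> :: "nat \<Rightarrow> nat"
  assumes "finite V" "finite I" "\<phi> ` V \<subseteq> I"
  defines "X \<equiv> (\<lambda>i. \<Sum>a\<in>{a \<in> V. \<phi> a = i}. x a)"
  shows "(\<Sum>a\<in>V. \<Sum>b\<in>V. \<Sum>c\<in>V. g (\<phi> a) (\<phi> b) (\<phi> c) * (x a * x b * x c)) =
         (\<Sum>i\<in>I. \<Sum>j\<in>I. \<Sum>k\<in>I. g i j k * (X i * X j * X k))"
proof -
  define h1 where "h1 = (\<lambda>i j. \<Sum>k\<in>I. g i j k * X k)"
  define h2 where "h2 = (\<lambda>i. \<Sum>j\<in>I. h1 i j * X j)"
  have push: "(\<Sum>a\<in>V. f (\<phi> a) * x a) = (\<Sum>i\<in>I. f i * X i)" for f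
    unfolding X_def by (rule sum_push[OF assms(1-3)])
  have 1: "(\<Sum>c\<in>V. g (\<phi> a) (\<phi> b) (\<phi> c) * (x a * x b * x c)) = (x a * x b) * h1 (\<phi> a) (\<phi> b)" for a b
    unfolding h1_def push[of "g (\<phi> a) (\<phi> b)", symmetric] sum_distrib_left
    by (intro sum.cong) auto
  have 2: "(\<Sum>b\<in>V. (x a * x b) * h1 (\<phi> a) (\<phi> b)) = x a * h2 (\<phi> a)" for a
    unfolding h2_def push[of "h1 (\<phi> a)", symmetric] sum_distrib_left
    by (intro sum.cong) auto
  have 3: "(\<Sum>a\<in>V. x a * h2 (\<phi> a)) = (\<Sum>i\<in>I. h2 i * X i)"
    unfolding push[of h2, symmetric] by (intro sum.cong) auto
  show ?thesis unfolding 1 2 3 unfolding h2_def h1_def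
    by (simp add: sum_distrib_left sum_distrib_right mult_ac)
qed

lemma tri_support:
  assumes "finite V" "S \<subseteq> V" "\<And>v. v \<in> V - S \<Longrightarrow> y v = 0"
  shows "tri E V y y y = tri E S y y y"
proof -
  have r: "sum f V = sum f S" if "\<And>v. v \<in> V - S \<Longrightarrow> f v = 0" for f :: "nat \<Rightarrow> real"
    using sum.mono_neutral_right[OF assms(1,2)] that by blast
  have "tri E V y y y = (\<Sum>a\<in>S. \<Sum>b\<in>V. \<Sum>c\<in>V. of_bool ({a, b, c} \<in> E) * (y a * y b * y c))"
    unfolding tri_def by (rule r) (simp add: assms(3))
  also have "\<dots> = (\<Sum>a\<in>S. \<Sum>b\<in>S. \<Sum>c\<in>V. of_bool ({a, b, c} \<in> E) * (y a * y b * y c))"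
    by (intro sum.cong refl r) (simp add: assms(3))
  also have "\<dots> = tri E S y y y"
    unfolding tri_def by (intro sum.cong refl r) (simp add: assms(3))
  finally show ?thesis .
qed

lemma tri_swap12: "tri E V x y z = tri E V y x z"
  unfolding tri_def by (subst sum.swap) (simp add: insert_commute mult_ac)

lemma tri_swap23: "tri E V x y z = tri E V x z y"
  unfolding tri_def by (subst sum.swap) (simp add: insert_commute mult_ac)

lemma tri_nonneg:
  assumes "\<And>v. 0 \<le> x v" "\<And>v. 0 \<le> y v" "\<And>v. 0 \<le> z v"
  shows "0 \<le> tri E V x y z"
  unfolding tri_def using assms by (intro sum_nonneg mult_nonneg_nonneg) auto

lemma tri_le_1:
  assumes "x \<in> weights V" "y \<in> weights V" "z \<in> weights V"
  shows "tri E V x y z \<le> 1"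
proof -
  have "tri E V x y z \<le> (\<Sum>a\<in>V. \<Sum>b\<in>V. \<Sum>c\<in>V. x a * y b * z c)"
    unfolding tri_def using assms
    by (intro sum_mono) (auto simp: weights_nonneg of_bool_def)
  also have "\<dots> = sum x V * sum y V * sum z V"
    by (simp only: sum_distrib_left[symmetric] sum_distrib_right[symmetric])
  finally show ?thesis using assms by (simp add: weights_sum)
qed

lemma bil_nonneg: "(\<And>v. 0 \<le> x v) \<Longrightarrow> 0 \<le> bil D V x x"
  unfolding bil_def by (intro sum_nonneg mult_nonneg_nonneg) auto

lemma bil_le_1:
  assumes "x \<in> weights V"
  shows "bil D V x x \<le> 1"
proof -
  have "bil D V x x \<le> (\<Sum>a\<in>V. \<Sum>b\<in>V. x a * x b)"
    unfolding bil_def using assms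
    by (intro sum_mono) (auto simp: weights_nonneg of_bool_def)
  also have "\<dots> = sum x V * sum x V"
    by (simp add: sum_distrib_left sum_distrib_right mult_ac)
  finally show ?thesis using assms by (simp add: weights_sum)
qed

section \<open>The Lagrangian polynomial of \<open>G26\<close>\<close>

lemma G26_edge_iff:
  "{i, j, k} \<in> G26_edges \<longleftrightarrow> i \<in> {1..6} \<and> j \<in> {1..6} \<and> k \<in> {1..6} \<and> i \<noteq> j \<and> i \<noteq> k \<and> j \<noteq> k \<and>
     \<not> (i \<in> {1,2,3} \<and> j \<in> {1,2,3} \<and> k \<in> {1,2,3}) \<and> \<not> (i \<in> {1,2,6} \<and> j \<in> {1,2,6} \<and> k \<in> {1,2,6}) \<and>
     \<not> (i \<in> {3,4,5} \<and> j \<in> {3,4,5} \<and> k \<in> {3,4,5}) \<and> \<not> (i \<in> {4,5,6} \<and> j \<in> {4,5,6} \<and> k \<in> {4,5,6})"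
proof -
  have eq: "{i, j, k} = A \<longleftrightarrow> i \<in> A \<and> j \<in> A \<and> k \<in> A" if "card {i, j, k} = 3" "card A = 3" for A
    using that card_subset_eq[of A "{i, j, k}"] card_ge_0_finite[of A] by auto
  have c: "card {1,2,3::nat} = 3" "card {1,2,6::nat} = 3" "card {3,4,5::nat} = 3" "card {4,5,6::nat} = 3"
    by auto
  show ?thesis
  proof (cases "card {i, j, k} = 3")
    case True
    have "i \<noteq> j" "i \<noteq> k" "j \<noteq> k" using True by (simp_all add: card3_distinct)
    moreover have "{i, j, k} \<in> G26_edges \<longleftrightarrow> {i, j, k} \<subseteq> {1..6} \<and> {i, j, k} \<noteq> {1,2,3} \<and>
        {i, j, k} \<noteq> {1,2,6} \<and> {i, j, k} \<noteq> {3,4,5} \<and> {i, j, k} \<noteq> {4,5,6}"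
      unfolding G26_edges_def using True by simp
    ultimately show ?thesis
      unfolding eq[OF True c(1)] eq[OF True c(2)] eq[OF True c(3)] eq[OF True c(4)]
      by (simp only: insert_subset empty_subsetI simp_thms conj_assoc not_False_eq_True)
  next
    case False
    then show ?thesis unfolding G26_edges_def by (auto simp: card3_distinct)
  qed
qed

text \<open>The 16 edge monomials, grouped by the pairs \<open>{1,2}\<close>, \<open>{3,6}\<close>,
  \<open>{4,5}\<close>: the non-edges are the pair \<open>{1,2}\<close> or \<open>{4,5}\<close>
  together with 3 or 6.\<close>

definition G26_poly :: "real \<Rightarrow> real \<Rightarrow> real \<Rightarrow> real \<Rightarrow> real \<Rightarrow> real \<Rightarrow> real" where
  "G26_poly x1 x2 x3 x4 x5 x6 = (x1 + x2) * (x3 + x6) * (x4 + x5) + x1 * x2 * (x4 + x5)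
     + x3 * x6 * (x1 + x2 + x4 + x5) + x4 * x5 * (x1 + x2)"

lemma set_1_6: "{1..6::nat} = {1, 2, 3, 4, 5, 6}"
  by auto

lemma tri_G26: "tri G26_edges {1..6} z z z = 6 * G26_poly (z 1) (z 2) (z 3) (z 4) (z 5) (z 6)"
  unfolding tri_def G26_edge_iff set_1_6
  by (simp add: G26_poly_def algebra_simps)

text \<open>Writing each product \<open>u * v\<close> inside a pair as a quarter of
  \<open>(u + v)^2 - (u - v)^2\<close> separates the pair sums from the pair differences. For
  nonnegative weights \<open>s\<close> is at most 1 and all five terms are nonnegative; they vanish
  together only when all weights are \<open>1/6\<close>.\<close>

lemma G26_poly_sos:
  fixes x1 x2 x3 x4 x5 x6 :: real
  assumes "x1 + x2 + x3 + x4 + x5 + x6 = 1"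
  defines "a \<equiv> x1 + x2" and "c \<equiv> x4 + x5"
  defines "s \<equiv> a + c"
  shows "2 / 27 - G26_poly x1 x2 x3 x4 x5 x6 =
    (s - 2/3)^2 * (8/3 - s) / 16 + (a - c)^2 * (1 - 3/4 * s) / 4
    + (x1 - x2)^2 * c / 4 + (x3 - x6)^2 * s / 4 + (x4 - x5)^2 * a / 4"
proof -
  have pairs: "x1 * x2 = (a^2 - (x1 - x2)^2) / 4" "x4 * x5 = (c^2 - (x4 - x5)^2) / 4"
    "x3 * x6 = ((1 - s)^2 - (x3 - x6)^2) / 4"
  proof -
    have "1 - s = x3 + x6" using assms(1) unfolding s_def a_def c_def by simp
    show "x3 * x6 = ((1 - s)^2 - (x3 - x6)^2) / 4" unfolding \<open>1 - s = x3 + x6\<close> by (simp add: power2_eq_square algebra_simps)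
  qed (simp_all add: a_def c_def power2_eq_square algebra_simps)
  have x36: "x3 + x6 = 1 - s" using assms(1) unfolding s_def a_def c_def by simp
  have "G26_poly x1 x2 x3 x4 x5 x6 = a * (1 - s) * c + (a^2 - (x1 - x2)^2) / 4 * c
     + ((1 - s)^2 - (x3 - x6)^2) / 4 * s + (c^2 - (x4 - x5)^2) / 4 * a"
    unfolding G26_poly_def pairs x36 by (simp add: a_def c_def s_def add.assoc)
  moreover have "a * (1 - s) * c + a^2 / 4 * c + (1 - s)^2 / 4 * s + c^2 / 4 * a =
     2 / 27 - (s - 2/3)^2 * (8/3 - s) / 16 - (a - c)^2 * (1 - 3/4 * s) / 4"
    unfolding s_def by (simp add: field_simps power2_eq_square power3_eq_cube)
  ultimately show ?thesis by (simp add: diff_divide_distrib left_diff_distrib)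
qed

lemma sq_le_imp_abs_le: "(x::real)^2 \<le> (k * \<theta>)^2 \<Longrightarrow> 0 \<le> k * \<theta> \<Longrightarrow> \<bar>x\<bar> \<le> k * \<theta>"
  using abs_le_square_iff[of x "k * \<theta>"] by simp

text \<open>Near equality each of the five terms of the deficit is at most
  \<open>\<theta>^2 / 6\<close>. A square with coefficient at least \<open>1/24\<close> is then at
  most \<open>4 * \<theta>^2\<close>, which is where \<open>2 * \<theta>\<close> comes from. A
  weight is half of a pair sum plus or minus half of a pair difference, so the same bound holds for
  it.\<close>

lemma G26_poly_bounds:
  fixes x1 x2 x3 x4 x5 x6 :: real
  assumes "x1 + x2 + x3 + x4 + x5 + x6 = 1"
    and nn: "0 \<le> x1" "0 \<le> x2" "0 \<le> x3" "0 \<le> x4" "0 \<le> x5" "0 \<le> x6"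
  shows G26_poly_le: "G26_poly x1 x2 x3 x4 x5 x6 \<le> 2 / 27"
    and G26_poly_near: "0 \<le> \<theta> \<Longrightarrow> \<theta> \<le> 1/1000 \<Longrightarrow> 4 / 9 - \<theta>^2 \<le> 6 * G26_poly x1 x2 x3 x4 x5 x6 \<Longrightarrow>
      \<bar>x1 - 1/6\<bar> \<le> 2 * \<theta> \<and> \<bar>x2 - 1/6\<bar> \<le> 2 * \<theta> \<and> \<bar>x3 - 1/6\<bar> \<le> 2 * \<theta> \<and>
      \<bar>x4 - 1/6\<bar> \<le> 2 * \<theta> \<and> \<bar>x5 - 1/6\<bar> \<le> 2 * \<theta> \<and> \<bar>x6 - 1/6\<bar> \<le> 2 * \<theta>"
proof -
  define a c where "a = x1 + x2" and "c = x4 + x5"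
  define s where "s = a + c"
  have s: "0 \<le> s" "s \<le> 1" "0 \<le> a" "0 \<le> c" "x3 + x6 = 1 - s"
    using assms unfolding s_def a_def c_def by auto
  note sos = G26_poly_sos[OF assms(1), folded a_def c_def, folded s_def]
  define t1 t2 t3 t4 t5 where t: "t1 = (s - 2/3)^2 * (8/3 - s) / 16"
    "t2 = (a - c)^2 * (1 - 3/4 * s) / 4" "t3 = (x1 - x2)^2 * c / 4" "t4 = (x3 - x6)^2 * s / 4"
    "t5 = (x4 - x5)^2 * a / 4"
  have tnn: "0 \<le> t1" "0 \<le> t2" "0 \<le> t3" "0 \<le> t4" "0 \<le> t5"
    unfolding t using s by (auto intro!: mult_nonneg_nonneg divide_nonneg_nonneg)
  show "G26_poly x1 x2 x3 x4 x5 x6 \<le> 2 / 27" using sos[folded t] tnn by linarith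
  assume th: "0 \<le> \<theta>" "\<theta> \<le> 1/1000" "4 / 9 - \<theta>^2 \<le> 6 * G26_poly x1 x2 x3 x4 x5 x6"
  have tle: "t1 \<le> \<theta>^2 / 6" "t2 \<le> \<theta>^2 / 6" "t3 \<le> \<theta>^2 / 6" "t4 \<le> \<theta>^2 / 6" "t5 \<le> \<theta>^2 / 6"
    using sos[folded t] tnn th(3) by linarith+
  have gen: "\<bar>u\<bar> \<le> 2 * \<theta>" if "u^2 * w / k \<le> \<theta>^2 / 6" "k > 0" "w / k \<ge> 1 / 24" for u w k :: real
  proof (rule sq_le_imp_abs_le)
    have "u^2 * (1 / 24) \<le> u^2 * (w / k)" using that by (intro mult_left_mono) auto
    also have "\<dots> \<le> \<theta>^2 / 6" using that by simp
    finally show "u^2 \<le> (2 * \<theta>)^2" by (simp add: power2_eq_square)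
  qed (use th in simp)
  \<comment> \<open>The sum \<open>s\<close> is located first: the coefficients
    \<open>c / 4\<close>, \<open>s / 4\<close>, \<open>a / 4\<close> of the last three squares are
    bounded below only once \<open>s\<close>, \<open>a\<close> and \<open>c\<close> are known
    approximately.\<close>
  have s1: "\<bar>s - 2/3\<bar> \<le> 2 * \<theta>" using gen[OF tle(1)[unfolded t]] s by simp
  then have sb: "s \<le> 0.7" "s \<ge> 0.6" using th by (auto simp: abs_le_iff)
  have ac: "\<bar>a - c\<bar> \<le> 2 * \<theta>" using gen[OF tle(2)[unfolded t]] sb by simp
  have ab: "\<bar>a - 1/3\<bar> \<le> 2 * \<theta>" "\<bar>c - 1/3\<bar> \<le> 2 * \<theta>" "a \<ge> 0.3" "c \<ge> 0.3"
    using s1 ac th unfolding s_def by (auto simp: abs_le_iff)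
  have d: "\<bar>x1 - x2\<bar> \<le> 2 * \<theta>" "\<bar>x3 - x6\<bar> \<le> 2 * \<theta>" "\<bar>x4 - x5\<bar> \<le> 2 * \<theta>"
    using gen[OF tle(3)[unfolded t]] gen[OF tle(4)[unfolded t]] gen[OF tle(5)[unfolded t]] ab sb by simp_all
  show "\<bar>x1 - 1/6\<bar> \<le> 2 * \<theta> \<and> \<bar>x2 - 1/6\<bar> \<le> 2 * \<theta> \<and> \<bar>x3 - 1/6\<bar> \<le> 2 * \<theta> \<and>
      \<bar>x4 - 1/6\<bar> \<le> 2 * \<theta> \<and> \<bar>x5 - 1/6\<bar> \<le> 2 * \<theta> \<and> \<bar>x6 - 1/6\<bar> \<le> 2 * \<theta>"
  proof -
    note D = d[THEN abs_le_D1] d[THEN abs_le_D2]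
    have x12: "\<bar>x1 - 1/6\<bar> \<le> 2 * \<theta>" "\<bar>x2 - 1/6\<bar> \<le> 2 * \<theta>"
      using D(1,4) ab(1)[THEN abs_le_D1] ab(1)[THEN abs_le_D2] unfolding a_def by (intro abs_leI; linarith)+
    have x45: "\<bar>x4 - 1/6\<bar> \<le> 2 * \<theta>" "\<bar>x5 - 1/6\<bar> \<le> 2 * \<theta>"
      using D(3,6) ab(2)[THEN abs_le_D1] ab(2)[THEN abs_le_D2] unfolding c_def by (intro abs_leI; linarith)+
    have x36: "\<bar>x3 - 1/6\<bar> \<le> 2 * \<theta>" "\<bar>x6 - 1/6\<bar> \<le> 2 * \<theta>"
      using D(2,5) s1[THEN abs_le_D1] s1[THEN abs_le_D2] s(5) by (intro abs_leI; linarith)+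
    show ?thesis using x12 x45 x36 by blast
  qed
qed

text \<open>On a clique every pair of distinct vertices contributes, so only the diagonal is lost
  from the square of the total weight 1.\<close>

lemma clique_bil:
  assumes H: "hg3 H" and y: "y \<in> weights (fst H)" and cl: "supp_clique H y"
  shows "bil (shadow H) (fst H) y y = 1 - (\<Sum>v\<in>fst H. (y v)^2)"
proof -
  have fin: "finite (fst H)" using H hg3_finite by blast
  have t: "of_bool ({a, b} \<in> shadow H) * (y a * y b) = y a * y b - of_bool (b = a) * (y a * y b)" for a b
  proof (cases "0 < y a \<and> 0 < y b")
    case True
    then show ?thesis using cl unfolding in_shadow_iff[OF H] supp_clique_def by auto
  next
    case False
    then have "y a = 0 \<or> y b = 0" using weights_nonneg[OF y] by (meson antisym_conv2 linorder_not_less)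
    then show ?thesis by auto
  qed
  have "bil (shadow H) (fst H) y y = (\<Sum>a\<in>fst H. \<Sum>b\<in>fst H. y a * y b) -
     (\<Sum>a\<in>fst H. \<Sum>b\<in>fst H. of_bool (b = a) * (y a * y b))"
    unfolding bil_def t by (simp add: sum_subtractf)
  also have "(\<Sum>a\<in>fst H. \<Sum>b\<in>fst H. y a * y b) = sum y (fst H) * sum y (fst H)"
    by (simp add: sum_product)
  also have "(\<Sum>a\<in>fst H. \<Sum>b\<in>fst H. of_bool (b = a) * (y a * y b)) = (\<Sum>v\<in>fst H. (y v)^2)"
    using fin by (intro sum.cong) (auto simp: of_bool_def power2_eq_square if_distrib[of "\<lambda>u. u * _"] cong: if_cong)
  finally show ?thesis using weights_sum[OF y] by simp
qed

text \<open>Inside the support an edge consists of \<open>c\<close>, in one of three positions, and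
  two distinct other vertices; ordered pairs of these weigh the square of the remaining weight minus
  its diagonal. If \<open>c\<close> has weight 0, the support contains no edge.\<close>

lemma star_tri_le:
  assumes H: "hg3 H" and y: "y \<in> weights (fst H)"
    and c: "\<forall>e\<in>snd H. e \<subseteq> {v. 0 < y v} \<longrightarrow> c \<in> e"
  shows "tri (snd H) (fst H) y y y \<le> 3 * y c * ((1 - y c)^2 - ((\<Sum>v\<in>fst H. (y v)^2) - (y c)^2))"
proof -
  let ?V = "fst H"
  have fin: "finite ?V" using H hg3_finite by blast
  note nn = weights_nonneg[OF y]
  define A where "A = (\<lambda>p. of_bool (p = c) * y p)"
  define B where "B = (\<lambda>p. y p - A p)"
  define K where "K = (\<lambda>q r. of_bool (q \<noteq> r) * (B q * B r))"
  have B: "B p = (if p = c then 0 else y p)" for p by (auto simp: B_def A_def)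
  have An: "0 \<le> A p" and Bn: "0 \<le> B p" for p using nn[of p] by (simp_all add: B A_def)
  have Kn: "0 \<le> K p q" for p q unfolding K_def using Bn[of p] Bn[of q] by simp
  have t: "of_bool ({p, q, r} \<in> snd H) * (y p * y q * y r) \<le> A p * K q r + A q * K p r + A r * K p q" for p q r
  proof (cases "{p, q, r} \<in> snd H \<and> 0 < y p \<and> 0 < y q \<and> 0 < y r")
    case True
    then have "{p, q, r} \<subseteq> {v. 0 < y v}" by simp
    then have m: "c \<in> {p, q, r}" using bspec[OF c, of "{p, q, r}"] True by simp
    have ne: "p \<noteq> q" "p \<noteq> r" "q \<noteq> r" using hg3_edge_distinct[OF H, of p q r] True by blast+
    from m consider "p = c" | "q = c" | "r = c" by blast
    then show ?thesis using ne True by cases (simp_all add: K_def B A_def)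
  next
    case False
    then have "{p, q, r} \<notin> snd H \<or> y p = 0 \<or> y q = 0 \<or> y r = 0"
      using nn[of p] nn[of q] nn[of r] by linarith
    then have "of_bool ({p, q, r} \<in> snd H) * (y p * y q * y r) = 0" by auto
    also have "0 \<le> A p * K q r + A q * K p r + A r * K p q"
      by (intro add_nonneg_nonneg mult_nonneg_nonneg An Kn)
    finally show ?thesis .
  qed
  define KK where "KK = (\<Sum>q\<in>?V. \<Sum>r\<in>?V. K q r)"
  have sA: "sum A ?V = y c"
  proof (cases "c \<in> ?V")
    case True
    then show ?thesis unfolding A_def using fin by (simp add: of_bool_def if_distrib[of "\<lambda>u. u * _"] cong: if_cong)
  next
    case False
    then have "y c = 0" using y unfolding weights_def by auto
    moreover have "sum A ?V = 0" unfolding A_def using False by (intro sum.neutral) auto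
    ultimately show ?thesis by simp
  qed
  have sB: "sum B ?V = 1 - y c" unfolding B_def by (simp add: sum_subtractf sA weights_sum[OF y])
  have B2: "(B v)^2 = (y v)^2 - y c * A v" for v unfolding B A_def by (auto simp: power2_eq_square)
  have sB2: "(\<Sum>v\<in>?V. (B v)^2) = (\<Sum>v\<in>?V. (y v)^2) - (y c)^2"
    unfolding B2 sum_subtractf sum_distrib_left[symmetric] sA by (simp add: power2_eq_square)
  have "KK = (\<Sum>q\<in>?V. \<Sum>r\<in>?V. B q * B r - of_bool (r = q) * (B q * B r))"
    unfolding KK_def K_def by (intro sum.cong) auto
  also have "\<dots> = sum B ?V * sum B ?V - (\<Sum>q\<in>?V. \<Sum>r\<in>?V. of_bool (r = q) * (B q * B r))"
    by (simp add: sum_subtractf sum_product)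
  also have "(\<Sum>q\<in>?V. \<Sum>r\<in>?V. of_bool (r = q) * (B q * B r)) = (\<Sum>v\<in>?V. (B v)^2)"
    using fin by (intro sum.cong) (auto simp: of_bool_def power2_eq_square if_distrib[of "\<lambda>u. u * _"] cong: if_cong)
  finally have KKe: "KK = (1 - y c)^2 - ((\<Sum>v\<in>?V. (y v)^2) - (y c)^2)"
    unfolding sB sB2 by (simp add: power2_eq_square)
  have e1: "(\<Sum>p\<in>?V. \<Sum>q\<in>?V. \<Sum>r\<in>?V. A p * K q r) = y c * KK"
    unfolding KK_def sA[symmetric] by (simp only: sum_distrib_left[symmetric] sum_distrib_right[symmetric])
  have e2: "(\<Sum>p\<in>?V. \<Sum>q\<in>?V. \<Sum>r\<in>?V. A q * K p r) = y c * KK"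
    by (subst sum.swap) (rule e1)
  have e3: "(\<Sum>p\<in>?V. \<Sum>q\<in>?V. \<Sum>r\<in>?V. A r * K p q) = y c * KK"
    unfolding KK_def sA[symmetric] by (simp only: sum_distrib_left[symmetric] sum_distrib_right[symmetric])
  have "tri (snd H) ?V y y y \<le> (\<Sum>p\<in>?V. \<Sum>q\<in>?V. \<Sum>r\<in>?V. A p * K q r + A q * K p r + A r * K p q)"
    unfolding tri_def by (intro sum_mono t)
  also have "\<dots> = 3 * y c * KK" by (simp add: sum.distrib e1 e2 e3)
  finally show ?thesis unfolding KKe .
qed


text \<open>Here \<open>a\<close> is the weight of the centre and \<sigma> the sum of the squares of
  the other weights. The deficit equals
  \<open>3 * (a - 1/3)^2 * (4/3 - a) + 3 * a * \<sigma>\<close>, so near equality \<open>a\<close>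
  is close to \<open>1/3\<close> and \<sigma> is close to 0.\<close>

lemma star_value:
  fixes a \<sigma> \<theta> :: real
  assumes "0 \<le> a" "a \<le> 1" "0 \<le> \<sigma>"
  shows star_value_le: "3 * a * ((1 - a)^2 - \<sigma>) \<le> 4 / 9"
    and star_value_near: "0 \<le> \<theta> \<Longrightarrow> \<theta> \<le> 1/1000 \<Longrightarrow> 4 / 9 - \<theta>^2 \<le> 3 * a * ((1 - a)^2 - \<sigma>) \<Longrightarrow>
      \<bar>1 - (a^2 + \<sigma>) - 8/9\<bar> \<le> 2 * \<theta>"
proof -
  have id: "4 / 9 - 3 * a * ((1 - a)^2 - \<sigma>) = 3 * (a - 1/3)^2 * (4/3 - a) + 3 * a * \<sigma>"
    by (simp add: field_simps power2_eq_square)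
  have p: "(a - 1/3)^2 * 1 \<le> (a - 1/3)^2 * (3 * (4/3 - a))" using assms by (intro mult_left_mono) auto
  have q: "0 \<le> a * \<sigma>" using assms by simp
  show "3 * a * ((1 - a)^2 - \<sigma>) \<le> 4 / 9" using id p q zero_le_power2[of "a - 1/3"] by linarith
  assume th: "0 \<le> \<theta>" "\<theta> \<le> 1/1000" "4 / 9 - \<theta>^2 \<le> 3 * a * ((1 - a)^2 - \<sigma>)"
  have "(a - 1/3)^2 \<le> \<theta>^2" using id p q th(3) by linarith
  then have ab: "\<bar>a - 1/3\<bar> \<le> 1 * \<theta>" using th by (intro sq_le_imp_abs_le) auto
  have a3: "a \<ge> 0.3" "a \<le> 0.4" using ab th by (auto simp: abs_le_iff)
  have "3 * a * \<sigma> \<le> \<theta>^2" using id p q th(3) zero_le_power2[of "a - 1/3"] by linarith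
  moreover have "0.9 * \<sigma> \<le> 3 * a * \<sigma>" using a3 assms by (intro mult_right_mono) auto
  moreover have "\<theta>^2 \<le> \<theta> * (1/1000)" unfolding power2_eq_square using th by (intro mult_left_mono) auto
  ultimately have s: "\<sigma> \<le> \<theta> * (1/900)" by linarith
  have "\<bar>a^2 - 1/9\<bar> = \<bar>a - 1/3\<bar> * \<bar>a + 1/3\<bar>"
    unfolding abs_mult[symmetric] by (simp add: power2_eq_square algebra_simps)
  also have "\<dots> \<le> \<theta> * 1" using ab a3 th by (intro mult_mono) auto
  finally have "\<bar>a^2 - 1/9\<bar> \<le> \<theta>" by simp
  then show "\<bar>1 - (a^2 + \<sigma>) - 8/9\<bar> \<le> 2 * \<theta>"
    using s assms(3) th(1) by linarith
qed

section \<open>Near-extremal weights supported on a clique\<close>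

lemma sum3_member_le:
  fixes f :: "nat \<Rightarrow> nat \<Rightarrow> nat \<Rightarrow> real"
  assumes "finite S" "\<And>a b c. a \<in> S \<Longrightarrow> b \<in> S \<Longrightarrow> c \<in> S \<Longrightarrow> 0 \<le> f a b c" "p \<in> S" "q \<in> S" "r \<in> S"
  shows "f p q r \<le> (\<Sum>a\<in>S. \<Sum>b\<in>S. \<Sum>c\<in>S. f a b c)"
proof -
  have "f p q r \<le> (\<Sum>c\<in>S. f p q c)"
    using assms by (intro member_le_sum) auto
  also have "\<dots> \<le> (\<Sum>b\<in>S. \<Sum>c\<in>S. f p b c)"
    using assms by (intro member_le_sum[of q S "\<lambda>b. \<Sum>c\<in>S. f p b c"] sum_nonneg) auto
  also have "\<dots> \<le> (\<Sum>a\<in>S. \<Sum>b\<in>S. \<Sum>c\<in>S. f a b c)"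
    using assms by (intro member_le_sum[of p S "\<lambda>a. \<Sum>b\<in>S. \<Sum>c\<in>S. f a b c"] sum_nonneg) auto
  finally show ?thesis .
qed

lemma weights_support:
  assumes "finite V" "y \<in> weights V"
  shows "{v. 0 < y v} \<subseteq> V" "finite {v. 0 < y v}" "\<And>v. v \<in> V - {v. 0 < y v} \<Longrightarrow> y v = 0"
    "sum y {v. 0 < y v} = 1"
proof -
  show sub: "{v. 0 < y v} \<subseteq> V" using assms(2) unfolding weights_def by force
  then show "finite {v. 0 < y v}" using assms(1) finite_subset by blast
  show z: "y v = 0" if "v \<in> V - {v. 0 < y v}" for v
    using that weights_nonneg[OF assms(2), of v] by simp
  have "sum y {v. 0 < y v} = sum y V" 
    by (rule sum.mono_neutral_left[OF assms(1) sub]) (blast intro: z)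
  then show "sum y {v. 0 < y v} = 1" using weights_sum[OF assms(2)] by simp
qed

lemma G26_hom_weights:
  assumes V: "finite V" and y: "y \<in> weights V"
    and \<psi>: "inj_on \<psi> {v. 0 < y v}" "\<psi> ` {v. 0 < y v} \<subseteq> {1..6}"
  obtains z :: "nat \<Rightarrow> real" where "\<forall>i. 0 \<le> z i" "z 1 + z 2 + z 3 + z 4 + z 5 + z 6 = 1"
    "\<forall>v. 0 < y v \<longrightarrow> z (\<psi> v) = y v" "\<forall>i. 0 < z i \<longrightarrow> i \<in> \<psi> ` {v. 0 < y v}"
    "(\<Sum>a\<in>{v. 0 < y v}. \<Sum>b\<in>{v. 0 < y v}. \<Sum>c\<in>{v. 0 < y v}.
        of_bool ({\<psi> a, \<psi> b, \<psi> c} \<in> G26_edges) * (y a * y b * y c)) =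
      6 * G26_poly (z 1) (z 2) (z 3) (z 4) (z 5) (z 6)"
proof
  let ?S = "{v. 0 < y v}"
  note S = weights_support[OF V y]
  define z where "z = (\<lambda>i. \<Sum>a\<in>{a \<in> ?S. \<psi> a = i}. y a)"
  show "\<forall>i. 0 \<le> z i" unfolding z_def using weights_nonneg[OF y] by (intro allI sum_nonneg) auto
  have "(\<Sum>i\<in>{1..6}. z i) = sum y ?S"
    unfolding z_def by (rule sum.group[OF S(2) _ \<psi>(2)]) simp
  then show "z 1 + z 2 + z 3 + z 4 + z 5 + z 6 = 1" unfolding S(4) set_1_6 by (simp add: add.assoc)
  show "\<forall>v. 0 < y v \<longrightarrow> z (\<psi> v) = y v"
  proof (intro allI impI)
    fix v assume that: "0 < y v"
    have "{a \<in> ?S. \<psi> a = \<psi> v} = {v}" using \<psi>(1) that unfolding inj_on_def by auto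
    then show "z (\<psi> v) = y v" unfolding z_def by (simp only: sum.insert finite.emptyI empty_iff not_False_eq_True sum.empty add_0_right)
  qed
  show "\<forall>i. 0 < z i \<longrightarrow> i \<in> \<psi> ` ?S"
  proof (intro allI impI, rule ccontr)
    fix i assume that: "0 < z i" and "i \<notin> \<psi> ` ?S"
    then have "{a \<in> ?S. \<psi> a = i} = {}" by auto
    then have "z i = 0" unfolding z_def by (simp only: sum.empty)
    then show False using that by simp
  qed
  show "(\<Sum>a\<in>?S. \<Sum>b\<in>?S. \<Sum>c\<in>?S. of_bool ({\<psi> a, \<psi> b, \<psi> c} \<in> G26_edges) * (y a * y b * y c)) =
      6 * G26_poly (z 1) (z 2) (z 3) (z 4) (z 5) (z 6)"
    unfolding tri_G26[symmetric] unfolding tri_def z_def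
    by (rule sum_push3[OF S(2) _ \<psi>(2)]) simp
qed

lemma supp_clique_clique:
  assumes "finite (fst H)" "y \<in> weights (fst H)" "supp_clique H y"
  shows "clique H {v. 0 < y v}"
  using weights_support(1)[OF assms(1,2)] assms(3) unfolding clique_def supp_clique_def by simp

lemma sum_sq_minus:
  assumes "finite V" "y \<in> weights V"
  shows "(y c)^2 \<le> (\<Sum>v\<in>V. (y v)^2)"
proof (cases "c \<in> V")
  case True
  then show ?thesis using assms by (intro member_le_sum[of c V "\<lambda>v. (y v)^2"]) auto
next
  case False
  then show ?thesis using assms by (auto simp: weights_def intro: sum_nonneg)
qed

lemma hom_tri_le:
  fixes y :: "nat \<Rightarrow> real"
  assumes "\<forall>e\<in>E. e \<subseteq> S \<longrightarrow> \<psi> ` e \<in> G" "a \<in> S" "b \<in> S" "c \<in> S" "0 \<le> y a" "0 \<le> y b" "0 \<le> y c"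
  shows "of_bool ({a, b, c} \<in> E) * (y a * y b * y c) \<le> of_bool ({\<psi> a, \<psi> b, \<psi> c} \<in> G) * (y a * y b * y c)"
proof (cases "{a, b, c} \<in> E")
  case True
  then have "\<psi> ` {a, b, c} \<in> G" using bspec[OF assms(1) True] assms(2-4) by simp
  then show ?thesis using True by simp
next
  case False
  then show ?thesis using assms(5-7) by simp
qed

lemma Mfree_clique_tri_le:
  assumes H: "hg3 H" "hfree Mfam H" and y: "y \<in> weights (fst H)" "supp_clique H y"
  shows "tri (snd H) (fst H) y y y \<le> 4 / 9"
proof -
  let ?S = "{v. 0 < y v}"
  have fin: "finite (fst H)" using H hg3_finite by blast
  note S = weights_support[OF fin y(1)]
  from Mfree_clique_structure[OF H supp_clique_clique[OF fin y]] show ?thesis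
  proof
    assume "\<exists>c. \<forall>e\<in>snd H. e \<subseteq> ?S \<longrightarrow> c \<in> e"
    then obtain c where c: "\<forall>e\<in>snd H. e \<subseteq> ?S \<longrightarrow> c \<in> e" by blast
    have "3 * y c * ((1 - y c)^2 - ((\<Sum>v\<in>fst H. (y v)^2) - (y c)^2)) \<le> 4 / 9"
      using star_value_le[OF weights_nonneg[OF y(1)] weights_le_1[OF fin y(1)]]
        sum_sq_minus[OF fin y(1), of c] by simp
    then show ?thesis using star_tri_le[OF H(1) y(1) c] by linarith
  next
    assume "\<exists>\<psi>. inj_on \<psi> ?S \<and> \<psi> ` ?S \<subseteq> {1..6} \<and> (\<forall>e\<in>snd H. e \<subseteq> ?S \<longrightarrow> \<psi> ` e \<in> G26_edges)"
    then obtain \<psi> where \<psi>: "inj_on \<psi> ?S" "\<psi> ` ?S \<subseteq> {1..6}" "\<forall>e\<in>snd H. e \<subseteq> ?S \<longrightarrow> \<psi> ` e \<in> G26_edges"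
      by blast
    obtain z :: "nat \<Rightarrow> real" where z': "\<forall>i. 0 \<le> z i" "z 1 + z 2 + z 3 + z 4 + z 5 + z 6 = 1"
      "\<forall>v. 0 < y v \<longrightarrow> z (\<psi> v) = y v" "\<forall>i. 0 < z i \<longrightarrow> i \<in> \<psi> ` ?S"
      "(\<Sum>a\<in>?S. \<Sum>b\<in>?S. \<Sum>c\<in>?S.
        of_bool ({\<psi> a, \<psi> b, \<psi> c} \<in> G26_edges) * (y a * y b * y c)) =
      6 * G26_poly (z 1) (z 2) (z 3) (z 4) (z 5) (z 6)"
      by (rule G26_hom_weights[OF fin y(1) \<psi>(1,2)], rule that)
    note z = z'[rule_format]
    have "tri (snd H) (fst H) y y y = tri (snd H) ?S y y y" by (rule tri_support[OF fin S(1,3)])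
    also have "\<dots> \<le> (\<Sum>a\<in>?S. \<Sum>b\<in>?S. \<Sum>c\<in>?S.
        of_bool ({\<psi> a, \<psi> b, \<psi> c} \<in> G26_edges) * (y a * y b * y c))"
      unfolding tri_def by (intro sum_mono hom_tri_le[OF \<psi>(3)] weights_nonneg[OF y(1)])
    also have "\<dots> \<le> 4 / 9" unfolding z(5) using G26_poly_le[OF z(2)] z(1) by simp
    finally show ?thesis .
  qed
qed

lemma Mfree_tri_le:
  assumes H: "hg3 H" "hfree Mfam H" and x: "x \<in> weights (fst H)"
  shows "tri (snd H) (fst H) x x x \<le> 4 / 9"
proof -
  obtain y where "y \<in> weights (fst H)" "tri (snd H) (fst H) x x x \<le> tri (snd H) (fst H) y y y"
    "supp_clique H y"
    using symmetrization[OF hg3_finite[OF H(1)] affine_along_tri[OF H(1)] x]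
    unfolding supp_clique_def by blast
  then show ?thesis using Mfree_clique_tri_le[OF H] by fastforce
qed

text \<open>As the weights sum to 1, the linear terms cancel and the sum of squares is
  \<open>1/6\<close> plus the squared deviations from \<open>1/6\<close>.\<close>

lemma sum_sq_near_uniform:
  fixes x1 x2 x3 x4 x5 x6 \<theta> :: real
  assumes "x1 + x2 + x3 + x4 + x5 + x6 = 1" "0 \<le> \<theta>" "\<theta> \<le> 1/1000"
    "\<bar>x1 - 1/6\<bar> \<le> 2 * \<theta>" "\<bar>x2 - 1/6\<bar> \<le> 2 * \<theta>" "\<bar>x3 - 1/6\<bar> \<le> 2 * \<theta>"
    "\<bar>x4 - 1/6\<bar> \<le> 2 * \<theta>" "\<bar>x5 - 1/6\<bar> \<le> 2 * \<theta>" "\<bar>x6 - 1/6\<bar> \<le> 2 * \<theta>"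
  shows "x1^2 + x2^2 + x3^2 + x4^2 + x5^2 + x6^2 \<le> 1/6 + \<theta>"
    and "1/6 \<le> x1^2 + x2^2 + x3^2 + x4^2 + x5^2 + x6^2"
proof -
  have sq: "(x - 1/6)^2 \<le> \<theta> / 6" if "\<bar>x - 1/6\<bar> \<le> 2 * \<theta>" for x :: real
  proof -
    have "(x - 1/6)^2 = \<bar>x - 1/6\<bar> * \<bar>x - 1/6\<bar>" by (simp add: power2_eq_square)
    also have "\<dots> \<le> (2 * \<theta>) * (1/500)" using that assms(2,3) by (intro mult_mono) auto
    finally show ?thesis using assms(2) by simp
  qed
  have e: "x1^2 + x2^2 + x3^2 + x4^2 + x5^2 + x6^2 = 1/6 + ((x1 - 1/6)^2 + (x2 - 1/6)^2 + (x3 - 1/6)^2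
     + (x4 - 1/6)^2 + (x5 - 1/6)^2 + (x6 - 1/6)^2)"
    using assms(1) by (simp add: power2_diff field_simps)
  show "x1^2 + x2^2 + x3^2 + x4^2 + x5^2 + x6^2 \<le> 1/6 + \<theta>"
    unfolding e using sq[OF assms(4)] sq[OF assms(5)] sq[OF assms(6)] sq[OF assms(7)] sq[OF assms(8)]
      sq[OF assms(9)] by linarith
  show "1/6 \<le> x1^2 + x2^2 + x3^2 + x4^2 + x5^2 + x6^2" unfolding e by simp
qed

definition G26_copy :: "hg \<Rightarrow> nat set \<Rightarrow> (nat \<Rightarrow> nat) \<Rightarrow> bool" where
  "G26_copy H S \<psi> \<longleftrightarrow> S \<subseteq> fst H \<and> bij_betw \<psi> S {1..6} \<and> (\<forall>e\<subseteq>S. e \<in> snd H \<longleftrightarrow> \<psi> ` e \<in> G26_edges)"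

text \<open>In the second case the colour weights are all near \<open>1/6\<close>, hence positive,
  so all six colours occur; then no edge of \<open>G26\<close> can be absent, because a single
  absent edge would cost more than the deficit allows.\<close>

lemma Mfree_clique_near_extremal:
  assumes H: "hg3 H" "hfree Mfam H" and y: "y \<in> weights (fst H)" "supp_clique H y"
    and th: "0 \<le> \<theta>" "\<theta> \<le> 1/1000" "4 / 9 - \<theta>^2 \<le> tri (snd H) (fst H) y y y"
  shows "\<bar>bil (shadow H) (fst H) y y - 8/9\<bar> \<le> 2 * \<theta> \<or>
    \<bar>bil (shadow H) (fst H) y y - 5/6\<bar> \<le> \<theta> \<and>
    (\<exists>\<psi>. G26_copy H {v. 0 < y v} \<psi> \<and> (\<forall>v. 0 < y v \<longrightarrow> \<bar>y v - 1/6\<bar> \<le> 2 * \<theta>))"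
proof -
  let ?S = "{v. 0 < y v}"
  have fin: "finite (fst H)" using H hg3_finite by blast
  note S = weights_support[OF fin y(1)]
  note Q = clique_bil[OF H(1) y]
  from Mfree_clique_structure[OF H supp_clique_clique[OF fin y]] show ?thesis
  proof
    assume "\<exists>c. \<forall>e\<in>snd H. e \<subseteq> ?S \<longrightarrow> c \<in> e"
    then obtain c where c: "\<forall>e\<in>snd H. e \<subseteq> ?S \<longrightarrow> c \<in> e" by blast
    let ?W = "\<Sum>v\<in>fst H. (y v)^2"
    have nn: "0 \<le> ?W - (y c)^2" using sum_sq_minus[OF fin y(1), of c] by simp
    have "4 / 9 - \<theta>^2 \<le> 3 * y c * ((1 - y c)^2 - (?W - (y c)^2))"
      using star_tri_le[OF H(1) y(1) c] th(3) by linarith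
    then have "\<bar>1 - ((y c)^2 + (?W - (y c)^2)) - 8/9\<bar> \<le> 2 * \<theta>"
      by (rule star_value_near[OF weights_nonneg[OF y(1)] weights_le_1[OF fin y(1)] nn th(1,2)])
    then show ?thesis unfolding Q by simp
  next
    assume "\<exists>\<psi>. inj_on \<psi> ?S \<and> \<psi> ` ?S \<subseteq> {1..6} \<and> (\<forall>e\<in>snd H. e \<subseteq> ?S \<longrightarrow> \<psi> ` e \<in> G26_edges)"
    then obtain \<psi> where \<psi>: "inj_on \<psi> ?S" "\<psi> ` ?S \<subseteq> {1..6}" "\<forall>e\<in>snd H. e \<subseteq> ?S \<longrightarrow> \<psi> ` e \<in> G26_edges"
      by blast
    define G where "G = (\<lambda>a b c. of_bool ({\<psi> a, \<psi> b, \<psi> c} \<in> G26_edges) * (y a * y b * y c))"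
    obtain z :: "nat \<Rightarrow> real" where z': "\<forall>i. 0 \<le> z i" "z 1 + z 2 + z 3 + z 4 + z 5 + z 6 = 1"
      "\<forall>v. 0 < y v \<longrightarrow> z (\<psi> v) = y v" "\<forall>i. 0 < z i \<longrightarrow> i \<in> \<psi> ` ?S"
      "(\<Sum>a\<in>?S. \<Sum>b\<in>?S. \<Sum>c\<in>?S.
        of_bool ({\<psi> a, \<psi> b, \<psi> c} \<in> G26_edges) * (y a * y b * y c)) =
      6 * G26_poly (z 1) (z 2) (z 3) (z 4) (z 5) (z 6)"
      by (rule G26_hom_weights[OF fin y(1) \<psi>(1,2)], rule that)
    have "(\<Sum>a\<in>?S. \<Sum>b\<in>?S. \<Sum>c\<in>?S. G a b c) = 6 * G26_poly (z 1) (z 2) (z 3) (z 4) (z 5) (z 6)"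
      unfolding G_def by (rule z'(5))
    note z = z'(1-4)[rule_format] this
    have tri_S: "tri (snd H) (fst H) y y y = tri (snd H) ?S y y y" by (rule tri_support[OF fin S(1,3)])
    have le: "of_bool ({a, b, c} \<in> snd H) * (y a * y b * y c) \<le> G a b c" if "a \<in> ?S" "b \<in> ?S" "c \<in> ?S" for a b c
      unfolding G_def by (intro hom_tri_le[OF \<psi>(3)] weights_nonneg[OF y(1)] that)
    have "tri (snd H) ?S y y y \<le> (\<Sum>a\<in>?S. \<Sum>b\<in>?S. \<Sum>c\<in>?S. G a b c)"
      unfolding tri_def by (intro sum_mono le)
    then have "4 / 9 - \<theta>^2 \<le> 6 * G26_poly (z 1) (z 2) (z 3) (z 4) (z 5) (z 6)"
      using th(3) tri_S z(5) by linarith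
    note near = G26_poly_near[OF z(2) z(1) z(1) z(1) z(1) z(1) z(1) th(1,2) this]
    have nearz: "\<bar>z i - 1/6\<bar> \<le> 2 * \<theta>" if "i \<in> {1..6}" for i
      using near that unfolding set_1_6 by auto
    have surj: "\<psi> ` ?S = {1..6}"
    proof
      show "{1..6} \<subseteq> \<psi> ` ?S"
      proof
        fix i :: nat assume "i \<in> {1..6}"
        then have "0 < z i" using abs_le_D2[OF nearz[of i]] th by simp
        then show "i \<in> \<psi> ` ?S" by (rule z(4))
      qed
    qed (rule \<psi>(2))
    have bij: "bij_betw \<psi> ?S {1..6}" using \<psi>(1) surj unfolding bij_betw_def by blast
    have neary: "\<bar>y v - 1/6\<bar> \<le> 2 * \<theta>" if "0 < y v" for v
    proof -
      have "\<psi> v \<in> {1..6}" using surj that by blast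
      then show ?thesis using nearz[of "\<psi> v"] z(3)[OF that] by simp
    qed
    have "(\<Sum>v\<in>fst H. (y v)^2) = (\<Sum>v\<in>?S. (y v)^2)"
    proof (rule sum.mono_neutral_right[OF fin S(1)], rule ballI)
      fix v assume "v \<in> fst H - ?S"
      from S(3)[OF this] show "(y v)^2 = 0" by simp
    qed
    also have "\<dots> = (\<Sum>v\<in>?S. (z (\<psi> v))^2)" using z(3) by simp
    also have "\<dots> = (\<Sum>i\<in>{1..6}. (z i)^2)" by (rule sum.reindex_bij_betw[OF bij])
    finally have W: "(\<Sum>v\<in>fst H. (y v)^2) = (z 1)^2 + (z 2)^2 + (z 3)^2 + (z 4)^2 + (z 5)^2 + (z 6)^2"
      unfolding set_1_6 by (simp add: add.assoc)
    have Qb: "\<bar>bil (shadow H) (fst H) y y - 5/6\<bar> \<le> \<theta>"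
      unfolding Q W using sum_sq_near_uniform[OF z(2) th(1,2)] near by (auto simp: abs_le_iff)
    \<comment> \<open>An absent edge loses at least \<open>0.16^3\<close>, about 0.004, from the
      value of the full \<open>G26\<close>, whereas the whole loss is at most
      \<open>\<theta>^2\<close>, that is at most \<open>10^(-6)\<close>.\<close>
    have full: "e \<in> snd H" if e: "e \<subseteq> ?S" "\<psi> ` e \<in> G26_edges" for e
    proof (rule ccontr)
      assume ne: "e \<notin> snd H"
      have "card e = 3" using G26_edge_card[OF e(2)] \<psi>(1) e(1) by (metis card_image inj_on_subset)
      then obtain p q r where pqr: "e = {p, q, r}" by (auto simp: card_3_iff)
      then have m: "p \<in> ?S" "q \<in> ?S" "r \<in> ?S" using e(1) by auto
      define f where "f = (\<lambda>a b c. G a b c - of_bool ({a, b, c} \<in> snd H) * (y a * y b * y c))"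
      have "f p q r \<le> (\<Sum>a\<in>?S. \<Sum>b\<in>?S. \<Sum>c\<in>?S. f a b c)"
        by (rule sum3_member_le[OF S(2) _ m]) (use le in \<open>auto simp: f_def\<close>)
      also have "\<dots> = (\<Sum>a\<in>?S. \<Sum>b\<in>?S. \<Sum>c\<in>?S. G a b c) - tri (snd H) ?S y y y"
        unfolding f_def tri_def by (simp add: sum_subtractf)
      also have "\<dots> \<le> \<theta>^2"
        using z(5) G26_poly_le[OF z(2)] z(1) th(3) tri_S by simp
      finally have "f p q r \<le> \<theta>^2" .
      moreover have "f p q r = y p * y q * y r" using ne e(2) unfolding f_def G_def pqr by simp
      moreover have "y v \<ge> 0.16" if "v \<in> ?S" for v using abs_le_D2[OF neary[of v]] that th by simp
      then have "y p * y q * y r \<ge> 0.16 * 0.16 * 0.16" using m by (intro mult_mono) auto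
      moreover have "\<theta>^2 \<le> (1/1000)^2" using th by (intro power_mono) auto
      ultimately show False by (simp add: power2_eq_square)
    qed
    have "\<forall>e\<subseteq>?S. e \<in> snd H \<longleftrightarrow> \<psi> ` e \<in> G26_edges"
    proof (intro allI impI)
      fix e assume "e \<subseteq> ?S"
      then show "e \<in> snd H \<longleftrightarrow> \<psi> ` e \<in> G26_edges" using full \<psi>(3) by metis
    qed
    then have "G26_copy H ?S \<psi>" unfolding G26_copy_def using S(1) bij by simp
    moreover have "\<forall>v. 0 < y v \<longrightarrow> \<bar>y v - 1/6\<bar> \<le> 2 * \<theta>" using neary by simp
    ultimately show ?thesis using Qb by (intro disjI2 conjI exI[of _ \<psi>])
  qed
qed

section \<open>Links measured by near-optimal weights\<close>

definition link :: "hg \<Rightarrow> nat \<Rightarrow> (nat \<Rightarrow> real) \<Rightarrow> real" where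
  "link H v y = (\<Sum>b\<in>fst H. \<Sum>c\<in>fst H. of_bool ({v, b, c} \<in> snd H) * (y b * y c))"

lemma tri_link: "tri (snd H) (fst H) x y y = (\<Sum>v\<in>fst H. x v * link H v y)"
  unfolding tri_def link_def by (simp add: sum_distrib_left mult_ac)

text \<open>If a vertex \<open>v\<close> had a larger link, moving a little weight from a near-optimal \<open>y\<close> to \<open>v\<close>
  would exceed the maximum \<open>4/9\<close>.\<close>

lemma link_le:
  assumes H: "hg3 H" "hfree Mfam H" and y: "y \<in> weights (fst H)" and v: "v \<in> fst H"
    and th: "0 < \<theta>" "\<theta> \<le> 1/1000" "4 / 9 - \<theta>^2 \<le> tri (snd H) (fst H) y y y"
  shows "link H v y \<le> 4 / 9 + 2 * \<theta>"
proof (rule ccontr)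
  assume neg: "\<not> ?thesis"
  let ?V = "fst H" and ?E = "snd H"
  have fin: "finite ?V" using H hg3_finite by blast
  define d :: "nat \<Rightarrow> real" where "d = (\<lambda>w. of_bool (w = v))"
  define x where "x = (\<lambda>w. (1 - \<theta>) * y w + \<theta> * d w)"
  have ynn: "0 \<le> y w" for w using weights_nonneg[OF y] .
  have dnn: "0 \<le> d w" for w unfolding d_def by simp
  have sd: "sum d ?V = 1" unfolding d_def using fin v by (simp add: of_bool_def)
  have dl: "tri ?E ?V d y y = link H v y"
    unfolding tri_link d_def using fin v by (simp add: of_bool_def if_distrib[of "\<lambda>u. u * _"] cong: if_cong)
  have "x \<in> weights ?V"
    unfolding weights_def
  proof (intro CollectI conjI allI impI)
    show "0 \<le> x w" for w unfolding x_def using ynn[of w] dnn[of w] th by simp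
    show "x w = 0" if "w \<notin> ?V" for w using that y v unfolding x_def d_def weights_def by auto
    show "sum x ?V = 1" unfolding x_def by (simp add: sum.distrib sum_distrib_left[symmetric] weights_sum[OF y] sd)
  qed
  then have up: "tri ?E ?V x x x \<le> 4 / 9" by (rule Mfree_tri_le[OF H])
  define k where "k = (1 - \<theta>)^2 * \<theta>"
  \<comment> \<open>Of the expansion of the product only the parts with \<open>d\<close> in at most
    one slot are kept; the parts with \<open>d\<close> in two or three slots are
    nonnegative.\<close>
  have t: "(1 - \<theta>)^3 * (of_bool P * (y a * y b * y c)) + k * (of_bool P * (d a * y b * y c))
      + k * (of_bool P * (y a * d b * y c)) + k * (of_bool P * (y a * y b * d c))
      \<le> of_bool P * (x a * x b * x c)" for a b c P
  proof -
    have "0 \<le> (1 - \<theta>) * \<theta>^2 * (d a * d b * y c + d a * y b * d c + y a * d b * d c) + \<theta>^3 * (d a * d b * d c)"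
      using th by (intro add_nonneg_nonneg mult_nonneg_nonneg ynn dnn) auto
    also have "\<dots> = x a * x b * x c - ((1 - \<theta>)^3 * (y a * y b * y c) + k * (d a * y b * y c)
      + k * (y a * d b * y c) + k * (y a * y b * d c))"
      unfolding x_def k_def by (simp add: algebra_simps power2_eq_square power3_eq_cube)
    finally show ?thesis by (cases P) auto
  qed
  have "(1 - \<theta>)^3 * tri ?E ?V y y y + k * tri ?E ?V d y y + k * tri ?E ?V y d y + k * tri ?E ?V y y d
     \<le> tri ?E ?V x x x"
    unfolding tri_def sum_distrib_left sum.distrib[symmetric] by (intro sum_mono t)
  also have "tri ?E ?V y d y = tri ?E ?V d y y" by (rule tri_swap12)
  also have "tri ?E ?V y y d = tri ?E ?V d y y" by (metis tri_swap12 tri_swap23)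
  finally have main: "(1 - \<theta>)^3 * tri ?E ?V y y y + 3 * k * link H v y \<le> 4 / 9"
    using up unfolding dl by simp
  have "(1 - \<theta>)^3 * (4 / 9 - \<theta>^2) \<le> (1 - \<theta>)^3 * tri ?E ?V y y y"
    using th by (intro mult_left_mono) auto
  moreover have "3 * k * (4 / 9 + 2 * \<theta>) \<le> 3 * k * link H v y"
    using th neg unfolding k_def by (intro mult_left_mono) auto
  ultimately have "(1 - \<theta>)^3 * (4 / 9 - \<theta>^2) + 3 * k * (4 / 9 + 2 * \<theta>) \<le> 4 / 9"
    using main by linarith
  \<comment> \<open>The constant and the linear terms in \<theta> cancel. The coefficient of
    \<open>\<theta>^2\<close> is about \<open>5 - 4/3\<close>, so the assumed link would push the
    value above \<open>4/9\<close>.\<close>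
  moreover have "(1 - \<theta>)^3 * (4 / 9 - \<theta>^2) + 3 * k * (4 / 9 + 2 * \<theta>) - 4 / 9 =
     \<theta>^2 * (8 * \<theta> / 9 - 4 / 3 + (1 - \<theta>)^2 * (5 + \<theta>))"
    unfolding k_def by (simp add: field_simps power2_eq_square power3_eq_cube)
  moreover have "(1 - \<theta>)^2 \<ge> 0.9^2" using th by (intro power_mono) auto
  then have "(1 - \<theta>)^2 * (5 + \<theta>) \<ge> 0.9^2 * 5" using th by (intro mult_mono) auto
  then have "8 * \<theta> / 9 - 4 / 3 + (1 - \<theta>)^2 * (5 + \<theta>) > 0" using th by (simp add: power2_eq_square)
  then have "\<theta>^2 * (8 * \<theta> / 9 - 4 / 3 + (1 - \<theta>)^2 * (5 + \<theta>)) > 0" using th by simp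
  ultimately show False by linarith
qed


section \<open>Colouring relative to a copy of \<open>G26\<close>\<close>

text \<open>Only edges with two vertices in the copy are tested: a local condition that any
  colouring extending \<psi> has to satisfy at \<open>v\<close>.\<close>

definition colours :: "hg \<Rightarrow> nat set \<Rightarrow> (nat \<Rightarrow> nat) \<Rightarrow> nat \<Rightarrow> nat set" where
  "colours H S \<psi> v =
     {i \<in> {1..6}. \<forall>s\<in>S. \<forall>t\<in>S. {v, s, t} \<in> snd H \<longrightarrow> {i, \<psi> s, \<psi> t} \<in> G26_edges}"

lemma G26_pair_covered:
  assumes "i \<in> {1..6}" "j \<in> {1..6}" "i \<noteq> j"
  shows "\<exists>k\<in>{1..6}. {i, j, k} \<in> G26_edges"
  using assms unfolding G26_edge_iff set_1_6
  by (elim insertE emptyE; hypsubst; simp)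

text \<open>Pairs of the copy are already covered by edges inside the copy. No covering vertices
  have to be added, which leaves the vertex budget of \<open>M3\<close> for arbitrary further
  vertices.\<close>

lemma G26_copy_core:
  assumes S: "G26_copy H S \<psi>" "S \<subseteq> U"
  shows "is_core (induced H U) S 6"
proof -
  have bij: "bij_betw \<psi> S {1..6}" using S unfolding G26_copy_def by blast
  have "card S = 6" using bij_betw_same_card[OF bij] by simp
  moreover have "\<exists>e\<in>snd (induced H U). {u, v} \<subseteq> e" if uv: "u \<in> S" "v \<in> S" "u \<noteq> v" for u v
  proof -
    have "\<psi> u \<noteq> \<psi> v" "\<psi> u \<in> {1..6}" "\<psi> v \<in> {1..6}"
      using bij uv unfolding bij_betw_def inj_on_def by blast+
    then obtain k where k: "k \<in> {1..6}" "{\<psi> u, \<psi> v, k} \<in> G26_edges" using G26_pair_covered by blast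
    obtain w where w: "w \<in> S" "\<psi> w = k" using bij k(1) unfolding bij_betw_def by (metis imageE)
    have sub: "{u, v, w} \<subseteq> S" using uv w by blast
    moreover have "\<psi> ` {u, v, w} \<in> G26_edges" using k(2) w(2) by simp
    ultimately have "{u, v, w} \<in> snd H" using S(1) unfolding G26_copy_def by metis
    then show ?thesis using sub S(2) unfolding induced_def by (intro bexI[of _ "{u, v, w}"]) auto
  qed
  ultimately show ?thesis using S(2) unfolding is_core_def by (simp add: induced_def)
qed

text \<open>Every homomorphism from the copy to \<open>G26\<close> is an automorphism, so that a colouring
  can be normalised to be the identity on the copy.\<close>

lemma G26_copy_extend:
  assumes H: "hg3 H" "hfree Mfam H" and S: "G26_copy H S \<psi>" and W: "W \<subseteq> fst H" "finite W" "card W \<le> 3"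
  shows "\<exists>\<phi>. G26_col \<phi> (induced H (S \<union> W)) \<and> (\<forall>s\<in>S. \<phi> s = \<psi> s)"
proof -
  let ?U = "S \<union> W"
  have bij: "bij_betw \<psi> S {1..6}" and SV: "S \<subseteq> fst H"
    and ed: "\<And>e. e \<subseteq> S \<Longrightarrow> e \<in> snd H \<longleftrightarrow> \<psi> ` e \<in> G26_edges"
    using S unfolding G26_copy_def by blast+
  have finS: "finite S" using bij bij_betw_finite by blast
  have inj: "inj_on \<psi> S" and img: "\<psi> ` S = {1..6}" using bij unfolding bij_betw_def by auto
  have cS: "card S = 6" using bij_betw_same_card[OF bij] by simp
  have U: "?U \<subseteq> fst H" using SV W by blast
  have "card ?U \<le> 21" using card_Un_le[of S W] cS W(3) by linarith
  note core = G26_copy_core[OF S, of ?U, simplified]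
  define \<psi>' where "\<psi>' = inv_into S \<psi>"
  have \<psi>': "\<psi>' i \<in> S" "\<psi> (\<psi>' i) = i" if "i \<in> {1..6}" for i
    using that img unfolding \<psi>'_def by (auto intro: inv_into_into f_inv_into_f simp: img)
  have lift: "\<psi>' ` e \<subseteq> S \<and> \<psi>' ` e \<in> snd H" if e: "e \<in> G26_edges" for e
  proof -
    have e6: "e \<subseteq> {1..6}" using G26_edge_sub[OF e] .
    then have sub: "\<psi>' ` e \<subseteq> S" using \<psi>'(1) by blast
    have "\<psi> ` \<psi>' ` e = (\<lambda>i. i) ` e" unfolding image_image
      by (rule image_cong) (use \<psi>'(2) e6 in auto)
    then show ?thesis using ed[OF sub] sub e by simp
  qed
  have not_star: False if c: "\<forall>e\<in>snd H. e \<subseteq> S \<longrightarrow> c \<in> e" for c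
  proof -
    \<comment> \<open>The copy contains two disjoint edges, so it is not a star and the colouring
      alternative must hold.\<close>
    have g: "{1, 2, 4} \<in> G26_edges" "{3, 5, 6} \<in> G26_edges" by (simp_all add: G26_edge_iff)
    have "c \<in> \<psi>' ` {1, 2, 4}" "c \<in> \<psi>' ` {3, 5, 6}" using lift[OF g(1)] lift[OF g(2)] c by blast+
    then obtain i j where ij: "i \<in> {1, 2, 4}" "j \<in> {3, 5, 6}" "c = \<psi>' i" "c = \<psi>' j" by blast
    then have "\<psi> c = i" "\<psi> c = j" using \<psi>'(2)[of i] \<psi>'(2)[of j] by auto
    then show False using ij(1,2) by auto
  qed
  obtain \<phi> where \<phi>: "G26_col \<phi> (induced H ?U)"
    using Mfree_core6[OF H U \<open>card ?U \<le> 21\<close> core] not_star by blast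
  have \<phi>U: "\<phi> v \<in> {1..6}" if "v \<in> ?U" for v
    using \<phi> that unfolding G26_col_def induced_def by simp
  have \<phi>E: "\<phi> ` e \<in> G26_edges" if "e \<in> snd H" "e \<subseteq> ?U" for e
    using \<phi> that unfolding G26_col_def induced_def by simp
  have \<phi>inj: "inj_on \<phi> S" using G26_col_core_inj[OF hg3_induced[OF H(1) U] \<phi> core] .
  define \<chi> where "\<chi> = \<phi> \<circ> \<psi>'"
  have \<chi>inj: "inj_on \<chi> {1..6}"
  proof (rule inj_onI)
    fix i j assume ij: "i \<in> {1..6}" "j \<in> {1..6}" "\<chi> i = \<chi> j"
    then have "\<psi>' i = \<psi>' j" using \<phi>inj \<psi>'(1) unfolding \<chi>_def inj_on_def by simp
    then show "i = j" using \<psi>'(2) ij by metis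
  qed
  have \<chi>sub: "\<chi> ` {1..6} \<subseteq> {1..6}" using \<psi>'(1) \<phi>U unfolding \<chi>_def by auto
  have \<chi>E: "\<chi> ` e \<in> G26_edges" if "e \<in> G26_edges" for e
  proof -
    have "\<phi> ` \<psi>' ` e \<in> G26_edges" using lift[OF that] by (intro \<phi>E) auto
    then show ?thesis unfolding \<chi>_def by (simp only: image_comp)
  qed
  have finE: "finite G26_edges" by (rule finite_subset[of _ "Pow {1..6}"]) (use G26_edge_sub in auto)
  \<comment> \<open>An injective self-map of the finite edge set of \<open>G26\<close> is onto.
    Hence the inverse of \<chi> also preserves edges and may be composed with the colouring to make
    it agree with \<psi> on the copy.\<close>
  have "inj_on (\<lambda>e. \<chi> ` e) G26_edges"
    by (rule inj_onI) (use inj_on_image_eq_iff[OF \<chi>inj] G26_edge_sub in metis)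
  moreover have "(\<lambda>e. \<chi> ` e) ` G26_edges \<subseteq> G26_edges" using \<chi>E by blast
  ultimately have surjE: "(\<lambda>e. \<chi> ` e) ` G26_edges = G26_edges"
    using endo_inj_surj[OF finE] by blast
  have \<chi>surj: "\<chi> ` {1..6} = {1..6}" using endo_inj_surj[OF _ \<chi>sub \<chi>inj] by simp
  define \<chi>' where "\<chi>' = inv_into {1..6} \<chi>"
  have \<chi>'1: "\<chi>' (\<chi> i) = i" if "i \<in> {1..6}" for i
    unfolding \<chi>'_def using inv_into_f_f[OF \<chi>inj that] .
  have \<chi>'2: "\<chi>' i \<in> {1..6}" if "i \<in> {1..6}" for i
    unfolding \<chi>'_def using inv_into_into[of i \<chi> "{1..6}"] that \<chi>surj by simp
  have "G26_col (\<chi>' \<circ> \<phi>) (induced H ?U)"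
    unfolding G26_col_def
  proof (intro conjI ballI)
    fix v assume "v \<in> fst (induced H ?U)"
    then show "(\<chi>' \<circ> \<phi>) v \<in> {1..6}" using \<chi>'2 \<phi>U unfolding induced_def by simp
  next
    fix e assume "e \<in> snd (induced H ?U)"
    then have "\<phi> ` e \<in> G26_edges" using \<phi>E unfolding induced_def by simp
    then obtain e' where e': "e' \<in> G26_edges" "\<phi> ` e = \<chi> ` e'" using surjE by blast
    have "(\<chi>' \<circ> \<phi>) ` e = \<chi>' ` \<chi> ` e'" using e'(2) by (metis image_comp)
    also have "\<dots> = (\<lambda>i. i) ` e'" unfolding image_image
      by (rule image_cong) (use \<chi>'1 G26_edge_sub[OF e'(1)] in auto)
    finally show "(\<chi>' \<circ> \<phi>) ` e \<in> G26_edges" using e'(1) by simp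
  qed
  moreover have "(\<chi>' \<circ> \<phi>) s = \<psi> s" if s: "s \<in> S" for s
  proof -
    have "\<psi> s \<in> {1..6}" using img s by blast
    moreover have "\<psi>' (\<psi> s) = s" unfolding \<psi>'_def using inv_into_f_f[OF inj s] .
    then have "\<chi> (\<psi> s) = \<phi> s" unfolding \<chi>_def by simp
    ultimately show ?thesis using \<chi>'1[of "\<psi> s"] by simp
  qed
  ultimately show ?thesis by blast
qed

text \<open>The copy and the edge together have at most 9 vertices, so they have a colouring that
  agrees with \<psi> on the copy. It selects an admissible colour at each vertex of the edge and
  separates these vertices.\<close>

lemma edge_colours:
  assumes H: "hg3 H" "hfree Mfam H" and S: "G26_copy H S \<psi>" and e: "{u, v, w} \<in> snd H"
  shows "\<exists>i j. i \<in> colours H S \<psi> u \<and> j \<in> colours H S \<psi> v \<and> i \<noteq> j"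
proof -
  let ?U = "S \<union> {u, v, w}"
  have W: "{u, v, w} \<subseteq> fst H" using hg3_sub[OF H(1) e] .
  have "card {u, v, w} \<le> 3" using hg3_card[OF H(1) e] by simp
  from G26_copy_extend[OF H S W _ this] obtain \<phi> where
    \<phi>: "G26_col \<phi> (induced H ?U)" "\<forall>s\<in>S. \<phi> s = \<psi> s" by auto
  have mem: "\<phi> a \<in> colours H S \<psi> a" if a: "a \<in> {u, v, w}" for a
    unfolding colours_def
  proof (intro CollectI conjI ballI impI)
    have "a \<in> fst (induced H ?U)" using a unfolding induced_def by auto
    then show "\<phi> a \<in> {1..6}" using \<phi>(1) unfolding G26_col_def by blast
  next
    fix s t assume st: "s \<in> S" "t \<in> S" "{a, s, t} \<in> snd H"
    then have "{a, s, t} \<in> snd (induced H ?U)" using a unfolding induced_def by auto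
    then have "\<phi> ` {a, s, t} \<in> G26_edges" using \<phi>(1) unfolding G26_col_def by blast
    then show "{\<phi> a, \<psi> s, \<psi> t} \<in> G26_edges" using \<phi>(2) st by simp
  qed
  have "{u, v, w} \<in> snd (induced H ?U)" using e unfolding induced_def by auto
  then have "\<phi> ` {u, v, w} \<in> G26_edges" using \<phi>(1) unfolding G26_col_def by blast
  then have "\<phi> u \<noteq> \<phi> v" using G26_edge_iff[of "\<phi> u" "\<phi> v" "\<phi> w"] by simp
  then show ?thesis using mem by blast
qed

text \<open>A link pair of a vertex with two admissible colours avoids both of them, so only 4
  vertices of the copy are available: 12 ordered pairs, of total weight about
  \<open>12/36 = 1/3\<close>. A vertex attached like a vertex of \<open>G26\<close> has 16 ordered
  pairs, that is \<open>4/9\<close>; the bound \<open>7/18\<close> lies halfway between.\<close>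

lemma ambiguous_link_le:
  assumes H: "hg3 H" and y: "y \<in> weights (fst H)" and S: "G26_copy H {v. 0 < y v} \<psi>"
    and th: "0 \<le> \<theta>" "\<theta> \<le> 1/1000" and near: "\<forall>v. 0 < y v \<longrightarrow> \<bar>y v - 1/6\<bar> \<le> 2 * \<theta>"
    and ij: "i \<in> colours H {v. 0 < y v} \<psi> v" "j \<in> colours H {v. 0 < y v} \<psi> v" "i \<noteq> j"
  shows "link H v y \<le> 7 / 18"
proof -
  let ?S = "{v. 0 < y v}"
  have bij: "bij_betw \<psi> ?S {1..6}" using S unfolding G26_copy_def by blast
  have finS: "finite ?S" using bij bij_betw_finite by blast
  have fin: "finite (fst H)" using H hg3_finite by blast
  have inj: "inj_on \<psi> ?S" and img: "\<psi> ` ?S = {1..6}" using bij unfolding bij_betw_def by auto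
  define m :: real where "m = 1/6 + 2 * \<theta>"
  define R where "R = {s \<in> ?S. \<psi> s \<notin> {i, j}}"
  have "\<psi> ` R = {1..6} - {i, j}" unfolding R_def using img by blast
  moreover have "i \<in> {1..6}" "j \<in> {1..6}" using ij unfolding colours_def by blast+
  then have "card ({1..6} - {i, j}) = 4" using ij(3) by (subst card_Diff_subset) auto
  moreover have "inj_on \<psi> R" using inj unfolding R_def inj_on_def by blast
  ultimately have cR: "card R = 4" using card_image by metis
  have finR: "finite R" using finS unfolding R_def by simp
  have RV: "R \<subseteq> fst H" using S unfolding R_def G26_copy_def by blast
  have t: "of_bool ({v, b, c} \<in> snd H) * (y b * y c) \<le>
      (if b \<in> R \<and> c \<in> R \<and> b \<noteq> c then m * m else 0)" for b c
  proof (cases "{v, b, c} \<in> snd H \<and> 0 < y b \<and> 0 < y c")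
    case True
    have e: "{i, \<psi> b, \<psi> c} \<in> G26_edges" "{j, \<psi> b, \<psi> c} \<in> G26_edges"
      using ij True unfolding colours_def by blast+
    have ne: "\<psi> b \<notin> {i, j}" "\<psi> c \<notin> {i, j}" "b \<noteq> c"
      using e(1)[unfolded G26_edge_iff] e(2)[unfolded G26_edge_iff] by auto
    then have R: "b \<in> R" "c \<in> R" unfolding R_def using True by auto
    have "y b \<le> m" "y c \<le> m" unfolding m_def
      using abs_le_D1[OF near[rule_format, of b]] abs_le_D1[OF near[rule_format, of c]] True by auto
    then have "y b * y c \<le> m * m" using True by (intro mult_mono) auto
    then show ?thesis using R ne True by simp
  next
    case False
    then have "{v, b, c} \<notin> snd H \<or> y b = 0 \<or> y c = 0"
      using weights_nonneg[OF y, of b] weights_nonneg[OF y, of c] by linarith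
    then have "of_bool ({v, b, c} \<in> snd H) * (y b * y c) = 0" by auto
    also have "0 \<le> (if b \<in> R \<and> c \<in> R \<and> b \<noteq> c then m * m else 0)" by simp
    finally show ?thesis .
  qed
  have "link H v y \<le> (\<Sum>b\<in>fst H. \<Sum>c\<in>fst H. if b \<in> R \<and> c \<in> R \<and> b \<noteq> c then m * m else 0)"
    unfolding link_def by (intro sum_mono t)
  also have "\<dots> = (\<Sum>b\<in>R. \<Sum>c\<in>fst H. if b \<in> R \<and> c \<in> R \<and> b \<noteq> c then m * m else 0)"
    by (rule sum.mono_neutral_right[OF fin RV]) auto
  also have "\<dots> = (\<Sum>b\<in>R. \<Sum>c\<in>R - {b}. m * m)"
  proof (rule sum.cong[OF refl])
    fix b assume b: "b \<in> R"
    have "(\<Sum>c\<in>fst H. if b \<in> R \<and> c \<in> R \<and> b \<noteq> c then m * m else 0) =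
      (\<Sum>c\<in>R - {b}. if b \<in> R \<and> c \<in> R \<and> b \<noteq> c then m * m else 0)"
      by (rule sum.mono_neutral_right[OF fin]) (use RV in auto)
    also have "\<dots> = (\<Sum>c\<in>R - {b}. m * m)" using b by (intro sum.cong) auto
    finally show "(\<Sum>c\<in>fst H. if b \<in> R \<and> c \<in> R \<and> b \<noteq> c then m * m else 0) = (\<Sum>c\<in>R - {b}. m * m)" .
  qed
  also have "\<dots> = (\<Sum>b\<in>R. 3 * (m * m))" using cR finR by (intro sum.cong) auto
  also have "\<dots> = 12 * (m * m)" using cR by simp
  also have "m * m \<le> 0.17 * 0.17" unfolding m_def using th by (intro mult_mono) auto
  finally show ?thesis by simp
qed

section \<open>From unique colours to the shadow bound\<close>

lemma sum_sq_six:
  fixes X :: "nat \<Rightarrow> real"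
  shows "(\<Sum>i\<in>{1..6}. X i)^2 \<le> 6 * (\<Sum>i\<in>{1..6}. (X i)^2)"
proof -
  define T where "T = (\<Sum>i\<in>{1..6}. X i)"
  have "0 \<le> (\<Sum>i\<in>{1..6::nat}. (X i - T / 6)^2)" by (intro sum_nonneg) auto
  also have "\<dots> = (\<Sum>i\<in>{1..6}. (X i)^2) - 2 * (T / 6) * (\<Sum>i\<in>{1..6}. X i) + 6 * (T / 6)^2"
    by (simp add: power2_diff sum.distrib sum_subtractf sum_distrib_left mult_ac)
  also have "\<dots> = (\<Sum>i\<in>{1..6}. (X i)^2) - T^2 / 6"
    unfolding T_def[symmetric] by (simp add: power2_eq_square)
  finally show ?thesis unfolding T_def[symmetric] by simp
qed

text \<open>The weighted form of the bound for complete 6-partite graphs: pairs inside the classes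
  lose the sum of the squared class weights, at least a sixth of the squared total.\<close>

lemma coloured_pairs_le:
  fixes x :: "nat \<Rightarrow> real"
  assumes "finite G" "g ` G \<subseteq> {1..6::nat}" "sum x G \<le> 1" "\<And>v. 0 \<le> x v"
  shows "(\<Sum>a\<in>G. \<Sum>b\<in>G. of_bool (g a \<noteq> g b) * (x a * x b)) \<le> 5 / 6"
proof -
  define X where "X = (\<lambda>i. \<Sum>a\<in>{a \<in> G. g a = i}. x a)"
  define T where "T = sum x G"
  have push: "(\<Sum>a\<in>G. f (g a) * x a) = (\<Sum>i\<in>{1..6}. f i * X i)" for f
    unfolding X_def by (rule sum_push[OF assms(1) _ assms(2)]) simp
  have TX: "(\<Sum>i\<in>{1..6}. X i) = T" using push[of "\<lambda>_. 1"] unfolding T_def by simp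
  have inner: "(\<Sum>b\<in>G. of_bool (g a \<noteq> g b) * (x a * x b)) = (T - X (g a)) * x a" if a: "a \<in> G" for a
  proof -
    have "g a \<in> {1..6}" using a assms(2) by blast
    then have "(\<Sum>i\<in>{1..6}. of_bool (g a = i) * X i) = X (g a)"
      by (subst sum.remove[of _ "g a"]) auto
    then have "(\<Sum>i\<in>{1..6}. of_bool (g a \<noteq> i) * X i) = T - X (g a)"
      unfolding TX[symmetric] by (simp add: of_bool_not_iff left_diff_distrib sum_subtractf)
    then have "(\<Sum>b\<in>G. of_bool (g a \<noteq> g b) * x b) = T - X (g a)"
      using push[of "\<lambda>i. of_bool (g a \<noteq> i)"] by simp
    moreover have "(\<Sum>b\<in>G. of_bool (g a \<noteq> g b) * (x a * x b)) = x a * (\<Sum>b\<in>G. of_bool (g a \<noteq> g b) * x b)"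
      by (simp add: sum_distrib_left mult_ac)
    ultimately show ?thesis by simp
  qed
  have "(\<Sum>a\<in>G. \<Sum>b\<in>G. of_bool (g a \<noteq> g b) * (x a * x b)) = (\<Sum>a\<in>G. (T - X (g a)) * x a)"
    by (intro sum.cong inner) auto
  also have "\<dots> = (\<Sum>i\<in>{1..6}. (T - X i) * X i)" by (rule push[of "\<lambda>i. T - X i"])
  also have "\<dots> = T * (\<Sum>i\<in>{1..6}. X i) - (\<Sum>i\<in>{1..6}. (X i)^2)"
    by (simp add: left_diff_distrib sum_subtractf sum_distrib_left power2_eq_square)
  also have "\<dots> = T^2 - (\<Sum>i\<in>{1..6}. (X i)^2)" unfolding TX by (simp add: power2_eq_square)
  also have "\<dots> \<le> T^2 - T^2 / 6" using sum_sq_six[of X] unfolding TX by simp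
  also have "\<dots> \<le> 5 / 6"
  proof -
    have "0 \<le> T" unfolding T_def using assms(4) by (intro sum_nonneg) auto
    then have "T^2 \<le> 1^2" using assms(3) unfolding T_def by (intro power_mono) auto
    then show ?thesis by simp
  qed
  finally show ?thesis .
qed

text \<open>Vertices outside \<open>A\<close> have at most one admissible colour, and by
  \<open>edge_colours\<close> covered pairs outside \<open>A\<close> receive different ones. Pairs
  that touch \<open>A\<close> weigh at most \<open>2 * sum x A\<close>.\<close>

lemma shadow_le_of_ambiguous:
  assumes H: "hg3 H" "hfree Mfam H" and x: "x \<in> weights (fst H)" and S: "G26_copy H S \<psi>"
  defines "A \<equiv> {v \<in> fst H. \<exists>i\<in>colours H S \<psi> v. \<exists>j\<in>colours H S \<psi> v. i \<noteq> j}"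
  shows "bil (shadow H) (fst H) x x \<le> 5 / 6 + 2 * sum x A"
proof -
  let ?V = "fst H"
  have fin: "finite ?V" using H hg3_finite by blast
  note nn = weights_nonneg[OF x]
  \<comment> \<open>The default colour 1 is harmless: by \<open>edge_colours\<close> a vertex
    without admissible colour lies in no edge, hence in no shadow pair.\<close>
  define g where "g = (\<lambda>v. if colours H S \<psi> v = {} then 1 else (SOME i. i \<in> colours H S \<psi> v))"
  have g6: "g v \<in> {1..6}" for v
  proof (cases "colours H S \<psi> v = {}")
    case False
    then have "(SOME i. i \<in> colours H S \<psi> v) \<in> colours H S \<psi> v" by (rule some_in_eq[THEN iffD2])
    then show ?thesis using False unfolding g_def colours_def by simp
  qed (simp add: g_def)
  have guniq: "i = g v" if "v \<in> ?V - A" "i \<in> colours H S \<psi> v" for v i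
  proof -
    have ne: "colours H S \<psi> v \<noteq> {}" using that(2) by blast
    then have "(SOME i. i \<in> colours H S \<psi> v) \<in> colours H S \<psi> v" by (rule some_in_eq[THEN iffD2])
    then have "g v \<in> colours H S \<psi> v" using ne unfolding g_def by simp
    then show ?thesis using that unfolding A_def by blast
  qed
  have diff: "g a \<noteq> g b" if ab: "{a, b} \<in> shadow H" "a \<in> ?V - A" "b \<in> ?V - A" for a b
  proof -
    obtain e where e: "e \<in> snd H" "{a, b} \<subseteq> e" "a \<noteq> b"
      using ab(1) unfolding in_shadow_iff[OF H(1)] covered_def by blast
    have "card (e - {a, b}) = 1" using hg3_card[OF H(1) e(1)] e by (simp add: card_Diff_subset)
    then obtain w where "e - {a, b} = {w}" by (auto simp: card_1_singleton_iff)
    then have "e = {a, b, w}" using e(2) by blast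
    then obtain i j where "i \<in> colours H S \<psi> a" "j \<in> colours H S \<psi> b" "i \<noteq> j"
      using edge_colours[OF H S, of a b w] e(1) by blast
    then show ?thesis using guniq ab by metis
  qed
  have t: "of_bool ({a, b} \<in> shadow H) * (x a * x b) \<le> of_bool (a \<in> A) * (x a * x b) +
      of_bool (b \<in> A) * (x a * x b) + of_bool (a \<notin> A \<and> b \<notin> A \<and> g a \<noteq> g b) * (x a * x b)"
    if "a \<in> ?V" "b \<in> ?V" for a b
  proof -
    have "0 \<le> x a * x b" using nn by simp
    then show ?thesis using diff[of a b] that
      by (cases "a \<in> A"; cases "b \<in> A"; cases "{a, b} \<in> shadow H") auto
  qed
  have "bil (shadow H) ?V x x \<le> (\<Sum>a\<in>?V. \<Sum>b\<in>?V. of_bool (a \<in> A) * (x a * x b) +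
      of_bool (b \<in> A) * (x a * x b) + of_bool (a \<notin> A \<and> b \<notin> A \<and> g a \<noteq> g b) * (x a * x b))"
    unfolding bil_def by (intro sum_mono t)
  also have "\<dots> = (\<Sum>a\<in>?V. \<Sum>b\<in>?V. of_bool (a \<in> A) * (x a * x b)) +
      (\<Sum>a\<in>?V. \<Sum>b\<in>?V. of_bool (b \<in> A) * (x a * x b)) +
      (\<Sum>a\<in>?V. \<Sum>b\<in>?V. of_bool (a \<notin> A \<and> b \<notin> A \<and> g a \<noteq> g b) * (x a * x b))"
    by (simp add: sum.distrib)
  also have "(\<Sum>a\<in>?V. \<Sum>b\<in>?V. of_bool (b \<in> A) * (x a * x b)) =
      (\<Sum>a\<in>?V. \<Sum>b\<in>?V. of_bool (a \<in> A) * (x a * x b))"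
    by (subst sum.swap) (simp add: mult_ac)
  also have "(\<Sum>a\<in>?V. \<Sum>b\<in>?V. of_bool (a \<in> A) * (x a * x b)) = sum x A"
  proof -
    have "(\<Sum>a\<in>?V. \<Sum>b\<in>?V. of_bool (a \<in> A) * (x a * x b)) = (\<Sum>a\<in>?V. of_bool (a \<in> A) * x a * sum x ?V)"
      by (simp only: sum_distrib_left mult.assoc)
    also have "\<dots> = (\<Sum>a\<in>?V. of_bool (a \<in> A) * x a)" by (simp add: weights_sum[OF x])
    also have "\<dots> = (\<Sum>a\<in>A. of_bool (a \<in> A) * x a)"
      by (rule sum.mono_neutral_right[OF fin]) (auto simp: A_def)
    finally show ?thesis by simp
  qed
  also have "(\<Sum>a\<in>?V. \<Sum>b\<in>?V. of_bool (a \<notin> A \<and> b \<notin> A \<and> g a \<noteq> g b) * (x a * x b)) =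
     (\<Sum>a\<in>?V - A. \<Sum>b\<in>?V - A. of_bool (g a \<noteq> g b) * (x a * x b))"
  proof -
    have "(\<Sum>a\<in>?V. \<Sum>b\<in>?V. of_bool (a \<notin> A \<and> b \<notin> A \<and> g a \<noteq> g b) * (x a * x b)) =
      (\<Sum>a\<in>?V - A. \<Sum>b\<in>?V. of_bool (a \<notin> A \<and> b \<notin> A \<and> g a \<noteq> g b) * (x a * x b))"
      by (rule sum.mono_neutral_right[OF fin]) auto
    also have "\<dots> = (\<Sum>a\<in>?V - A. \<Sum>b\<in>?V - A. of_bool (a \<notin> A \<and> b \<notin> A \<and> g a \<noteq> g b) * (x a * x b))"
      by (intro sum.cong refl sum.mono_neutral_right[OF fin]) auto
    also have "\<dots> = (\<Sum>a\<in>?V - A. \<Sum>b\<in>?V - A. of_bool (g a \<noteq> g b) * (x a * x b))"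
      by (intro sum.cong refl) auto
    finally show ?thesis .
  qed
  also have "\<dots> \<le> 5 / 6"
  proof (rule coloured_pairs_le)
    show "sum x (?V - A) \<le> 1"
      using sum_mono2[OF fin, of "?V - A" x] nn weights_sum[OF x] by auto
  qed (use fin nn g6 in auto)
  finally show ?thesis by simp
qed

text \<open>The form with \<open>x\<close> in one slot is the \<open>x\<close>-average of links.
  Each is at most \<open>4/9 + 2 * \<theta>\<close>, and an ambiguous vertex falls short by a
  further \<open>4/9 - 7/18 = 1/18\<close>.\<close>

lemma ambiguous_weight_le:
  assumes H: "hg3 H" "hfree Mfam H" and x: "x \<in> weights (fst H)" and y: "y \<in> weights (fst H)"
    and S: "G26_copy H {v. 0 < y v} \<psi>" and near: "\<forall>v. 0 < y v \<longrightarrow> \<bar>y v - 1/6\<bar> \<le> 2 * \<theta>"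
    and th: "0 < \<theta>" "\<theta> \<le> 1/1000" "4 / 9 - \<theta>^2 \<le> tri (snd H) (fst H) y y y"
  defines "A \<equiv> {v \<in> fst H. \<exists>i\<in>colours H {v. 0 < y v} \<psi> v. \<exists>j\<in>colours H {v. 0 < y v} \<psi> v. i \<noteq> j}"
  shows "sum x A / 18 \<le> 4 / 9 + 2 * \<theta> - tri (snd H) (fst H) x y y"
proof -
  let ?V = "fst H"
  have fin: "finite ?V" using H hg3_finite by blast
  note nn = weights_nonneg[OF x]
  have l: "link H v y \<le> 4 / 9 + 2 * \<theta> - of_bool (v \<in> A) / 18" if v: "v \<in> ?V" for v
  proof (cases "v \<in> A")
    case True
    then obtain i j where "i \<in> colours H {v. 0 < y v} \<psi> v" "j \<in> colours H {v. 0 < y v} \<psi> v" "i \<noteq> j"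
      unfolding A_def by blast
    then have "link H v y \<le> 7 / 18" using ambiguous_link_le[OF H(1) y S _ th(2) near] th by simp
    then show ?thesis using True th by simp
  next
    case False
    then show ?thesis using link_le[OF H y v th] by simp
  qed
  have "tri (snd H) ?V x y y \<le> (\<Sum>v\<in>?V. x v * (4 / 9 + 2 * \<theta> - of_bool (v \<in> A) / 18))"
    unfolding tri_link by (intro sum_mono mult_left_mono l nn)
  also have "\<dots> = (4 / 9 + 2 * \<theta>) * sum x ?V - (\<Sum>v\<in>?V. of_bool (v \<in> A) * x v) / 18"
  proof -
    have "x v * (4 / 9 + 2 * \<theta> - of_bool (v \<in> A) / 18) =
        (4 / 9 + 2 * \<theta>) * x v - (of_bool (v \<in> A) * x v) / 18" for v
      by (simp add: algebra_simps)
    then show ?thesis by (simp only: sum_subtractf sum_distrib_left sum_divide_distrib)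
  qed
  also have "(\<Sum>v\<in>?V. of_bool (v \<in> A) * x v) = (\<Sum>v\<in>A. of_bool (v \<in> A) * x v)"
    by (rule sum.mono_neutral_right[OF fin]) (auto simp: A_def)
  also have "\<dots> = sum x A" by simp
  finally show ?thesis using weights_sum[OF x] by simp
qed


section \<open>Stability of the shadow density\<close>

text \<open>The choice \<alpha> \<open>= 4 / \<theta>^2\<close> balances two demands. A gain of at
  most 2 in \<Psi> can pay for a loss of at most \<open>\<theta>^2 / 2\<close> in the cubic form;
  conversely the cubic form can rise by at most \<open>\<theta>^3\<close>, which pays for a loss of
  at most \<open>4 * \<theta>\<close> in \<Psi>.\<close>

lemma near_extremal_symmetrization:
  assumes H: "hg3 H" and x: "x \<in> weights (fst H)" and \<Psi>: "affine_along (covered H) (fst H) \<Psi>"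
    and bd: "\<And>y. y \<in> weights (fst H) \<Longrightarrow> \<Psi> y - \<Psi> x \<le> 2"
    and mx: "\<And>y. y \<in> weights (fst H) \<Longrightarrow> tri (snd H) (fst H) y y y \<le> 4 / 9"
    and th: "0 < \<theta>" "\<theta> \<le> 1/1000" "4 / 9 - \<theta>^3 \<le> tri (snd H) (fst H) x x x"
  shows "\<exists>y\<in>weights (fst H). supp_clique H y \<and> 4 / 9 - \<theta>^2 \<le> tri (snd H) (fst H) y y y \<and>
           \<Psi> x \<le> \<Psi> y + 4 * \<theta>"
proof -
  let ?P = "\<lambda>y. tri (snd H) (fst H) y y y"
  define \<alpha> where "\<alpha> = 4 / \<theta>^2"
  have "affine_along (covered H) (fst H) (\<lambda>y. \<alpha> * ?P y + \<Psi> y)"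
    by (intro affine_along_add affine_along_cmult affine_along_tri[OF H] \<Psi>)
  from symmetrization[OF hg3_finite[OF H] this x] obtain y where
    y: "y \<in> weights (fst H)" "\<alpha> * ?P x + \<Psi> x \<le> \<alpha> * ?P y + \<Psi> y" "supp_clique H y"
    unfolding supp_clique_def by blast
  have \<alpha>: "\<alpha> > 0" unfolding \<alpha>_def using th by simp
  have e: "\<alpha> * \<theta>^2 = 4" "\<alpha> * \<theta>^3 = 4 * \<theta>"
    unfolding \<alpha>_def using th by (simp_all add: power2_eq_square power3_eq_cube)
  have "\<alpha> * (?P x - ?P y) \<le> \<alpha> * (\<theta>^2 / 2)" using y(2) bd[OF y(1)] e by (simp add: algebra_simps)
  then have "?P x - ?P y \<le> \<theta>^2 / 2" using \<alpha> by simp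
  moreover have "\<theta>^3 \<le> \<theta>^2 / 2"
  proof -
    have "\<theta>^2 * \<theta> \<le> \<theta>^2 * (1/2)" using th by (intro mult_left_mono) auto
    then show ?thesis by (simp add: power2_eq_square power3_eq_cube)
  qed
  ultimately have near: "4 / 9 - \<theta>^2 \<le> ?P y" using th by linarith
  have "?P y - ?P x \<le> \<theta>^3" using mx[OF y(1)] th(3) by linarith
  then have "\<alpha> * (?P y - ?P x) \<le> \<alpha> * \<theta>^3" using \<alpha> by (intro mult_left_mono) auto
  then have "\<Psi> x \<le> \<Psi> y + 4 * \<theta>" using y(2) unfolding e by (simp add: algebra_simps)
  then show ?thesis using y near by blast
qed

theorem Mfree_shadow_stability:
  assumes H: "hg3 H" "hfree Mfam H" and x: "x \<in> weights (fst H)"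
    and g: "0 < g" "g \<le> 1/100" "4 / 9 - g^6 \<le> tri (snd H) (fst H) x x x"
  shows "\<bar>bil (shadow H) (fst H) x x - 5/6\<bar> \<le> 100 * g \<or> \<bar>bil (shadow H) (fst H) x x - 8/9\<bar> \<le> 100 * g"
proof -
  let ?V = "fst H"
  let ?Q = "\<lambda>y. bil (shadow H) ?V y y"
  let ?P = "\<lambda>y. tri (snd H) ?V y y y"
  let ?L = "\<lambda>y. tri (snd H) ?V x y y"
  define \<theta> where "\<theta> = g^2"
  have fin: "finite ?V" using H hg3_finite by blast
  have "g * g \<le> (1/100) * (1/100)" using g by (intro mult_mono) auto
  then have th: "0 < \<theta>" "\<theta> \<le> 1/1000" unfolding \<theta>_def using g by (auto simp: power2_eq_square)
  have "\<theta>^3 = g^6" unfolding \<theta>_def by (simp add: power_mult[symmetric])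
  then have Px: "4 / 9 - \<theta>^3 \<le> ?P x" using g by simp
  have thg: "\<theta> \<le> g / 100" unfolding \<theta>_def power2_eq_square using g mult_left_mono[of g "1/100" g] by simp
  have th3: "\<theta>^3 \<le> \<theta>"
    using th power_decreasing[of 1 3 \<theta>] by simp
  have mx: "\<And>y. y \<in> weights ?V \<Longrightarrow> ?P y \<le> 4 / 9" using Mfree_tri_le[OF H] .
  have Q0: "0 \<le> ?Q y" "?Q y \<le> 1" if "y \<in> weights ?V" for y
    using bil_le_1[OF that] bil_nonneg[of y] weights_nonneg[OF that] by auto
  note Qx = Q0[OF x]
  have affQ: "affine_along (covered H) ?V ?Q" by (rule affine_along_bil[OF H(1)])
  \<comment> \<open>Symmetrising with minus the shadow form, and then with the shadow form itself,
    brackets the shadow value of \<open>x\<close> by the two values that near-extremal cliques can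
    have.\<close>
  have lower: "?Q x \<ge> 5/6 - 6 * \<theta>"
  proof -
    have "affine_along (covered H) ?V (\<lambda>y. (-1) * ?Q y)" by (rule affine_along_cmult[OF affQ])
    moreover have "(-1) * ?Q y - (-1) * ?Q x \<le> 2" if "y \<in> weights ?V" for y using Q0[OF that] Qx by simp
    ultimately obtain y where y: "y \<in> weights ?V" "supp_clique H y" "4 / 9 - \<theta>^2 \<le> ?P y"
      "(-1) * ?Q x \<le> (-1) * ?Q y + 4 * \<theta>"
      using near_extremal_symmetrization[OF H(1) x _ _ mx th Px, of "\<lambda>y. (-1) * ?Q y"] by blast
    have "?Q y \<ge> 5/6 - 2 * \<theta>"
      using Mfree_clique_near_extremal[OF H y(1,2) _ th(2) y(3)] th by (auto simp: abs_le_iff)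
    then show ?thesis using y(4) by simp
  qed
  have upper: "?Q x \<le> 8/9 + 6 * \<theta>"
  proof -
    have "?Q y - ?Q x \<le> 2" if "y \<in> weights ?V" for y using Q0[OF that] Qx by simp
    then obtain y where y: "y \<in> weights ?V" "supp_clique H y" "4 / 9 - \<theta>^2 \<le> ?P y"
      "?Q x \<le> ?Q y + 4 * \<theta>"
      using near_extremal_symmetrization[OF H(1) x affQ _ mx th Px] by blast
    have "?Q y \<le> 8/9 + 2 * \<theta>"
      using Mfree_clique_near_extremal[OF H y(1,2) _ th(2) y(3)] th by (auto simp: abs_le_iff)
    then show ?thesis using y(4) by simp
  qed
  let ?\<Psi> = "\<lambda>y. ?L y + (- g) * ?Q y"
  have "affine_along (covered H) ?V ?\<Psi>"
    by (intro affine_along_add affine_along_cmult affQ affine_along_tri2[OF H(1)])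
  moreover have "?\<Psi> y - ?\<Psi> x \<le> 2" if y: "y \<in> weights ?V" for y
  proof -
    have "?L y \<le> 1" using tri_le_1[OF x y y] .
    moreover have "0 \<le> ?L x" using tri_nonneg[of x x x] weights_nonneg[OF x] by blast
    moreover have "0 \<le> g * ?Q y" using Q0[OF y] g by simp
    moreover have "g * ?Q x \<le> 1 * 1" using Qx g by (intro mult_mono) auto
    ultimately show ?thesis by simp
  qed
  ultimately obtain y where y: "y \<in> weights ?V" "supp_clique H y" "4 / 9 - \<theta>^2 \<le> ?P y"
      "?\<Psi> x \<le> ?\<Psi> y + 4 * \<theta>"
    using near_extremal_symmetrization[OF H(1) x _ _ mx th Px, of ?\<Psi>] by blast
  \<comment> \<open>The form at \<open>(x, x, x)\<close> is at least
    \<open>4/9 - \<theta>^3\<close>; the loss \<open>5 * \<theta>\<close> collects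
    \<open>4 * \<theta>\<close> from the symmetrisation and \<open>\<theta>^3\<close>, which is at
    most \<theta>.\<close>
  have main: "4 / 9 - g * ?Q x + g * ?Q y - 5 * \<theta> \<le> ?L y" using y(4) Px th3 by simp
  from Mfree_clique_near_extremal[OF H y(1,2) _ th(2) y(3)] th(1)
  consider "\<bar>?Q y - 8/9\<bar> \<le> 2 * \<theta>" |
    \<psi> where "G26_copy H {v. 0 < y v} \<psi>" "\<forall>v. 0 < y v \<longrightarrow> \<bar>y v - 1/6\<bar> \<le> 2 * \<theta>" by auto
  then show ?thesis
  proof cases
    case 1
    \<comment> \<open>Links cap the mixed form at \<open>4/9 + 2 * \<theta>\<close>, so
      \<open>main\<close> bounds \<open>g\<close> times the gap between the shadow values of
      \<open>y\<close> and \<open>x\<close> by \<open>7 * \<theta>\<close>. Dividing by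
      \<open>g\<close> leaves \<open>7 * g\<close>.\<close>
    have "?L y = (\<Sum>v\<in>?V. x v * link H v y)" by (rule tri_link)
    also have "\<dots> \<le> (\<Sum>v\<in>?V. x v * (4 / 9 + 2 * \<theta>))"
      by (intro sum_mono mult_left_mono link_le[OF H y(1) _ th y(3)] weights_nonneg[OF x])
    also have "\<dots> = 4 / 9 + 2 * \<theta>" by (simp only: sum_distrib_right[symmetric] weights_sum[OF x] mult_1_left)
    finally have "g * ?Q y \<le> g * ?Q x + 7 * \<theta>" using main by linarith
    also have "\<dots> = g * (?Q x + 7 * g)" unfolding \<theta>_def by (simp add: power2_eq_square algebra_simps)
    finally have "?Q y \<le> ?Q x + 7 * g" using g by simp
    then have "?Q x \<ge> 8/9 - 8 * g" using 1 thg g by (simp add: abs_le_iff)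
    then have "\<bar>?Q x - 8/9\<bar> \<le> 100 * g" using upper thg g by (simp add: abs_le_iff)
    then show ?thesis ..
  next
    case 2
    define A where "A = {v \<in> ?V. \<exists>i\<in>colours H {v. 0 < y v} \<psi> v. \<exists>j\<in>colours H {v. 0 < y v} \<psi> v. i \<noteq> j}"
    have "sum x A / 18 \<le> 4 / 9 + 2 * \<theta> - ?L y"
      unfolding A_def by (rule ambiguous_weight_le[OF H x y(1) 2 th y(3)])
    moreover have "g * ?Q x \<le> g * 1" using Qx g by (intro mult_left_mono) auto
    moreover have "0 \<le> g * ?Q y" using Q0[OF y(1)] g by simp
    \<comment> \<open>The ambiguous weight is thus at most \<open>36 * g\<close>, and the shadow
      value of \<open>x\<close> at most \<open>5/6 + 72 * g\<close>.\<close>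
    ultimately have "sum x A / 18 \<le> 2 * g" using main thg g by linarith
    moreover have "?Q x \<le> 5 / 6 + 2 * sum x A"
      unfolding A_def by (rule shadow_le_of_ambiguous[OF H x 2(1)])
    ultimately have "\<bar>?Q x - 5/6\<bar> \<le> 100 * g" using lower thg g by (simp add: abs_le_iff)
    then show ?thesis ..
  qed
qed

section \<open>Densities\<close>

lemma card_orderings3:
  assumes "card e = 3"
  shows "card {(a, b, c). {a, b, c} = e} = 6"
proof -
  have fin: "finite e" using assms by (intro card_ge_0_finite) simp
  have "{(a, b, c). {a, b, c} = e} = (SIGMA a:e. SIGMA b:e - {a}. e - {a, b})"
  proof (rule set_eqI, clarify)
    fix a b c
    show "(a, b, c) \<in> {(a, b, c). {a, b, c} = e} \<longleftrightarrow> (a, b, c) \<in> (SIGMA a:e. SIGMA b:e - {a}. e - {a, b})"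
    proof
      assume "(a, b, c) \<in> {(a, b, c). {a, b, c} = e}"
      then have e: "{a, b, c} = e" by simp
      then have "a \<noteq> b" "a \<noteq> c" "b \<noteq> c" using assms card3_distinct[of a b c] by auto
      then show "(a, b, c) \<in> (SIGMA a:e. SIGMA b:e - {a}. e - {a, b})" using e by auto
    next
      assume "(a, b, c) \<in> (SIGMA a:e. SIGMA b:e - {a}. e - {a, b})"
      then have m: "{a, b, c} \<subseteq> e" and "a \<noteq> b" "a \<noteq> c" "b \<noteq> c" by auto
      then have "card {a, b, c} = card e" using assms by (simp add: card3_distinct)
      then have "{a, b, c} = e" using card_subset_eq[OF fin m] by blast
      then show "(a, b, c) \<in> {(a, b, c). {a, b, c} = e}" by simp
    qed
  qed
  also have "card \<dots> = (\<Sum>a\<in>e. \<Sum>b\<in>e - {a}. card (e - {a, b}))"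
    using fin by (simp add: card_SigmaI)
  also have "\<dots> = (\<Sum>a\<in>e. \<Sum>b\<in>e - {a}. 1)"
    using assms by (intro sum.cong refl) (auto simp: card_Diff_subset card_insert_if)
  also have "\<dots> = 6" using assms fin by simp
  finally show ?thesis .
qed

lemma card_orderings2:
  assumes "card e = 2"
  shows "card {(a, b). {a, b} = e} = 2"
proof -
  obtain p q where pq: "e = {p, q}" "p \<noteq> q" using assms by (auto simp: card_2_iff)
  have "{(a, b). {a, b} = e} = {(p, q), (q, p)}" unfolding pq using pq(2) by (auto simp: doubleton_eq_iff)
  then show ?thesis using pq by simp
qed

lemma card_ordered_triples:
  assumes "finite E" "\<forall>e\<in>E. card e = 3"
  shows "card {(a, b, c). {a, b, c} \<in> E} = 6 * card E"
proof -
  have "{(a, b, c). {a, b, c} \<in> E} = (\<Union>e\<in>E. {(a, b, c). {a, b, c} = e})" by auto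
  also have "card \<dots> = (\<Sum>e\<in>E. card {(a, b, c). {a, b, c} = e})"
  proof (rule card_UN_disjoint[OF assms(1)])
    show "\<forall>e\<in>E. finite {(a, b, c). {a, b, c} = e}"
      using card_orderings3 assms(2) by (metis card_ge_0_finite zero_less_numeral)
  qed auto
  also have "\<dots> = (\<Sum>e\<in>E. 6)" using card_orderings3 assms(2) by (intro sum.cong) auto
  finally show ?thesis by simp
qed

lemma card_ordered_pairs:
  assumes "finite D" "\<forall>e\<in>D. card e = 2"
  shows "card {(a, b). {a, b} \<in> D} = 2 * card D"
proof -
  have "{(a, b). {a, b} \<in> D} = (\<Union>e\<in>D. {(a, b). {a, b} = e})" by auto
  also have "card \<dots> = (\<Sum>e\<in>D. card {(a, b). {a, b} = e})"
  proof (rule card_UN_disjoint[OF assms(1)])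
    show "\<forall>e\<in>D. finite {(a, b). {a, b} = e}"
      using card_orderings2 assms(2) by (metis card_ge_0_finite zero_less_numeral)
  qed auto
  also have "\<dots> = (\<Sum>e\<in>D. 2)" using card_orderings2 assms(2) by (intro sum.cong) auto
  finally show ?thesis by simp
qed

lemma tri_count:
  assumes "finite V" "\<forall>e\<in>E. e \<subseteq> V \<and> card e = 3"
  shows "(\<Sum>a\<in>V. \<Sum>b\<in>V. \<Sum>c\<in>V. of_bool ({a, b, c} \<in> E)) = 6 * real (card E)"
proof -
  have finE: "finite E" by (rule finite_subset[of _ "Pow V"]) (use assms in auto)
  have "(\<Sum>a\<in>V. \<Sum>b\<in>V. \<Sum>c\<in>V. of_bool ({a, b, c} \<in> E)) =
      (\<Sum>t\<in>V \<times> V \<times> V. of_bool (t \<in> {(a, b, c). {a, b, c} \<in> E}) :: real)"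
    by (simp add: sum.cartesian_product case_prod_unfold)
  also have "\<dots> = real (card ({(a, b, c). {a, b, c} \<in> E} \<inter> (V \<times> V \<times> V)))"
    using assms(1) by (simp add: of_bool_def sum.If_cases Int_commute)
  also have "{(a, b, c). {a, b, c} \<in> E} \<inter> (V \<times> V \<times> V) = {(a, b, c). {a, b, c} \<in> E}"
    using assms(2) by auto
  finally show ?thesis using card_ordered_triples[OF finE] assms(2) by simp
qed

lemma bil_count:
  assumes "finite V" "\<forall>e\<in>D. e \<subseteq> V \<and> card e = 2"
  shows "(\<Sum>a\<in>V. \<Sum>b\<in>V. of_bool ({a, b} \<in> D)) = 2 * real (card D)"
proof -
  have finE: "finite D" by (rule finite_subset[of _ "Pow V"]) (use assms in auto)
  have "(\<Sum>a\<in>V. \<Sum>b\<in>V. of_bool ({a, b} \<in> D)) =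
      (\<Sum>t\<in>V \<times> V. of_bool (t \<in> {(a, b). {a, b} \<in> D}) :: real)"
    by (simp add: sum.cartesian_product case_prod_unfold)
  also have "\<dots> = real (card ({(a, b). {a, b} \<in> D} \<inter> (V \<times> V)))"
    using assms(1) by (simp add: of_bool_def sum.If_cases Int_commute)
  also have "{(a, b). {a, b} \<in> D} \<inter> (V \<times> V) = {(a, b). {a, b} \<in> D}"
    using assms(2) by auto
  finally show ?thesis using card_ordered_pairs[OF finE] assms(2) by simp
qed

definition uniform :: "nat set \<Rightarrow> nat \<Rightarrow> real" where
  "uniform V = (\<lambda>v. if v \<in> V then 1 / real (card V) else 0)"

lemma uniform_weights: "finite V \<Longrightarrow> V \<noteq> {} \<Longrightarrow> uniform V \<in> weights V"
  unfolding uniform_def weights_def by simp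

lemma real_choose_2: "real (n choose 2) = real n * (real n - 1) / 2"
  by (induction n) (simp_all add: numeral_2_eq_2 field_simps)

lemma real_choose_3: "real (n choose 3) = real n * (real n - 1) * (real n - 2) / 6"
proof (induction n)
  case (Suc n)
  have "real (Suc n choose 3) = real (n choose 2) + real (n choose 3)"
    by (simp add: numeral_3_eq_3 numeral_2_eq_2)
  then show ?case unfolding Suc.IH real_choose_2 by (simp add: field_simps)
qed simp

text \<open>The correction factor is the probability that three independent uniform vertices are
  distinct; it tends to 1.\<close>

lemma tri_uniform:
  assumes H: "hg3 H" and n: "card (fst H) \<ge> 3"
  defines "N \<equiv> real (card (fst H))"
  shows "tri (snd H) (fst H) (uniform (fst H)) (uniform (fst H)) (uniform (fst H)) =
         edge_density H * ((1 - 1 / N) * (1 - 2 / N))"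
proof -
  let ?u = "uniform (fst H)"
  have fin: "finite (fst H)" using H hg3_finite by blast
  have N: "N \<ge> 3" using n unfolding N_def by simp
  have "tri (snd H) (fst H) ?u ?u ?u =
      (\<Sum>a\<in>fst H. \<Sum>b\<in>fst H. \<Sum>c\<in>fst H. of_bool ({a, b, c} \<in> snd H) * (1 / N^3))"
    unfolding tri_def by (intro sum.cong refl) (simp add: uniform_def N_def power3_eq_cube)
  also have "\<dots> = 6 * real (card (snd H)) * (1 / N^3)"
    unfolding sum_distrib_right[symmetric]
    by (subst tri_count[OF fin]) (use H in \<open>simp_all add: hg3_def\<close>)
  also have "\<dots> = edge_density H * ((1 - 1 / N) * (1 - 2 / N))"
  proof -
    have e: "1 - 1 / N = (N - 1) / N" "1 - 2 / N = (N - 2) / N" using N by (simp_all add: diff_divide_distrib)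
    have ne: "N \<noteq> 0" "N - 1 \<noteq> 0" "N - 2 \<noteq> 0" using N by auto
    have frac: "6 * c * (1 / N^3) = c / (N * p * q / 6) * ((p / N) * (q / N))"
      if "N \<noteq> 0" "p \<noteq> 0" "q \<noteq> 0" for c p q :: real
      using that by (simp add: field_simps power3_eq_cube)
    show ?thesis
      unfolding edge_density_def real_choose_3 N_def[symmetric] e by (rule frac[OF ne])
  qed
  finally show ?thesis .
qed

lemma bil_uniform:
  assumes H: "hg3 H" and n: "card (fst H) \<ge> 3"
  defines "N \<equiv> real (card (fst H))"
  shows "bil (shadow H) (fst H) (uniform (fst H)) (uniform (fst H)) = shadow_density H * (1 - 1 / N)"
proof -
  let ?u = "uniform (fst H)"
  have fin: "finite (fst H)" using H hg3_finite by blast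
  have N: "N \<ge> 3" using n unfolding N_def by simp
  have "bil (shadow H) (fst H) ?u ?u =
      (\<Sum>a\<in>fst H. \<Sum>b\<in>fst H. of_bool ({a, b} \<in> shadow H) * (1 / N^2))"
    unfolding bil_def by (intro sum.cong refl) (simp add: uniform_def N_def power2_eq_square)
  also have "\<dots> = 2 * real (card (shadow H)) * (1 / N^2)"
    unfolding sum_distrib_right[symmetric]
    by (subst bil_count[OF fin]) (simp_all add: shadow_def)
  also have "\<dots> = shadow_density H * (1 - 1 / N)"
  proof -
    have e: "1 - 1 / N = (N - 1) / N" using N by (simp add: diff_divide_distrib)
    have ne: "N \<noteq> 0" "N - 1 \<noteq> 0" using N by auto
    have frac: "2 * c * (1 / N^2) = c / (N * p / 2) * (p / N)" if "N \<noteq> 0" "p \<noteq> 0" for c p :: real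
      using that by (simp add: field_simps power2_eq_square)
    show ?thesis
      unfolding shadow_density_def real_choose_2 N_def[symmetric] e by (rule frac[OF ne])
  qed
  finally show ?thesis .
qed

lemma feasible_limits:
  assumes "(x, y) \<in> feasible_region Mfam"
  obtains Hs :: "nat \<Rightarrow> hg" where "\<forall>k. hg3 (Hs k) \<and> hfree Mfam (Hs k)"
    "\<forall>\<^sub>F k in sequentially. uniform (fst (Hs k)) \<in> weights (fst (Hs k))"
    "(\<lambda>k. tri (snd (Hs k)) (fst (Hs k)) (uniform (fst (Hs k))) (uniform (fst (Hs k))) (uniform (fst (Hs k)))) \<longlonglongrightarrow> y"
    "(\<lambda>k. bil (shadow (Hs k)) (fst (Hs k)) (uniform (fst (Hs k))) (uniform (fst (Hs k)))) \<longlonglongrightarrow> x"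
proof -
  obtain Hs :: "nat \<Rightarrow> hg" where Hs: "\<forall>k. hg3 (Hs k) \<and> hfree Mfam (Hs k)"
    "filterlim (\<lambda>k. card (fst (Hs k))) at_top sequentially"
    "(\<lambda>k. shadow_density (Hs k)) \<longlonglongrightarrow> x" "(\<lambda>k. edge_density (Hs k)) \<longlonglongrightarrow> y"
    using assms unfolding feasible_region_def by blast
  define N where "N = (\<lambda>k. real (card (fst (Hs k))))"
  have "filterlim N at_top sequentially"
    unfolding N_def by (rule filterlim_compose[OF filterlim_real_sequentially Hs(2)])
  then have inv: "(\<lambda>k. c / N k) \<longlonglongrightarrow> 0" for c
    by (intro tendsto_divide_0[OF tendsto_const] filterlim_at_top_imp_at_infinity)
  have ev: "\<forall>\<^sub>F k in sequentially. card (fst (Hs k)) \<ge> 3"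
    using Hs(2) unfolding filterlim_at_top by blast
  have "\<forall>\<^sub>F k in sequentially. uniform (fst (Hs k)) \<in> weights (fst (Hs k))"
    using ev by eventually_elim (rule uniform_weights, use Hs(1) hg3_finite in auto)
  moreover have "(\<lambda>k. tri (snd (Hs k)) (fst (Hs k)) (uniform (fst (Hs k))) (uniform (fst (Hs k))) (uniform (fst (Hs k)))) \<longlonglongrightarrow> y"
  proof -
    have "(\<lambda>k. edge_density (Hs k) * ((1 - 1 / N k) * (1 - 2 / N k))) \<longlonglongrightarrow> y * ((1 - 0) * (1 - 0))"
      by (intro tendsto_intros Hs(4) inv)
    then have "(\<lambda>k. edge_density (Hs k) * ((1 - 1 / N k) * (1 - 2 / N k))) \<longlonglongrightarrow> y" by simp
    then show ?thesis
    proof (rule Lim_transform_eventually)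
      show "\<forall>\<^sub>F k in sequentially. edge_density (Hs k) * ((1 - 1 / N k) * (1 - 2 / N k)) =
         tri (snd (Hs k)) (fst (Hs k)) (uniform (fst (Hs k))) (uniform (fst (Hs k))) (uniform (fst (Hs k)))"
        using ev by eventually_elim (simp only: tri_uniform Hs(1) N_def)
    qed
  qed
  moreover have "(\<lambda>k. bil (shadow (Hs k)) (fst (Hs k)) (uniform (fst (Hs k))) (uniform (fst (Hs k)))) \<longlonglongrightarrow> x"
  proof -
    have "(\<lambda>k. shadow_density (Hs k) * (1 - 1 / N k)) \<longlonglongrightarrow> x * (1 - 0)"
      by (intro tendsto_intros Hs(3) inv)
    then have "(\<lambda>k. shadow_density (Hs k) * (1 - 1 / N k)) \<longlonglongrightarrow> x" by simp
    then show ?thesis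
    proof (rule Lim_transform_eventually)
      show "\<forall>\<^sub>F k in sequentially. shadow_density (Hs k) * (1 - 1 / N k) =
         bil (shadow (Hs k)) (fst (Hs k)) (uniform (fst (Hs k))) (uniform (fst (Hs k)))"
        using ev by eventually_elim (simp only: bil_uniform Hs(1) N_def)
    qed
  qed
  ultimately show ?thesis using that Hs(1) by blast
qed

lemma feasible_le:
  assumes "(x, y) \<in> feasible_region Mfam"
  shows "y \<le> 4 / 9"
proof -
  obtain Hs :: "nat \<Rightarrow> hg" where Hs: "\<forall>k. hg3 (Hs k) \<and> hfree Mfam (Hs k)"
    "\<forall>\<^sub>F k in sequentially. uniform (fst (Hs k)) \<in> weights (fst (Hs k))"
    "(\<lambda>k. tri (snd (Hs k)) (fst (Hs k)) (uniform (fst (Hs k))) (uniform (fst (Hs k))) (uniform (fst (Hs k)))) \<longlonglongrightarrow> y"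
    by (rule feasible_limits[OF assms])
  show ?thesis
  proof (rule tendsto_upperbound[OF Hs(3)])
    show "\<forall>\<^sub>F k in sequentially. tri (snd (Hs k)) (fst (Hs k)) (uniform (fst (Hs k))) (uniform (fst (Hs k)))
        (uniform (fst (Hs k))) \<le> 4 / 9"
      using Hs(2) by eventually_elim (use Mfree_tri_le Hs(1) in blast)
  qed simp
qed

lemma feasible_extremal:
  assumes "(x, 4 / 9) \<in> feasible_region Mfam"
  shows "x \<in> {5/6, 8/9}"
proof (rule ccontr)
  assume "x \<notin> {5/6, 8/9}"
  then have x: "x \<noteq> 5/6" "x \<noteq> 8/9" by auto
  obtain Hs :: "nat \<Rightarrow> hg" where Hs: "\<forall>k. hg3 (Hs k) \<and> hfree Mfam (Hs k)"
    "\<forall>\<^sub>F k in sequentially. uniform (fst (Hs k)) \<in> weights (fst (Hs k))"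
    "(\<lambda>k. tri (snd (Hs k)) (fst (Hs k)) (uniform (fst (Hs k))) (uniform (fst (Hs k))) (uniform (fst (Hs k)))) \<longlonglongrightarrow> 4 / 9"
    "(\<lambda>k. bil (shadow (Hs k)) (fst (Hs k)) (uniform (fst (Hs k))) (uniform (fst (Hs k)))) \<longlonglongrightarrow> x"
    by (rule feasible_limits[OF assms])
  \<comment> \<open>Stability puts the shadow value within \<open>100 * g\<close> of
    \<open>5/6\<close> or \<open>8/9\<close>, and the limit is within \<open>g\<close> of it; a
    distance of \<open>400 * g\<close> from both points contradicts this.\<close>
  define g where "g = min (1/100) (min \<bar>x - 5/6\<bar> \<bar>x - 8/9\<bar> / 400)"
  have g: "0 < g" "g \<le> 1/100" "400 * g \<le> \<bar>x - 5/6\<bar>" "400 * g \<le> \<bar>x - 8/9\<bar>"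
    unfolding g_def using x by (auto simp: min_def)
  have "\<forall>\<^sub>F k in sequentially. 4 / 9 - g^6 < tri (snd (Hs k)) (fst (Hs k)) (uniform (fst (Hs k)))
      (uniform (fst (Hs k))) (uniform (fst (Hs k)))"
    by (rule order_tendstoD(1)[OF Hs(3)]) (use g in simp)
  moreover have "\<forall>\<^sub>F k in sequentially. dist (bil (shadow (Hs k)) (fst (Hs k)) (uniform (fst (Hs k)))
      (uniform (fst (Hs k)))) x < g"
    by (rule tendstoD[OF Hs(4) g(1)])
  ultimately have "\<forall>\<^sub>F k in sequentially. False"
    using Hs(2)
  proof eventually_elim
    case (elim k)
    then have "\<bar>bil (shadow (Hs k)) (fst (Hs k)) (uniform (fst (Hs k))) (uniform (fst (Hs k))) - 5/6\<bar> \<le> 100 * g \<or>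
      \<bar>bil (shadow (Hs k)) (fst (Hs k)) (uniform (fst (Hs k))) (uniform (fst (Hs k))) - 8/9\<bar> \<le> 100 * g"
      using Mfree_shadow_stability[of "Hs k" "uniform (fst (Hs k))" g] Hs(1) g by simp
    then show False using elim(2) g unfolding dist_real_def by linarith
  qed
  then show False by simp
qed


section \<open>Constructions\<close>

lemma hg3_semibip: "hg3 (semibip t n)"
  unfolding hg3_def semibip_def by (auto simp: card_insert_if)

lemma hg3_K5minus: "hg3 K5minus"
  unfolding hg3_def K5minus_def by auto

lemma K5minus_edge:
  assumes "a \<noteq> b" "a \<noteq> c" "b \<noteq> c" "a < 5" "b < 5" "c < 5" "3 \<le> c"
  shows "{a, b, c} \<in> snd K5minus"
proof -
  have "c \<notin> {0, 1, 2}" using assms by simp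
  then have "{a, b, c} \<noteq> {0, 1, 2}" by blast
  moreover have "card {a, b, c} = 3" using assms by (simp add: card3_distinct)
  ultimately show ?thesis unfolding K5minus_def using assms by simp
qed

lemma K5minus_core: "is_core K5minus {0..<5} 5"
  unfolding is_core_def
proof (intro conjI ballI impI)
  fix u v :: nat assume uv: "u \<in> {0..<5}" "v \<in> {0..<5}" "u \<noteq> v"
  \<comment> \<open>The third vertex ensures that the triple contains 3 or 4 and so is not the
    removed triple; 0 is needed only for the pair \<open>{3, 4}\<close>.\<close>
  define w :: nat where "w = (if 3 \<notin> {u, v} then 3 else if 4 \<notin> {u, v} then 4 else 0)"
  have w: "w \<noteq> u" "w \<noteq> v" "w < 5" "3 \<in> {u, v, w} \<or> 4 \<in> {u, v, w}"
    unfolding w_def using uv by auto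
  have "card {u, v, w} = 3" using w uv by (simp add: card3_distinct)
  moreover have "{u, v, w} \<noteq> {0, 1, 2}"
  proof
    assume eq: "{u, v, w} = {0, 1, 2}"
    show False using w(4) unfolding eq by simp
  qed
  moreover have "{u, v, w} \<subseteq> {0..<5}" using w(3) uv by simp
  ultimately have "{u, v, w} \<in> snd K5minus" unfolding K5minus_def by simp
  then show "\<exists>e\<in>snd K5minus. {u, v} \<subseteq> e" by (rule bexI[rotated]) simp
qed (auto simp: K5minus_def)

lemma Mfam_hg3: "F \<in> Mfam \<Longrightarrow> hg3 F"
  unfolding Mfam_def M2_def M3_def Kfam_def using hg3_K5minus by blast

text \<open>Each side has at most \<open>n\<close> vertices, while \<open>G1 (3 * Suc n)\<close> has
  sides of sizes \<open>Suc n\<close> and \<open>2 * Suc n\<close>. This lets \<open>M3\<close>,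
  which mentions only the balanced \<open>G1\<close>, exclude subgraphs of unbalanced ones as
  well.\<close>

lemma semibip_contained_G1: "contained (semibip t n) (G1 (3 * Suc n))"
proof -
  define f where "f = (\<lambda>v. if v < t then v else Suc n + v)"
  have "inj_on f {0..<n}" unfolding f_def inj_on_def by auto
  moreover have "f ` {0..<n} \<subseteq> {0..<3 * Suc n}" unfolding f_def by auto
  moreover have "f ` e \<in> snd (semibip (Suc n) (3 * Suc n))" if e: "e \<in> snd (semibip t n)" for e
  proof -
    obtain a b b' where ab: "a < t" "t \<le> b" "b < n" "t \<le> b'" "b' < n" "b \<noteq> b'" "e = {a, b, b'}"
      using e unfolding semibip_def by auto
    have "f ` e = {a, Suc n + b, Suc n + b'}" using ab unfolding f_def by auto
    moreover have "a < Suc n" "Suc n \<le> Suc n + b" "Suc n + b < 3 * Suc n"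
      "Suc n \<le> Suc n + b'" "Suc n + b' < 3 * Suc n" "Suc n + b \<noteq> Suc n + b'" using ab by auto
    ultimately show ?thesis unfolding semibip_def snd_conv mem_Collect_eq by blast
  qed
  moreover have "G1 (3 * Suc n) = semibip (Suc n) (3 * Suc n)" unfolding G1_semibip by (simp del: mult_Suc_right)
  moreover have "fst (semibip t n) = {0..<n}" "fst (semibip (Suc n) (3 * Suc n)) = {0..<3 * Suc n}"
    unfolding semibip_def by simp_all
  ultimately show ?thesis unfolding contained_def by (intro exI[of _ f]) simp
qed

text \<open>The marking pulls back to the forbidden 3-graph, so the edges inside any of its cores
  have a common vertex or do not exist. This excludes \<open>K5minus\<close>, whose vertex set is a
  core, and \<open>M2\<close>; members of \<open>M3\<close> are not contained in any
  \<open>G1\<close>.\<close>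

lemma semibip_free: "hfree Mfam (semibip t n)"
  unfolding hfree_def
proof (intro notI, elim bexE)
  fix F assume F: "F \<in> Mfam" "contained F (semibip t n)"
  note h = Mfam_hg3[OF F(1)]
  obtain \<beta> where \<beta>: "one_marked \<beta> F" using one_marked_contained[OF F(2) one_marked_semibip h] by blast
  consider "F = K5minus" | "F \<in> M2" | "F \<in> M3" using F(1) unfolding Mfam_def by blast
  then show False
  proof cases
    case 1
    have in5: "e \<subseteq> {0..<5}" if "e \<in> snd F" for e using that unfolding 1 K5minus_def by simp
    \<comment> \<open>Four edges of \<open>K5minus\<close> without a common vertex.\<close>
    have ed: "{0, 1, 3} \<in> snd F" "{0, 1, 4} \<in> snd F" "{0, 3, 4} \<in> snd F" "{1, 3, 4} \<in> snd F"
      unfolding 1 by (rule K5minus_edge; simp)+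
    have "(\<exists>c\<in>{0..<5}. \<forall>e\<in>snd F. e \<subseteq> {0..<5} \<longrightarrow> c \<in> e) \<or> (\<forall>e\<in>snd F. \<not> e \<subseteq> {0..<5})"
      using one_marked_core[OF \<beta>] K5minus_core 1 by blast
    then obtain c where c: "\<forall>e\<in>snd F. c \<in> e" using in5 ed(1) by metis
    show False using bspec[OF c ed(1)] bspec[OF c ed(2)] bspec[OF c ed(3)] bspec[OF c ed(4)] by auto
  next
    case 2
    then obtain S where S: "is_core F S 7" "2 \<le> tau S {e \<in> snd F. e \<subseteq> S}" unfolding M2_def by blast
    have "(\<exists>c\<in>S. \<forall>e\<in>{e \<in> snd F. e \<subseteq> S}. c \<in> e) \<or> {e \<in> snd F. e \<subseteq> S} = {}"
      using one_marked_core[OF \<beta> S(1)] by (simp add: Ball_def imp_conjL)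
    from tau_le_1[OF this] show False using S(2) by simp
  next
    case 3
    have "contained F (G1 (3 * Suc n))" by (rule contained_trans[OF F(2) semibip_contained_G1 h])
    moreover have "3 * Suc n \<ge> 1" by simp
    ultimately show False using 3 unfolding M3_def by blast
  qed
qed

lemma card_semibip_edges:
  shows "card (snd (semibip t n)) = t * ((n - t) choose 2)"
proof -
  let ?P = "{P. P \<subseteq> {t..<n} \<and> card P = 2}"
  let ?f = "\<lambda>(a, P). insert a P"
  have "snd (semibip t n) = ?f ` ({..<t} \<times> ?P)"
  proof (rule set_eqI)
    fix e
    show "e \<in> snd (semibip t n) \<longleftrightarrow> e \<in> ?f ` ({..<t} \<times> ?P)"
    proof
      assume "e \<in> snd (semibip t n)"
      then obtain a b b' where ab: "a < t" "t \<le> b" "b < n" "t \<le> b'" "b' < n" "b \<noteq> b'" "e = {a, b, b'}"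
        unfolding semibip_def by auto
      then have "(a, {b, b'}) \<in> {..<t} \<times> ?P" by simp
      then show "e \<in> ?f ` ({..<t} \<times> ?P)" using ab(7) by (metis (no_types, lifting) case_prod_conv image_eqI)
    next
      assume "e \<in> ?f ` ({..<t} \<times> ?P)"
      then obtain a P where aP: "a < t" "P \<subseteq> {t..<n}" "card P = 2" "e = insert a P" by auto
      then obtain b b' where "P = {b, b'}" "b \<noteq> b'" by (auto simp: card_2_iff)
      then show "e \<in> snd (semibip t n)" using aP unfolding semibip_def by auto
    qed
  qed
  moreover have "inj_on ?f ({..<t} \<times> ?P)"
  proof (rule inj_onI)
    fix x y assume xy: "x \<in> {..<t} \<times> ?P" "y \<in> {..<t} \<times> ?P" "?f x = ?f y"
    obtain a P b Q where e: "x = (a, P)" "y = (b, Q)" by (cases x, cases y)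
    have h: "a < t" "b < t" "P \<subseteq> {t..<n}" "Q \<subseteq> {t..<n}" "insert a P = insert b Q"
      using xy unfolding e by auto
    have "a \<notin> Q" "b \<notin> P" "a \<notin> P" "b \<notin> Q" using h by auto
    then have "a = b" using h(5) by blast
    moreover have "P = Q" using h(5) \<open>a \<notin> P\<close> \<open>b \<notin> Q\<close> \<open>a = b\<close> by (simp add: insert_ident)
    ultimately show "x = y" unfolding e by blast
  qed
  ultimately have "card (snd (semibip t n)) = card ({..<t} \<times> ?P)" by (simp add: card_image)
  also have "\<dots> = t * card ?P" by (simp add: card_cartesian_product)
  also have "card ?P = (n - t) choose 2" using n_subsets[of "{t..<n}" 2] by simp
  finally show ?thesis .
qed

text \<open>Only pairs inside the first side are uncovered. A pair in the second side needs a
  first-side vertex, and a mixed pair needs another second-side vertex; the size assumptions provide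
  both.\<close>

lemma card_semibip_shadow:
  assumes "1 \<le> t" "t + 2 \<le> n"
  shows "real (card (shadow (semibip t n))) = real (n choose 2) - real (t choose 2)"
proof -
  let ?A = "{A. A \<subseteq> {0..<n} \<and> card A = 2}" and ?B = "{A. A \<subseteq> {0..<t} \<and> card A = 2}"
  have BA: "?B \<subseteq> ?A"
  proof
    fix A assume "A \<in> ?B"
    moreover have "{0..<t} \<subseteq> {0..<n}" using assms by auto
    ultimately show "A \<in> ?A" by blast
  qed
  have edge: "{a, b, c} \<in> snd (semibip t n)" if "a < t" "t \<le> b" "b < n" "t \<le> c" "c < n" "b \<noteq> c" for a b c
    using that unfolding semibip_def by auto
  have cov: "covered (semibip t n) u v \<longleftrightarrow> \<not> (u < t \<and> v < t)" if uv: "u < n" "v < n" "u \<noteq> v" for u v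
  proof
    assume "covered (semibip t n) u v"
    then obtain a b b' where "a < t" "t \<le> b" "t \<le> b'" "{u, v} \<subseteq> {a, b, b'}"
      unfolding covered_def semibip_def by auto
    then show "\<not> (u < t \<and> v < t)" using uv by auto
  next
    assume "\<not> (u < t \<and> v < t)"
    then consider "t \<le> u" "t \<le> v" | "u < t" "t \<le> v" | "t \<le> u" "v < t" by linarith
    then show "covered (semibip t n) u v"
    proof cases
      case 1
      then have "{0, u, v} \<in> snd (semibip t n)" using edge[of 0 u v] uv assms by auto
      then show ?thesis unfolding covered_def by (rule bexI[rotated]) simp
    next
      case 2
      define w where "w = (if v = t then t + 1 else t)"
      have "{u, v, w} \<in> snd (semibip t n)" by (rule edge) (use 2 uv assms in \<open>auto simp: w_def\<close>)
      then show ?thesis unfolding covered_def by (rule bexI[rotated]) simp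
    next
      case 3
      define w where "w = (if u = t then t + 1 else t)"
      have "{v, u, w} \<in> snd (semibip t n)" by (rule edge) (use 3 uv assms in \<open>auto simp: w_def\<close>)
      then show ?thesis unfolding covered_def by (rule bexI[rotated]) simp
    qed
  qed
  have "shadow (semibip t n) = ?A - ?B"
  proof (rule set_eqI)
    fix A
    show "A \<in> shadow (semibip t n) \<longleftrightarrow> A \<in> ?A - ?B"
    proof (cases "A \<subseteq> {0..<n} \<and> card A = 2")
      case True
      then obtain u v where uv: "A = {u, v}" "u \<noteq> v" by (auto simp: card_2_iff)
      then have "u < n" "v < n" using True by auto
      then show ?thesis using cov[of u v] uv True in_shadow_iff[OF hg3_semibip, of u v t n] by auto
    next
      case False
      then show ?thesis unfolding shadow_def semibip_def by auto
    qed
  qed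
  moreover have "card (?A - ?B) = card ?A - card ?B" using BA by (intro card_Diff_subset) auto
  moreover have "card ?B \<le> card ?A" using BA by (intro card_mono) auto
  ultimately have "real (card (shadow (semibip t n))) = real (card ?A) - real (card ?B)" by simp
  then show ?thesis using n_subsets[of "{0..<n}" 2] n_subsets[of "{0..<t}" 2] by simp
qed

lemma inverse_real_tendsto_0: "(\<lambda>k. c / real k) \<longlonglongrightarrow> 0"
  by (intro tendsto_divide_0[OF tendsto_const] filterlim_at_top_imp_at_infinity filterlim_real_sequentially)

text \<open>The parameter \<open>s\<close> is the limiting proportion of the first side. Taking
  \<open>s = sqrt (1 - x)\<close> reaches every shadow density \<open>x\<close> in
  \<open>(0, 1]\<close>, and \<open>s = 1/3\<close> gives the extremal point
  \<open>(8/9, 4/9)\<close>.\<close>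

lemma semibip_feasible:
  assumes s: "0 \<le> s" "s < 1"
  shows "(1 - s^2, 3 * s * (1 - s)^2) \<in> feasible_region Mfam"
proof -
  \<comment> \<open>The successor keeps the first side nonempty even for \<open>s = 0\<close>, as
    the shadow count requires, and does not change the limit.\<close>
  define t where "t = (\<lambda>k::nat. Suc (nat \<lfloor>s * real k\<rfloor>))"
  have tb: "s * real k \<le> real (t k)" "real (t k) \<le> s * real k + 1" for k
  proof -
    have "0 \<le> s * real k" using s by simp
    then have "real (t k) = of_int \<lfloor>s * real k\<rfloor> + 1" unfolding t_def by simp
    then show "s * real k \<le> real (t k)" "real (t k) \<le> s * real k + 1" by linarith+
  qed
  have lim: "(\<lambda>k. real (t k) / real k) \<longlonglongrightarrow> s"
  proof (rule tendsto_sandwich)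
    show "\<forall>\<^sub>F k in sequentially. s \<le> real (t k) / real k"
      using eventually_gt_at_top[of 0] by eventually_elim (use tb in \<open>simp add: field_simps\<close>)
    show "\<forall>\<^sub>F k in sequentially. real (t k) / real k \<le> s + 1 / real k"
      using eventually_gt_at_top[of 0] by eventually_elim (use tb in \<open>simp add: field_simps\<close>)
    show "(\<lambda>k. s + 1 / real k) \<longlonglongrightarrow> s"
      using tendsto_add[OF tendsto_const[of s] inverse_real_tendsto_0[of 1]] by simp
  qed simp
  have "(\<lambda>k. real (t k) / real k + 2 / real k) \<longlonglongrightarrow> s + 0"
    by (intro tendsto_add lim inverse_real_tendsto_0)
  then have "\<forall>\<^sub>F k in sequentially. real (t k) / real k + 2 / real k < 1"
    using s by (intro order_tendstoD(2)) auto
  then have ev: "\<forall>\<^sub>F k in sequentially. t k + 2 \<le> k \<and> 3 \<le> k"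
    using eventually_ge_at_top[of 3]
  proof eventually_elim
    case (elim k)
    then have "(real (t k) + 2) / real k < 1" by (simp add: add_divide_distrib)
    then have "real (t k) + 2 < real k" using elim(2) by (simp add: divide_less_eq)
    then show ?case using elim(2) by linarith
  qed
  have "(\<lambda>k. 1 - (real (t k) / real k) * (real (t k) / real k - 1 / real k) / (1 - 1 / real k))
     \<longlonglongrightarrow> 1 - s * (s - 0) / (1 - 0)"
    by (intro tendsto_intros lim inverse_real_tendsto_0) simp
  then have "(\<lambda>k. 1 - (real (t k) / real k) * (real (t k) / real k - 1 / real k) / (1 - 1 / real k))
     \<longlonglongrightarrow> 1 - s^2" by (simp add: power2_eq_square)
  then have sh: "(\<lambda>k. shadow_density (semibip (t k) k)) \<longlonglongrightarrow> 1 - s^2"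
  proof (rule Lim_transform_eventually)
    show "\<forall>\<^sub>F k in sequentially. 1 - (real (t k) / real k) * (real (t k) / real k - 1 / real k) / (1 - 1 / real k)
       = shadow_density (semibip (t k) k)"
      using ev
    proof eventually_elim
      case (elim k)
      have c: "real (card (shadow (semibip (t k) k))) = real (k choose 2) - real (t k choose 2)"
        using elim by (intro card_semibip_shadow) (auto simp: t_def)
      have ne: "real k \<noteq> 0" "real k - 1 \<noteq> 0" using elim by auto
      have e: "real (t k) / real k - 1 / real k = (real (t k) - 1) / real k" "1 - 1 / real k = (real k - 1) / real k"
        using ne by (simp_all add: diff_divide_distrib)
      have frac: "1 - a / m * (b / m) / (p / m) = (m * p / 2 - a * b / 2) / (m * p / 2)"
        if "m \<noteq> 0" "p \<noteq> 0" for a b m p :: real using that by (simp add: field_simps)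
      have "card (fst (semibip (t k) k)) = k" unfolding semibip_def by simp
      then show ?case unfolding shadow_density_def c real_choose_2 e using frac[OF ne] by simp
    qed
  qed
  have "(\<lambda>k. 3 * (real (t k) / real k) * (1 - real (t k) / real k) * (1 - real (t k) / real k - 1 / real k)
      / ((1 - 1 / real k) * (1 - 2 / real k))) \<longlonglongrightarrow> 3 * s * (1 - s) * (1 - s - 0) / ((1 - 0) * (1 - 0))"
    by (intro tendsto_intros lim inverse_real_tendsto_0) simp
  then have "(\<lambda>k. 3 * (real (t k) / real k) * (1 - real (t k) / real k) * (1 - real (t k) / real k - 1 / real k)
      / ((1 - 1 / real k) * (1 - 2 / real k))) \<longlonglongrightarrow> 3 * s * (1 - s)^2"
    by (simp add: power2_eq_square mult.assoc)
  then have ed: "(\<lambda>k. edge_density (semibip (t k) k)) \<longlonglongrightarrow> 3 * s * (1 - s)^2"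
  proof (rule Lim_transform_eventually)
    show "\<forall>\<^sub>F k in sequentially. 3 * (real (t k) / real k) * (1 - real (t k) / real k) * (1 - real (t k) / real k - 1 / real k)
      / ((1 - 1 / real k) * (1 - 2 / real k)) = edge_density (semibip (t k) k)"
      using ev
    proof eventually_elim
      case (elim k)
      have m: "real (k - t k) = real k - real (t k)" using elim by auto
      have ne: "real k \<noteq> 0" "real k - 1 \<noteq> 0" "real k - 2 \<noteq> 0" using elim by auto
      have e: "1 - real (t k) / real k = (real k - real (t k)) / real k"
        "(real k - real (t k)) / real k - 1 / real k = (real k - real (t k) - 1) / real k"
        "1 - 1 / real k = (real k - 1) / real k" "1 - 2 / real k = (real k - 2) / real k"
        using ne by (simp_all add: diff_divide_distrib)
      have frac: "3 * (a / m) * (b / m) * (c / m) / ((p / m) * (q / m)) = a * (b * c / 2) / (m * p * q / 6)"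
        if "m \<noteq> 0" "p \<noteq> 0" "q \<noteq> 0" for a b c m p q :: real using that by (simp add: field_simps)
      have "card (fst (semibip (t k) k)) = k" unfolding semibip_def by simp
      then show ?case
        unfolding edge_density_def card_semibip_edges of_nat_mult real_choose_2 m e
        using frac[OF ne] by (simp only: real_choose_3)
    qed
  qed
  have "0 \<le> s^2" "s^2 \<le> 1" using s by (simp_all add: power_le_one)
  moreover have "0 \<le> 3 * s * (1 - s)^2" using s by simp
  moreover have "3 * s * (1 - s)^2 \<le> 1" using star_value_le[of s 0] s by simp
  ultimately have "1 - s^2 \<in> {0..1}" "3 * s * (1 - s)^2 \<in> {0..1}" by simp_all
  moreover have "filterlim (\<lambda>k. card (fst (semibip (t k) k))) at_top sequentially"
    unfolding semibip_def by (simp add: filterlim_ident)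
  moreover have "\<forall>k. hg3 (semibip (t k) k) \<and> hfree Mfam (semibip (t k) k)"
    using hg3_semibip semibip_free by simp
  ultimately show ?thesis
    unfolding feasible_region_def mem_Collect_eq case_prod_conv
    using sh ed by (intro conjI exI[of _ "\<lambda>k. semibip (t k) k"])
qed

text \<open>The endpoint \<open>s = 1\<close> of the semibipartite curve, where the second side is
  too small for the shadow count; edgeless 3-graphs supply it.\<close>

lemma empty_feasible: "(0, 0) \<in> feasible_region Mfam"
proof -
  have e: "snd (semibip k k) = {}" "fst (semibip k k) = {0..<k}" for k unfolding semibip_def by auto
  have sh: "shadow (semibip k k) = {}" for k unfolding shadow_def e by simp
  show ?thesis unfolding feasible_region_def
    by (auto intro!: exI[of _ "\<lambda>k. semibip k k"] simp: hg3_semibip semibip_free e sh filterlim_ident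
        shadow_density_def edge_density_def)
qed

section \<open>Balanced blowups of \<open>G26\<close> and the point
  \<open>(5/6, 4/9)\<close>\<close>

definition balanced_col :: "nat \<Rightarrow> nat" where
  "balanced_col a = Suc (a mod 6)"

text \<open>Restricting to \<open>6 * k\<close> vertices makes all classes equal, so the Lagrangian
  bound is attained exactly and the maximality demanded by \<open>G2\<close> is an exact
  computation.\<close>

definition balanced_G26 :: "nat \<Rightarrow> hg" where
  "balanced_G26 k = ({0..<6 * k}, {e. e \<subseteq> {0..<6 * k} \<and> card e = 3 \<and> balanced_col ` e \<in> G26_edges})"

text \<open>A triple with pairwise different colours has distinct vertices, so counting edges is
  evaluating the trilinear form of \<open>G26\<close> at the class sizes; both sides count each edge
  6 times.\<close>

lemma blowup_edge_count:
  assumes "\<phi> ` {0..<n} = {1..6}"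
  defines "N \<equiv> (\<lambda>i. real (card {a \<in> {0..<n}. \<phi> a = i}))"
  shows "real (card {e. e \<subseteq> {0..<n} \<and> card e = 3 \<and> \<phi> ` e \<in> G26_edges}) =
           G26_poly (N 1) (N 2) (N 3) (N 4) (N 5) (N 6)"
    and "N 1 + N 2 + N 3 + N 4 + N 5 + N 6 = real n"
proof -
  let ?V = "{0..<n}" and ?E = "{e. e \<subseteq> {0..<n} \<and> card e = 3 \<and> \<phi> ` e \<in> G26_edges}"
  have iff: "{a, b, c} \<in> ?E \<longleftrightarrow> {\<phi> a, \<phi> b, \<phi> c} \<in> G26_edges" if "a \<in> ?V" "b \<in> ?V" "c \<in> ?V" for a b c
  proof
    assume h: "{\<phi> a, \<phi> b, \<phi> c} \<in> G26_edges"
    then have "\<phi> a \<noteq> \<phi> b" "\<phi> a \<noteq> \<phi> c" "\<phi> b \<noteq> \<phi> c" unfolding G26_edge_iff by blast+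
    then have "card {a, b, c} = 3" unfolding card3_distinct by blast
    then show "{a, b, c} \<in> ?E" using h that by simp
  qed simp
  have N: "N i = (\<Sum>a\<in>{a \<in> ?V. \<phi> a = i}. 1)" for i unfolding N_def by simp
  have "6 * real (card ?E) = (\<Sum>a\<in>?V. \<Sum>b\<in>?V. \<Sum>c\<in>?V. of_bool ({a, b, c} \<in> ?E))"
    by (rule tri_count[symmetric]) auto
  also have "\<dots> = (\<Sum>a\<in>?V. \<Sum>b\<in>?V. \<Sum>c\<in>?V. of_bool ({\<phi> a, \<phi> b, \<phi> c} \<in> G26_edges) * (1 * 1 * 1))"
    by (intro sum.cong refl) (simp only: iff mult_1_right)
  also have "\<dots> = tri G26_edges {1..6} N N N"
    unfolding tri_def N using assms(1) by (intro sum_push3) auto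
  finally show "real (card ?E) = G26_poly (N 1) (N 2) (N 3) (N 4) (N 5) (N 6)" unfolding tri_G26 by simp
  have "(\<Sum>i\<in>{1..6}. N i) = (\<Sum>a\<in>?V. 1)"
    unfolding N by (rule sum.group) (use assms(1) in auto)
  then show "N 1 + N 2 + N 3 + N 4 + N 5 + N 6 = real n" unfolding set_1_6 by (simp add: add.assoc)
qed

lemma G26_poly_homogeneous_le:
  fixes x1 x2 x3 x4 x5 x6 n :: real
  assumes s: "x1 + x2 + x3 + x4 + x5 + x6 = n" and n: "0 < n"
    and nn: "0 \<le> x1" "0 \<le> x2" "0 \<le> x3" "0 \<le> x4" "0 \<le> x5" "0 \<le> x6"
  shows "G26_poly x1 x2 x3 x4 x5 x6 \<le> 2 / 27 * n^3"
proof -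
  have hom: "G26_poly (r * a) (r * b) (r * c) (r * d) (r * e) (r * f) = r^3 * G26_poly a b c d e f"
    for r a b c d e f :: real unfolding G26_poly_def by (simp add: algebra_simps power3_eq_cube)
  have "G26_poly (x1 / n) (x2 / n) (x3 / n) (x4 / n) (x5 / n) (x6 / n) \<le> 2 / 27"
    by (rule G26_poly_le) (use assms in \<open>simp_all add: add_divide_distrib[symmetric]\<close>)
  then have "n^3 * G26_poly (x1 / n) (x2 / n) (x3 / n) (x4 / n) (x5 / n) (x6 / n) \<le> n^3 * (2 / 27)"
    using n by (intro mult_left_mono) auto
  then show ?thesis unfolding hom[symmetric] using n by simp
qed

lemma balanced_col_card:
  assumes "i \<in> {1..6}"
  shows "card {a \<in> {0..<6 * k}. balanced_col a = i} = k"
proof -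
  obtain r where r: "i = Suc r" "r < 6" using assms by (cases i) auto
  have "{a \<in> {0..<6 * k}. balanced_col a = i} = (\<lambda>j. 6 * j + r) ` {..<k}"
  proof (rule set_eqI)
    fix a
    show "a \<in> {a \<in> {0..<6 * k}. balanced_col a = i} \<longleftrightarrow> a \<in> (\<lambda>j. 6 * j + r) ` {..<k}"
    proof
      assume "a \<in> {a \<in> {0..<6 * k}. balanced_col a = i}"
      then have "a < 6 * k" "a mod 6 = r" unfolding balanced_col_def r by auto
      then have "a = 6 * (a div 6) + r" "a div 6 < k" by auto
      then show "a \<in> (\<lambda>j. 6 * j + r) ` {..<k}" by blast
    next
      assume "a \<in> (\<lambda>j. 6 * j + r) ` {..<k}"
      then obtain j where "j < k" "a = 6 * j + r" by blast
      then show "a \<in> {a \<in> {0..<6 * k}. balanced_col a = i}"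
        unfolding balanced_col_def r using r(2) by auto
    qed
  qed
  moreover have "inj_on (\<lambda>j. 6 * j + r) {..<k}" by (rule inj_onI) simp
  ultimately show ?thesis by (simp add: card_image)
qed

lemma balanced_col_surj:
  assumes "1 \<le> k"
  shows "balanced_col ` {0..<6 * k} = {1..6}"
proof
  show "balanced_col ` {0..<6 * k} \<subseteq> {1..6}" unfolding balanced_col_def by (auto simp: Suc_le_eq)
  show "{1..6} \<subseteq> balanced_col ` {0..<6 * k}"
  proof
    fix i :: nat assume "i \<in> {1..6}"
    then have "balanced_col (i - 1) = i" "i - 1 \<in> {0..<6 * k}"
      unfolding balanced_col_def using assms by auto
    then show "i \<in> balanced_col ` {0..<6 * k}" by (metis imageI)
  qed
qed

lemma balanced_G26_blowup: "1 \<le> k \<Longrightarrow> blowup_G26 (6 * k) (balanced_G26 k)"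
  unfolding blowup_G26_def balanced_G26_def using balanced_col_surj by blast

lemma card_balanced_G26:
  assumes "1 \<le> k"
  shows "real (card (snd (balanced_G26 k))) = 16 * real k ^ 3"
proof -
  note c = balanced_col_card[of _ k]
  have m: "1 \<in> {1..6::nat}" "2 \<in> {1..6::nat}" "3 \<in> {1..6::nat}" "4 \<in> {1..6::nat}"
    "5 \<in> {1..6::nat}" "6 \<in> {1..6::nat}" by simp_all
  have "real (card (snd (balanced_G26 k))) = G26_poly (real k) (real k) (real k) (real k) (real k) (real k)"
    unfolding balanced_G26_def snd_conv blowup_edge_count(1)[OF balanced_col_surj[OF assms]]
    by (simp only: c[OF m(1)] c[OF m(2)] c[OF m(3)] c[OF m(4)] c[OF m(5)] c[OF m(6)])
  then show ?thesis by (simp add: G26_poly_def power3_eq_cube)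
qed

text \<open>The count \<open>16 * k^3\<close> equals \<open>2/27 * (6 * k)^3\<close>, the Lagrangian
  bound for every blowup on \<open>6 * k\<close> vertices. Maximality matters because
  \<open>M3\<close> refers to edge-maximal blowups only.\<close>

lemma balanced_G26_G2:
  assumes "1 \<le> k"
  shows "G2 (6 * k) (balanced_G26 k)"
  unfolding G2_def
proof (intro conjI allI impI)
  fix H assume "blowup_G26 (6 * k) H"
  then obtain \<phi> where \<phi>: "\<phi> ` {0..<6 * k} = {1..6}"
    "H = ({0..<6 * k}, {e. e \<subseteq> {0..<6 * k} \<and> card e = 3 \<and> \<phi> ` e \<in> G26_edges})"
    unfolding blowup_G26_def by blast
  have "real (card (snd H)) \<le> 2 / 27 * real (6 * k)^3"
    unfolding \<phi>(2) snd_conv blowup_edge_count(1)[OF \<phi>(1)]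
    by (rule G26_poly_homogeneous_le[OF blowup_edge_count(2)[OF \<phi>(1)]]) (use assms in auto)
  also have "\<dots> = real (card (snd (balanced_G26 k)))"
    unfolding card_balanced_G26[OF assms] by (simp add: power_mult_distrib)
  finally show "card (snd H) \<le> card (snd (balanced_G26 k))" by simp
qed (rule balanced_G26_blowup[OF assms])

lemma hg3_balanced_G26: "hg3 (balanced_G26 k)"
  unfolding hg3_def balanced_G26_def by simp

text \<open>A colouring is injective on the five vertices and misses one colour. Exactly two of the
  four non-edges of \<open>G26\<close> avoid a given colour, and both would have to be the image of
  the only missing triple of \<open>K5minus\<close>.\<close>

lemma K5minus_not_G26_col: "\<not> G26_col \<psi> K5minus"
proof
  assume c: "G26_col \<psi> K5minus"
  have inj: "inj_on \<psi> {0..<5}" using G26_col_core_inj[OF hg3_K5minus c K5minus_core] .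
  have sub: "\<psi> ` {0..<5} \<subseteq> {1..6}" using c unfolding G26_col_def K5minus_def by auto
  have only: "m = \<psi> ` {0, 1, 2}" if m: "m \<subseteq> \<psi> ` {0..<5}" "card m = 3" "m \<notin> G26_edges" for m
  proof -
    obtain e where e: "e \<subseteq> {0..<5}" "m = \<psi> ` e" using m(1) by (auto simp: subset_image_iff)
    then have "card e = 3" using m(2) inj by (metis card_image inj_on_subset)
    then have "e = {0, 1, 2}" using c m(3) e unfolding G26_col_def K5minus_def by auto
    then show ?thesis using e by simp
  qed
  have "card (\<psi> ` {0..<5}) = 5" using card_image[OF inj] by simp
  then have "\<psi> ` {0..<5} \<noteq> {1..6}" by auto
  then obtain i where i: "i \<in> {1..6}" "i \<notin> \<psi> ` {0..<5}" using sub by blast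
  have "\<psi> ` {0..<5} = {1..6} - {i}"
    using i sub \<open>card (\<psi> ` {0..<5}) = 5\<close> by (intro card_subset_eq) auto
  then have mem: "m = \<psi> ` {0, 1, 2}" if "m \<subseteq> {1..6} - {i}" "m \<in> {{1,2,3}, {1,2,6}, {3,4,5}, {4,5,6}}" for m
  proof (intro only)
    show "card m = 3" using that(2) by (elim insertE emptyE) simp_all
    show "m \<notin> G26_edges" using that(2) unfolding G26_edges_def by blast
  qed (use that(1) in simp)
  have ne: "{1,2,3} \<noteq> {1,2,6::nat}" "{3,4,5} \<noteq> {4,5,6::nat}" "{1,2,6} \<noteq> {4,5,6::nat}" "{1,2,3} \<noteq> {3,4,5::nat}"
    by (rule notI, drule equalityD1, simp)+
  have "i = 1 \<or> i = 2 \<or> i = 3 \<or> i = 4 \<or> i = 5 \<or> i = 6" using i(1) by auto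
  then consider "i \<in> {1, 2}" | "i \<in> {4, 5}" | "i = 3" | "i = 6" by blast
  then show False
  proof cases
    case 1
    have "{3,4,5} = \<psi> ` {0, 1, 2}" by (rule mem, use 1 in force, simp only: insert_iff simp_thms)
    moreover have "{4,5,6} = \<psi> ` {0, 1, 2}" by (rule mem, use 1 in force, simp only: insert_iff simp_thms)
    ultimately show False using ne(2) by (simp only: simp_thms)
  next
    case 2
    have "{1,2,3} = \<psi> ` {0, 1, 2}" by (rule mem, use 2 in force, simp only: insert_iff simp_thms)
    moreover have "{1,2,6} = \<psi> ` {0, 1, 2}" by (rule mem, use 2 in force, simp only: insert_iff simp_thms)
    ultimately show False using ne(1) by (simp only: simp_thms)
  next
    case 3
    have "{1,2,6} = \<psi> ` {0, 1, 2}" by (rule mem, use 3 in force, simp only: insert_iff simp_thms)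
    moreover have "{4,5,6} = \<psi> ` {0, 1, 2}" by (rule mem, use 3 in force, simp only: insert_iff simp_thms)
    ultimately show False using ne(3) by (simp only: simp_thms)
  next
    case 4
    have "{1,2,3} = \<psi> ` {0, 1, 2}" by (rule mem, use 4 in force, simp only: insert_iff simp_thms)
    moreover have "{3,4,5} = \<psi> ` {0, 1, 2}" by (rule mem, use 4 in force, simp only: insert_iff simp_thms)
    ultimately show False using ne(4) by (simp only: simp_thms)
  qed
qed

text \<open>A forbidden subgraph would inherit a colouring. \<open>K5minus\<close> has none, a core
  on seven vertices cannot be injectively coloured with six colours, and members of
  \<open>M3\<close> are not contained in any \<open>G2\<close>.\<close>

lemma balanced_G26_free:
  assumes "1 \<le> k"
  shows "hfree Mfam (balanced_G26 k)"
  unfolding hfree_def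
proof (intro notI, elim bexE)
  fix F assume F: "F \<in> Mfam" "contained F (balanced_G26 k)"
  note h = Mfam_hg3[OF F(1)]
  obtain \<phi> where "G26_col \<phi> (balanced_G26 k)" using blowup_G26_col[OF balanced_G26_blowup[OF assms]] by blast
  then obtain \<psi> where \<psi>: "G26_col \<psi> F" using G26_col_contained[OF F(2)] by blast
  consider "F = K5minus" | "F \<in> M2" | "F \<in> M3" using F(1) unfolding Mfam_def by blast
  then show False
  proof cases
    case 1
    then show False using \<psi> K5minus_not_G26_col by blast
  next
    case 2
    then obtain S where S: "is_core F S 7" unfolding M2_def by blast
    have "inj_on \<psi> S" by (rule G26_col_core_inj[OF h \<psi> S])
    then have "card (\<psi> ` S) = 7" using S unfolding is_core_def by (simp add: card_image)
    moreover have "\<psi> ` S \<subseteq> {1..6}" using \<psi> S unfolding is_core_def G26_col_def by blast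
    then have "card (\<psi> ` S) \<le> card {1..6::nat}" by (intro card_mono) auto
    ultimately show False by simp
  next
    case 3
    have "6 \<le> 6 * k" using assms by simp
    then show False using 3 balanced_G26_G2[OF assms] F(2) unfolding M3_def by blast
  qed
qed

text \<open>Any two colours lie in an edge of \<open>G26\<close>, so the shadow is complete
  6-partite with classes of size \<open>k\<close>: 15 pairs of classes with \<open>k^2\<close> pairs
  each.\<close>

lemma card_balanced_G26_shadow:
  assumes "1 \<le> k"
  shows "real (card (shadow (balanced_G26 k))) = 15 * real k ^ 2"
proof -
  let ?V = "{0..<6 * k}"
  have fstV: "fst (balanced_G26 k) = ?V" unfolding balanced_G26_def by simp
  have iff: "{a, b} \<in> shadow (balanced_G26 k) \<longleftrightarrow> balanced_col a \<noteq> balanced_col b"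
    if ab: "a \<in> ?V" "b \<in> ?V" for a b
    unfolding in_shadow_iff[OF hg3_balanced_G26]
  proof
    assume "a \<noteq> b \<and> covered (balanced_G26 k) a b"
    then obtain e where e: "e \<in> snd (balanced_G26 k)" "{a, b} \<subseteq> e" "a \<noteq> b" unfolding covered_def by blast
    have "G26_col balanced_col (balanced_G26 k)"
      unfolding G26_col_def using balanced_col_surj[OF assms] unfolding balanced_G26_def by auto
    from G26_col_inj_edge[OF hg3_balanced_G26 this e(1)] show "balanced_col a \<noteq> balanced_col b"
      using e unfolding inj_on_def by auto
  next
    assume ne: "balanced_col a \<noteq> balanced_col b"
    have "balanced_col a \<in> {1..6}" "balanced_col b \<in> {1..6}" using balanced_col_surj[OF assms] ab by blast+
    then obtain l where l: "l \<in> {1..6}" "{balanced_col a, balanced_col b, l} \<in> G26_edges"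
      using G26_pair_covered ne by blast
    then obtain c where c: "c \<in> ?V" "balanced_col c = l" using balanced_col_surj[OF assms] by (metis imageE)
    have im: "balanced_col ` {a, b, c} \<in> G26_edges" using l c by simp
    then have "balanced_col a \<noteq> balanced_col c" "balanced_col b \<noteq> balanced_col c"
      using G26_edge_iff[of "balanced_col a" "balanced_col b" "balanced_col c"] by auto
    then have "card {a, b, c} = 3" using ne unfolding card3_distinct by auto
    then have "{a, b, c} \<in> snd (balanced_G26 k)" unfolding balanced_G26_def using im ab c(1) by simp
    then show "a \<noteq> b \<and> covered (balanced_G26 k) a b" using ne unfolding covered_def by auto
  qed
  have "2 * real (card (shadow (balanced_G26 k))) = (\<Sum>a\<in>?V. \<Sum>b\<in>?V. of_bool ({a, b} \<in> shadow (balanced_G26 k)))"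
    by (rule bil_count[symmetric]) (auto simp: shadow_def fstV)
  also have "\<dots> = (\<Sum>a\<in>?V. \<Sum>b\<in>?V. of_bool (balanced_col a \<noteq> balanced_col b))"
    by (intro sum.cong refl) (simp only: iff)
  also have "\<dots> = (\<Sum>a\<in>?V. 5 * real k)"
  proof (rule sum.cong[OF refl])
    fix a assume a: "a \<in> ?V"
    have "balanced_col a \<in> {1..6}" using balanced_col_surj[OF assms] a by blast
    then have cd: "card {b \<in> ?V. balanced_col b = balanced_col a} = k" by (rule balanced_col_card)
    have "(\<Sum>b\<in>?V. of_bool (balanced_col a \<noteq> balanced_col b) :: real) =
       (\<Sum>b\<in>?V. 1 - of_bool (balanced_col b = balanced_col a))" by (intro sum.cong) auto
    also have "\<dots> = real (6 * k) - (\<Sum>b\<in>?V. of_bool (balanced_col b = balanced_col a))"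
      by (simp add: sum_subtractf)
    also have "(\<Sum>b\<in>?V. of_bool (balanced_col b = balanced_col a) :: real) =
       real (card {b \<in> ?V. balanced_col b = balanced_col a})"
      by (simp add: of_bool_def sum.If_cases Int_def)
    finally show "(\<Sum>b\<in>?V. of_bool (balanced_col a \<noteq> balanced_col b) :: real) = 5 * real k"
      unfolding cd by simp
  qed
  finally show ?thesis by (simp add: power2_eq_square)
qed

lemma balanced_G26_feasible: "(5 / 6, 4 / 9) \<in> feasible_region Mfam"
proof -
  define B where "B = (\<lambda>j. balanced_G26 (Suc j))"
  have n: "card (fst (B j)) = 6 * Suc j" for j unfolding B_def balanced_G26_def by simp
  define \<iota> where "\<iota> = (\<lambda>j. 1 / real (Suc j))"
  have \<iota>: "\<iota> \<longlonglongrightarrow> 0" unfolding \<iota>_def using LIMSEQ_Suc[OF inverse_real_tendsto_0[of 1]] .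
  have sd: "shadow_density (B j) = 5 / (6 - \<iota> j)" for j
  proof -
    define r where "r = real (Suc j)"
    have r: "r \<ge> 1" unfolding r_def by simp
    have nr: "real (card (fst (B j))) = 6 * r" unfolding n r_def by simp
    have sr: "real (card (shadow (B j))) = 15 * r^2"
      unfolding B_def r_def by (rule card_balanced_G26_shadow) simp
    have "shadow_density (B j) = 15 * r^2 / (6 * r * (6 * r - 1) / 2)"
      unfolding shadow_density_def real_choose_2 nr sr ..
    also have "\<dots> = 5 * r / (6 * r - 1)" using r by (simp add: field_simps power2_eq_square)
    also have "\<dots> = 5 / (6 - 1 / r)" using r by (simp add: field_simps)
    finally show ?thesis unfolding \<iota>_def r_def .
  qed
  have ed: "edge_density (B j) = 16 / ((6 - \<iota> j) * (6 - 2 * \<iota> j))" for j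
  proof -
    define r where "r = real (Suc j)"
    have r: "r \<ge> 1" unfolding r_def by simp
    have e: "6 - 1 / r = (6 * r - 1) / r" "6 - 2 * (1 / r) = (6 * r - 2) / r" using r by (simp_all add: field_simps)
    have frac: "16 * r^3 / (6 * r * p * q / 6) = 16 / ((p / r) * (q / r))" if "p \<noteq> 0" "q \<noteq> 0" for p q
      using that r by (simp add: field_simps power3_eq_cube)
    have nr: "real (card (fst (B j))) = 6 * r" unfolding n r_def by simp
    have sr: "real (card (snd (B j))) = 16 * r^3"
      unfolding B_def r_def by (rule card_balanced_G26) simp
    have "edge_density (B j) = 16 * r^3 / (6 * r * (6 * r - 1) * (6 * r - 2) / 6)"
      unfolding edge_density_def real_choose_3 nr sr ..
    also have "\<dots> = 16 / ((6 - 1 / r) * (6 - 2 * (1 / r)))" unfolding e using r by (intro frac) auto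
    finally show ?thesis unfolding \<iota>_def r_def .
  qed
  have "(\<lambda>j. 5 / (6 - \<iota> j)) \<longlonglongrightarrow> 5 / (6 - 0)" by (intro tendsto_intros \<iota>) simp
  then have l1: "(\<lambda>j. shadow_density (B j)) \<longlonglongrightarrow> 5 / 6" unfolding sd by simp
  have "(\<lambda>j. 16 / ((6 - \<iota> j) * (6 - 2 * \<iota> j))) \<longlonglongrightarrow> 16 / ((6 - 0) * (6 - 2 * 0))"
    by (intro tendsto_intros \<iota>) simp
  then have l2: "(\<lambda>j. edge_density (B j)) \<longlonglongrightarrow> 4 / 9" unfolding ed by simp
  have l3: "filterlim (\<lambda>j. card (fst (B j))) at_top sequentially"
    unfolding n by (rule filterlim_at_top_mono[OF filterlim_ident]) auto
  have "\<forall>j. hg3 (B j) \<and> hfree Mfam (B j)" unfolding B_def using hg3_balanced_G26 balanced_G26_free by simp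
  then show ?thesis
    unfolding feasible_region_def mem_Collect_eq case_prod_conv
    using l1 l2 l3 by (intro conjI exI[of _ B]) simp_all
qed

section \<open>The feasible region\<close>

text \<open>A diagonal argument: for each \<open>k\<close>, one sufficiently large 3-graph is taken
  from a sequence for some \<open>y\<close> within \<open>1 / (k + 1)\<close> of the supremum. The
  supremum is therefore attained, so \<open>GREATEST\<close> in \<open>feasible_g\<close> denotes a
  true maximum.\<close>

lemma feasible_region_Sup:
  assumes "(x, y0) \<in> feasible_region Fam"
  defines "Y \<equiv> {y. (x, y) \<in> feasible_region Fam}"
  shows "(x, Sup Y) \<in> feasible_region Fam" "\<And>y. (x, y) \<in> feasible_region Fam \<Longrightarrow> y \<le> Sup Y"
proof -
  define s where "s = Sup Y"
  have Y01: "y \<in> {0..1}" if "y \<in> Y" for y using that unfolding Y_def feasible_region_def by auto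
  have bdd: "bdd_above Y" using Y01 by (intro bdd_aboveI[of _ 1]) auto
  have y0: "y0 \<in> Y" using assms(1) unfolding Y_def by simp
  have ub: "y \<le> s" if "y \<in> Y" for y unfolding s_def using cSup_upper[OF that bdd] .
  show "y \<le> Sup Y" if "(x, y) \<in> feasible_region Fam" for y using ub[of y] that unfolding s_def Y_def by simp
  have s01: "s \<in> {0..1}"
  proof -
    have "s \<le> 1" unfolding s_def using y0 Y01 by (intro cSup_least) auto
    moreover have "0 \<le> s" using ub[OF y0] Y01[OF y0] by simp
    ultimately show ?thesis by simp
  qed
  have x01: "x \<in> {0..1}" using assms(1) unfolding feasible_region_def by auto
  have ex: "\<exists>H. hg3 H \<and> hfree Fam H \<and> k \<le> card (fst H) \<and> dist (shadow_density H) x < 1 / real (Suc k) \<and>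
      dist (edge_density H) s < 2 / real (Suc k)" for k
  proof -
    have "s - 1 / real (Suc k) < Sup Y" unfolding s_def by simp
    then obtain y where y: "y \<in> Y" "s - 1 / real (Suc k) < y"
      using less_cSup_iff[OF _ bdd] y0 by blast
    then obtain Hs :: "nat \<Rightarrow> hg" where Hs: "\<forall>k. hg3 (Hs k) \<and> hfree Fam (Hs k)"
      "filterlim (\<lambda>k. card (fst (Hs k))) at_top sequentially"
      "(\<lambda>k. shadow_density (Hs k)) \<longlonglongrightarrow> x" "(\<lambda>k. edge_density (Hs k)) \<longlonglongrightarrow> y"
      unfolding Y_def feasible_region_def by blast
    have pos: "0 < 1 / real (Suc k)" by simp
    have "\<forall>\<^sub>F j in sequentially. k \<le> card (fst (Hs j))" using Hs(2) unfolding filterlim_at_top by blast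
    moreover have "\<forall>\<^sub>F j in sequentially. dist (shadow_density (Hs j)) x < 1 / real (Suc k)"
      by (rule tendstoD[OF Hs(3) pos])
    moreover have "\<forall>\<^sub>F j in sequentially. dist (edge_density (Hs j)) y < 1 / real (Suc k)"
      by (rule tendstoD[OF Hs(4) pos])
    ultimately have "\<forall>\<^sub>F j in sequentially. k \<le> card (fst (Hs j)) \<and>
        dist (shadow_density (Hs j)) x < 1 / real (Suc k) \<and> dist (edge_density (Hs j)) y < 1 / real (Suc k)"
      by eventually_elim blast
    then obtain j where j: "k \<le> card (fst (Hs j))" "dist (shadow_density (Hs j)) x < 1 / real (Suc k)"
      "dist (edge_density (Hs j)) y < 1 / real (Suc k)"
      using eventually_happens'[OF sequentially_bot] by blast
    have "dist y s < 1 / real (Suc k)" using y ub[OF y(1)] unfolding dist_real_def by simp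
    then have "dist (edge_density (Hs j)) s < 1 / real (Suc k) + 1 / real (Suc k)"
      using j(3) dist_triangle[of "edge_density (Hs j)" s y] by linarith
    then have "dist (edge_density (Hs j)) s < 2 / real (Suc k)" by simp
    then show ?thesis using Hs(1) j by blast
  qed
  define H where "H = (\<lambda>k. SOME H. hg3 H \<and> hfree Fam H \<and> k \<le> card (fst H) \<and>
      dist (shadow_density H) x < 1 / real (Suc k) \<and> dist (edge_density H) s < 2 / real (Suc k))"
  have H: "hg3 (H k)" "hfree Fam (H k)" "k \<le> card (fst (H k))"
    "dist (shadow_density (H k)) x < 1 / real (Suc k)" "dist (edge_density (H k)) s < 2 / real (Suc k)" for k
    using someI_ex[OF ex[of k]] unfolding H_def by blast+
  have z: "(\<lambda>k. c / real (Suc k)) \<longlonglongrightarrow> 0" for c using LIMSEQ_Suc[OF inverse_real_tendsto_0[of c]] .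
  have "filterlim (\<lambda>k. card (fst (H k))) at_top sequentially"
    by (rule filterlim_at_top_mono[OF filterlim_ident]) (use H(3) in auto)
  moreover have "(\<lambda>k. shadow_density (H k)) \<longlonglongrightarrow> x"
    by (rule metric_tendsto_imp_tendsto[OF z[of 1]])
      (use H(4) in \<open>auto simp: dist_real_def intro!: always_eventually less_imp_le\<close>)
  moreover have "(\<lambda>k. edge_density (H k)) \<longlonglongrightarrow> s"
    by (rule metric_tendsto_imp_tendsto[OF z[of 2]])
      (use H(5) in \<open>auto simp: dist_real_def intro!: always_eventually less_imp_le\<close>)
  ultimately show "(x, Sup Y) \<in> feasible_region Fam"
    unfolding s_def[symmetric] feasible_region_def using x01 s01 H(1,2) by blast
qed

lemma feasible_g_greatest:
  assumes "(x, y0) \<in> feasible_region Fam"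
  shows "(x, feasible_g Fam x) \<in> feasible_region Fam"
    and "(x, y) \<in> feasible_region Fam \<Longrightarrow> y \<le> feasible_g Fam x"
proof -
  note S = feasible_region_Sup[OF assms]
  have "feasible_g Fam x = Sup {y. (x, y) \<in> feasible_region Fam}"
    unfolding feasible_g_def by (rule Greatest_equality) (use S in auto)
  then show "(x, feasible_g Fam x) \<in> feasible_region Fam"
    "(x, y) \<in> feasible_region Fam \<Longrightarrow> y \<le> feasible_g Fam x" using S by auto
qed

lemma Mfam_feasible:
  assumes "x \<in> {0..1}"
  shows "\<exists>y. (x, y) \<in> feasible_region Mfam"
proof (cases "x = 0")
  case True
  then show ?thesis using empty_feasible by blast
next
  case False
  have "0 \<le> sqrt (1 - x)" "sqrt (1 - x) < 1" "1 - (sqrt (1 - x))^2 = x" using False assms by auto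
  then show ?thesis using semibip_feasible[of "sqrt (1 - x)"] by auto
qed

theorem theorem1p14:
  shows "proj_region Mfam = {0..1} \<and>
         (\<forall>x\<in>{0..1::real}. feasible_g Mfam x \<le> 4/9) \<and>
         (\<forall>x\<in>{0..1::real}. feasible_g Mfam x = 4/9 \<longleftrightarrow> x \<in> {5/6, 8/9})"
proof (intro conjI ballI)
  have "proj_region Mfam \<subseteq> {0..1}" unfolding proj_region_def feasible_region_def by auto
  then show "proj_region Mfam = {0..1}" using Mfam_feasible unfolding proj_region_def by blast
next
  fix x :: real assume x: "x \<in> {0..1}"
  obtain y0 where y0: "(x, y0) \<in> feasible_region Mfam" using Mfam_feasible[OF x] by blast
  note g = feasible_g_greatest[OF y0]
  show le: "feasible_g Mfam x \<le> 4/9" by (rule feasible_le[OF g(1)])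
  show "feasible_g Mfam x = 4/9 \<longleftrightarrow> x \<in> {5/6, 8/9}"
  proof
    assume eq: "feasible_g Mfam x = 4/9"
    show "x \<in> {5/6, 8/9}" by (rule feasible_extremal[OF g(1)[unfolded eq]])
  next
    assume "x \<in> {5/6, 8/9}"
    moreover have "(8/9, 4/9) \<in> feasible_region Mfam"
      using semibip_feasible[of "1/3"] by (simp add: power2_eq_square)
    ultimately have "(x, 4/9) \<in> feasible_region Mfam" using balanced_G26_feasible by blast
    then show "feasible_g Mfam x = 4/9" using g(2) le by (intro antisym)
  qed
qed

end
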